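(* Let $\lambda$ be a fixed even partition such that all zeros of $H=H_\lambda$ are simple, and let $m=\deg H=|\lambda|$. For all sufficiently large $n$ (that is, for all $n\ge n_0$ with some $n_0$ depending on $\lambda$), the Hessian $\mathbf{H}(Z)\in\mathbb{R}^{(2m+n)\times(2m+n)}$ of the logarithmic energy function $F$, evaluated at the set $Z$ of the zeros of the exceptional Hermite polynomial $P_{m,m+n}$, is nonsingular.
   Context: A partition of length $r$ is $\lambda=(\lambda_1\ge\dots\ge\lambda_r\ge 1)$, $|\lambda|=\sum_i\lambda_i$. It is even if $r$ is even and $\lambda_{2k-1}=\lambda_{2k}$ for $k=1,\dots,r/2$. With $H_j$ the classical Hermite polynomials (orthogonal with respect to $e^{-x^2}$ on $\mathbb{R}$) and $\mathrm{Wr}$ the Wronskian determinant, the generalized Hermite polynomial is $H_\lambda=\mathrm{Wr}[H_{\lambda_r},\dots,H_{\lambda_2+r-2},H_{\lambda_1+r-1}]$, of degree $|\lambda|$; for even $\lambda$ it has no real zeros. Write $H=H_\lambda$, $m=\deg H=|\lambda|$. Let $n\ge\lambda_1$. The exceptional Hermite polynomial of degree $m+n$ is $P_{m,m+n}=\mathrm{Wr}[H_{\lambda_r},\dots,H_{\lambda_2+r-2},H_{\lambda_1+r-1},H_{n+r}]$. Known: for $n$ large it has exactly $m$ non-real ("exceptional") zeros $z_k=\xi_k+i\eta_k$, $k=1,\dots,m$, and $n$ real ("regular") zeros $x_1,\dots,x_n$. $Z$ denotes the set of all these zeros. Let $w(z)=|e^{-z^2}|/|H(z)|^2$ on $\mathbb{C}$.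 The logarithmic energy function is the function of $2m+n$ real variables, with $\dot z_k=\dot\xi_k+i\dot\eta_k$, $$F(\dot\xi_1,\dot\eta_1,\dots,\dot\xi_m,\dot\eta_m,\dot x_1,\dots,\dot x_n)=\sum_{k=1}^m\log w(\dot z_k)+\sum_{i=1}^n\log w(\dot x_i)+\sum_{1\le k<l\le m}\log|\dot z_k-\dot z_l|^2+\sum_{1\le i<j\le n}\log|\dot x_i-\dot x_j|^2+\sum_{k=1}^m\sum_{i=1}^n\log|\dot x_i-\dot z_k|^2 .$$ $\mathbf{H}$ is the matrix of second partial derivatives of $F$ with the variables in the order $\dot\xi_1,\dot\eta_1,\dots,\dot\xi_m,\dot\eta_m,\dot x_1,\dots,\dot x_n$; evaluation at $Z$ means $\dot\xi_k=\xi_k$, $\dot\eta_k=\eta_k$, $\dot x_i=x_i$. *)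

theory Defs
  imports "HOL-Analysis.Derivative" "Jordan_Normal_Form.Determinant"
begin

text \<open>
  A partition is the list of its parts in weakly decreasing order. Lists are indexed from 0, so
  \<open>lam ! i\<close> is the part usually written with index \<open>i + 1\<close>.
\<close>

definition partition :: "nat list \<Rightarrow> bool" where
  "partition lam \<longleftrightarrow> sorted_wrt (\<ge>) lam \<and> (\<forall>p\<in>set lam. p \<ge> 1)"

definition even_partition :: "nat list \<Rightarrow> bool" where
  "even_partition lam \<longleftrightarrow> partition lam \<and> even (length lam) \<and>
     (\<forall>k < length lam div 2. lam ! (2 * k) = lam ! (2 * k + 1))"

text \<open>
  Hermite polynomials in the normalisation with leading coefficient \<open>2 ^ n\<close>, regarded as
  polynomials over the complex numbers.
\<close>

fun hermite :: "nat \<Rightarrow> complex poly" where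
  "hermite 0 = 1"
| "hermite (Suc 0) = [:0, 2:]"
| "hermite (Suc (Suc n)) = [:0, 2:] * hermite (Suc n) - smult (2 * of_nat (Suc n)) (hermite n)"

definition wronskian :: "complex poly list \<Rightarrow> complex poly" where
  "wronskian fs = Determinant.det
     (Matrix.mat (length fs) (length fs) (\<lambda>(i, j). (pderiv ^^ i) (fs ! j)))"

text \<open>
  The degrees \<open>lam\<^sub>r, lam\<^sub>r\<^sub>-\<^sub>1 + 1, \<dots>, lam\<^sub>1 + r - 1\<close> where \<open>r\<close> is the length of the partition.
\<close>

definition hermite_seq :: "nat list \<Rightarrow> complex poly list" where
  "hermite_seq lam = map (\<lambda>i. hermite (rev lam ! i + i)) [0..<length lam]"

definition gen_hermite :: "nat list \<Rightarrow> complex poly" where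
  "gen_hermite lam = wronskian (hermite_seq lam)"

definition exc_hermite :: "nat list \<Rightarrow> nat \<Rightarrow> complex poly" where
  "exc_hermite lam n = wronskian (hermite_seq lam @ [hermite (n + length lam)])"

definition weight :: "complex poly \<Rightarrow> complex \<Rightarrow> real" where
  "weight H z = cmod (exp (- (z ^ 2))) / (cmod (poly H z)) ^ 2"

text \<open>
  A point of the real space of dimension \<open>2 * m + n\<close> is a function on the indices below
  \<open>2 * m + n\<close>: real and imaginary part of the \<open>k\<close>-th complex variable have the indices \<open>2 * k\<close>
  and \<open>2 * k + 1\<close>, the \<open>i\<close>-th real variable has the index \<open>2 * m + i\<close>.
\<close>

definition energy :: "complex poly \<Rightarrow> nat \<Rightarrow> nat \<Rightarrow> (nat \<Rightarrow> real) \<Rightarrow> real" where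
  "energy H m n v =
    (let z = (\<lambda>k. Complex (v (2 * k)) (v (2 * k + 1)));
         x = (\<lambda>i. v (2 * m + i))
     in (\<Sum>k<m. ln (weight H (z k))) +
        (\<Sum>i<n. ln (weight H (complex_of_real (x i)))) +
        (\<Sum>l<m. \<Sum>k<l. ln ((cmod (z k - z l)) ^ 2)) +
        (\<Sum>j<n. \<Sum>i<j. ln (\<bar>x i - x j\<bar> ^ 2)) +
        (\<Sum>k<m. \<Sum>i<n. ln ((cmod (complex_of_real (x i) - z k)) ^ 2)))"

definition point_of :: "nat \<Rightarrow> (nat \<Rightarrow> complex) \<Rightarrow> (nat \<Rightarrow> real) \<Rightarrow> nat \<Rightarrow> real" where
  "point_of m z x j =
    (if j < 2 * m then (if even j then Re (z (j div 2)) else Im (z (j div 2)))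
     else x (j - 2 * m))"

definition partial :: "nat \<Rightarrow> ((nat \<Rightarrow> real) \<Rightarrow> real) \<Rightarrow> (nat \<Rightarrow> real) \<Rightarrow> real" where
  "partial j f v = deriv (\<lambda>t. f (v(j := t))) (v j)"

definition hessian :: "nat \<Rightarrow> ((nat \<Rightarrow> real) \<Rightarrow> real) \<Rightarrow> (nat \<Rightarrow> real) \<Rightarrow> real mat" where
  "hessian N f v = Matrix.mat N N (\<lambda>(i, j). partial i (partial j f) v)"

text \<open>
  The zeros of \<open>P\<close>, listed with multiplicity, are the \<open>m\<close> non-real numbers \<open>z 0, \<dots>, z (m - 1)\<close>
  and the \<open>n\<close> real numbers \<open>x 0, \<dots>, x (n - 1)\<close>.
\<close>

definition enumerates_zeros ::
  "complex poly \<Rightarrow> nat \<Rightarrow> nat \<Rightarrow> (nat \<Rightarrow> complex) \<Rightarrow> (nat \<Rightarrow> real) \<Rightarrow> bool" where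
  "enumerates_zeros P m n z x \<longleftrightarrow>
     (\<forall>k<m. z k \<notin> \<real>) \<and>
     proots P = mset (map z [0..<m]) + mset (map (\<lambda>i. complex_of_real (x i)) [0..<n])"

end

theory Submission
imports Defs "HOL-Complex_Analysis.Conformal_Mappings" "HOL-Real_Asymp.Real_Asymp"
  "HOL-Computational_Algebra.Fundamental_Theorem_Algebra"
begin

text \<open>
  Let \<open>N = n + r\<close> with \<open>r = length lam\<close>. Expanding the Wronskian along its last column and reducing the
  derivatives of \<open>h\<^sub>N = hermite N\<close> with the Hermite equation shows that, locally uniformly off the real
  axis, the exceptional polynomial equals \<open>(- 2 N)\<^sup>r\<^sup>/\<^sup>2 h\<^sub>N (H + O(N\<^sup>-\<^sup>1\<^sup>/\<^sup>2))\<close>; here \<open>|h\<^sub>N' / h\<^sub>N|\<close> is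
  comparable to \<open>N\<^sup>1\<^sup>/\<^sup>2\<close> by the Riccati equation. Since \<open>H\<close> has no real zeros, its simple zeros \<open>\<zeta>\<^sub>k\<close>
  attract one exceptional zero \<open>z\<^sub>k\<close> each, with \<open>0 < |z\<^sub>k - \<zeta>\<^sub>k| = O(N\<^sup>-\<^sup>1\<^sup>/\<^sup>2)\<close>, while
  \<open>\<Sum>\<^sub>i 1 / |z\<^sub>k - x\<^sub>i|\<^sup>2 = O(N\<^sup>1\<^sup>/\<^sup>2)\<close>. Hence the diagonal Hessian entries at the exceptional zeros, which
  contain \<open>2 / (z\<^sub>k - \<zeta>\<^sub>k)\<^sup>2\<close>, are of order \<open>N\<close> and dominate the coupling to the regular zeros, whose own
  block is \<open>- 2\<close> minus a weighted graph Laplacian up to \<open>o(1)\<close>; so the kernel is trivial.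

  That \<open>H\<close> has no real zeros is seen on a discretisation: consecutive Casorati determinants of
  Krawtchouk polynomials at an even set of degrees have the same sign, and in the limit \<open>H\<close> does not
  change sign on the real line, so a real zero could not be simple.
\<close>

section \<open>Determinants and Wronskians\<close>

text \<open>For an even partition the Hermite degrees come in pairs \<open>d\<close>,
  \<open>d + 1\<close>, so the product of all \<open>k - d\<close> is nonnegative at integers
  \<open>k\<close>, but not at real ones. Positivity must therefore be tested in a variable that
  runs through the integers and for which the degrees are nodes. Krawtchouk polynomials provide it:
  degree and variable can be exchanged in them, and they degenerate to Hermite polynomials. The
  asymptotics need no knowledge of individual zeros. Since the zeros of \<open>h\<close> are real,
  the imaginary part of \<open>u = h' / h\<close> controls the sum of all
  \<open>1 / |z - a|^2\<close>, so that the Riccati equation becomes a quadratic inequality with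
  main terms \<open>u^2\<close> and \<open>2 N\<close>. The same device, applied to the exceptional
  polynomial at one point high above the zeros of \<open>H\<close>, bounds the sum over the regular
  zeros. That an exceptional zero differs from its zero of \<open>H\<close> is a separate matter:
  there the leading term vanishes, the next one carries \<open>H'\<close> times an odd derivative of
  \<open>h\<close>, and the lower bound for \<open>|u|\<close> is needed.\<close>

lemma det_mat_eq_0_iff:
  fixes a :: "nat \<Rightarrow> nat \<Rightarrow> 'a::field"
  shows "Determinant.det (Matrix.mat n n (\<lambda>(i, j). a i j)) = 0 \<longleftrightarrow>
    (\<exists>c. (\<exists>j<n. c j \<noteq> 0) \<and> (\<forall>i<n. (\<Sum>j<n. a i j * c j) = 0))"
proof -
  let ?A = "Matrix.mat n n (\<lambda>(i, j). a i j)"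
  have A: "?A \<in> carrier_mat n n" by simp
  have mult: "(?A *\<^sub>v v) = Matrix.vec n (\<lambda>i. \<Sum>j<n. a i j * vec_index v j)" if "v \<in> carrier_vec n" for v
    using that by (intro eq_vecI) (auto simp: scalar_prod_def atLeast0LessThan)
  have "Determinant.det ?A = 0 \<longleftrightarrow> (\<exists>v. v \<in> carrier_vec n \<and> v \<noteq> 0\<^sub>v n \<and> ?A *\<^sub>v v = 0\<^sub>v n)"
    by (rule det_0_iff_vec_prod_zero_field[OF A])
  also have "\<dots> \<longleftrightarrow> (\<exists>c. (\<exists>j<n. c j \<noteq> 0) \<and> (\<forall>i<n. (\<Sum>j<n. a i j * c j) = 0))"
  proof
    assume "\<exists>v. v \<in> carrier_vec n \<and> v \<noteq> 0\<^sub>v n \<and> ?A *\<^sub>v v = 0\<^sub>v n"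
    then obtain v where v: "v \<in> carrier_vec n" "v \<noteq> 0\<^sub>v n" "?A *\<^sub>v v = 0\<^sub>v n" by auto
    have "\<exists>j<n. vec_index v j \<noteq> 0"
    proof (rule ccontr)
      assume "\<not> (\<exists>j<n. vec_index v j \<noteq> 0)"
      hence "v = 0\<^sub>v n" using v(1) by (intro eq_vecI) auto
      with v(2) show False by simp
    qed
    moreover have "(\<Sum>j<n. a i j * vec_index v j) = 0" if "i < n" for i
      using arg_cong[OF v(3), of "\<lambda>u. vec_index u i"] that unfolding mult[OF v(1)] by simp
    ultimately show "\<exists>c. (\<exists>j<n. c j \<noteq> 0) \<and> (\<forall>i<n. (\<Sum>j<n. a i j * c j) = 0)" by blast
  next
    assume "\<exists>c. (\<exists>j<n. c j \<noteq> 0) \<and> (\<forall>i<n. (\<Sum>j<n. a i j * c j) = 0)"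
    then obtain c j where c: "j < n" "c j \<noteq> 0" "\<forall>i<n. (\<Sum>j<n. a i j * c j) = 0" by auto
    define v where "v = Matrix.vec n c"
    have v: "v \<in> carrier_vec n" by (simp add: v_def)
    have "vec_index v j \<noteq> 0" using c(1,2) by (simp add: v_def)
    hence "v \<noteq> 0\<^sub>v n" using c(1) by auto
    moreover have "?A *\<^sub>v v = 0\<^sub>v n"
      unfolding mult[OF v] using c(3) by (intro eq_vecI) (auto simp: v_def)
    ultimately show "\<exists>v. v \<in> carrier_vec n \<and> v \<noteq> 0\<^sub>v n \<and> ?A *\<^sub>v v = 0\<^sub>v n" using v by blast
  qed
  finally show ?thesis .
qed

lemma det_mat_solve:
  fixes a :: "nat \<Rightarrow> nat \<Rightarrow> 'a::field"
  assumes "Determinant.det (Matrix.mat n n (\<lambda>(i, j). a i j)) \<noteq> 0"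
  obtains c where "\<And>i. i < n \<Longrightarrow> (\<Sum>j<n. a i j * c j) = b i"
proof -
  let ?A = "Matrix.mat n n (\<lambda>(i, j). a i j)"
  have A: "?A \<in> carrier_mat n n" by simp
  define v where "v = adj_mat ?A *\<^sub>v Matrix.vec n b"
  have adj: "adj_mat ?A \<in> carrier_mat n n" "?A * adj_mat ?A = Determinant.det ?A \<cdot>\<^sub>m 1\<^sub>m n"
    using adj_mat[OF A] by auto
  have v: "v \<in> carrier_vec n" using adj(1) by (simp add: v_def)
  have "?A *\<^sub>v v = (?A * adj_mat ?A) *\<^sub>v Matrix.vec n b"
    unfolding v_def by (rule assoc_mult_mat_vec[OF A adj(1), symmetric]) simp
  also have "\<dots> = Determinant.det ?A \<cdot>\<^sub>v Matrix.vec n b"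
    unfolding adj(2)
  proof (rule eq_vecI)
    fix i assume "i < dim_vec (Determinant.det ?A \<cdot>\<^sub>v Matrix.vec n b)"
    hence i: "i < n" by simp
    have "vec_index (Determinant.det ?A \<cdot>\<^sub>m 1\<^sub>m n *\<^sub>v Matrix.vec n b) i =
      (\<Sum>j\<in>{0..<n}. Determinant.det ?A * (if j = i then 1 else 0) * b j)"
      using i by (simp add: scalar_prod_def)
    also have "\<dots> = (\<Sum>j\<in>{0..<n}. if j = i then Determinant.det ?A * b i else 0)"
      by (rule sum.cong) auto
    also have "\<dots> = Determinant.det ?A * b i" using i by simp
    finally show "vec_index (Determinant.det ?A \<cdot>\<^sub>m 1\<^sub>m n *\<^sub>v Matrix.vec n b) i =
      vec_index (Determinant.det ?A \<cdot>\<^sub>v Matrix.vec n b) i" using i by simp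
  qed simp
  finally have eq: "?A *\<^sub>v v = Determinant.det ?A \<cdot>\<^sub>v Matrix.vec n b" .
  show ?thesis
  proof (rule that[of "\<lambda>j. vec_index v j / Determinant.det ?A"])
    fix i assume i: "i < n"
    have "vec_index (?A *\<^sub>v v) i = (\<Sum>j<n. a i j * vec_index v j)"
      using i v by (auto simp: scalar_prod_def atLeast0LessThan)
    hence "(\<Sum>j<n. a i j * vec_index v j) = Determinant.det ?A * b i"
      using i unfolding eq by simp
    thus "(\<Sum>j<n. a i j * (vec_index v j / Determinant.det ?A)) = b i"
      using assms by (simp add: sum_divide_distrib[symmetric] field_simps)
  qed
qed

lemma det_cong:
  assumes "\<And>i j. i < n \<Longrightarrow> j < n \<Longrightarrow> a i j = b i j"
  shows "Determinant.det (Matrix.mat n n (\<lambda>(i, j). a i j)) = Determinant.det (Matrix.mat n n (\<lambda>(i, j). b i j))"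
  by (rule arg_cong[of _ _ Determinant.det], rule eq_matI) (use assms in auto)

lemma poly_det:
  fixes a :: "nat \<Rightarrow> nat \<Rightarrow> 'a::comm_ring_1 poly"
  shows "poly (Determinant.det (Matrix.mat n n (\<lambda>(i, j). a i j))) x =
    Determinant.det (Matrix.mat n n (\<lambda>(i, j). poly (a i j) x))"
proof -
  interpret comm_ring_hom "\<lambda>p. poly p x" by unfold_locales auto
  have "map_mat (\<lambda>p. poly p x) (Matrix.mat n n (\<lambda>(i, j). a i j)) = Matrix.mat n n (\<lambda>(i, j). poly (a i j) x)"
    by (rule eq_matI) auto
  thus ?thesis using hom_det[of "Matrix.mat n n (\<lambda>(i, j). a i j)"] by simp
qed

lemma det_mat_laplace_column:
  fixes a :: "nat \<Rightarrow> nat \<Rightarrow> 'a::comm_ring_1"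
  assumes "j0 \<le> n"
  shows "Determinant.det (Matrix.mat (Suc n) (Suc n) (\<lambda>(i, j). a i j)) =
    (\<Sum>i\<le>n. a i j0 * ((-1) ^ (i + j0) * Determinant.det (Matrix.mat n n (\<lambda>(i', j).
        a (if i' < i then i' else Suc i') (if j < j0 then j else Suc j)))))"
proof -
  let ?A = "Matrix.mat (Suc n) (Suc n) (\<lambda>(i, j). a i j)"
  have del: "mat_delete ?A i j0 = Matrix.mat n n (\<lambda>(i', j). a (if i' < i then i' else Suc i') (if j < j0 then j else Suc j))" for i
    by (rule eq_matI) (auto simp: mat_delete_def)
  have "Determinant.det ?A = (\<Sum>i<Suc n. ?A $$ (i, j0) * cofactor ?A i j0)"
    by (rule laplace_expansion_column) (use assms in auto)
  also have "\<dots> = (\<Sum>i\<le>n. ?A $$ (i, j0) * cofactor ?A i j0)" by (simp only: lessThan_Suc_atMost)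
  also have "\<dots> = (\<Sum>i\<le>n. a i j0 * ((-1) ^ (i + j0) * Determinant.det (Matrix.mat n n (\<lambda>(i', j).
        a (if i' < i then i' else Suc i') (if j < j0 then j else Suc j)))))"
    by (rule sum.cong) (use assms in \<open>auto simp: cofactor_def del\<close>)
  finally show ?thesis .
qed

lemma pderiv_sum: "pderiv (\<Sum>x\<in>A. f x) = (\<Sum>x\<in>A. pderiv (f x))"
  using higher_pderiv_sum[of "Suc 0"] by simp

lemma pderiv_det:
  fixes a :: "nat \<Rightarrow> nat \<Rightarrow> 'a::idom poly"
  shows "pderiv (Determinant.det (Matrix.mat n n (\<lambda>(i, j). a i j))) =
    (\<Sum>k<n. Determinant.det (Matrix.mat n n (\<lambda>(i, j). if i = k then pderiv (a i j) else a i j)))"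
proof -
  let ?S = "{p. p permutes {0..<n}}"
  have det: "Determinant.det (Matrix.mat n n (\<lambda>(i, j). b i j)) = (\<Sum>p\<in>?S. signof p * (\<Prod>i=0..<n. b i (p i)))"
    for b :: "nat \<Rightarrow> nat \<Rightarrow> 'a poly"
    unfolding Determinant.det_def
    by (auto intro!: sum.cong prod.cong dest: permutes_in_image)
  have ps: "pderiv (signof p * q) = signof p * pderiv q" for p :: "nat \<Rightarrow> nat" and q :: "'a poly"
    by (simp add: sign_def pderiv_minus)
  have pp: "pderiv (\<Prod>i=0..<n. a i (p i)) = (\<Sum>k<n. \<Prod>i=0..<n. (if i = k then pderiv (a i (p i)) else a i (p i)))" for p
  proof -
    have "(\<Prod>i=0..<n. (if i = k then pderiv (a i (p i)) else a i (p i))) =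
       prod (\<lambda>i. a i (p i)) ({0..<n} - {k}) * pderiv (a k (p k))" if "k < n" for k
    proof -
      have "(\<Prod>i=0..<n. (if i = k then pderiv (a i (p i)) else a i (p i))) =
        (if k = k then pderiv (a k (p k)) else a k (p k)) * (\<Prod>i\<in>{0..<n} - {k}. (if i = k then pderiv (a i (p i)) else a i (p i)))"
        by (rule prod.remove) (use that in auto)
      also have "(\<Prod>i\<in>{0..<n} - {k}. (if i = k then pderiv (a i (p i)) else a i (p i))) = (\<Prod>i\<in>{0..<n} - {k}. a i (p i))"
        by (rule prod.cong) auto
      finally show ?thesis by (simp add: mult.commute)
    qed
    thus ?thesis by (simp add: pderiv_prod atLeast0LessThan)
  qed
  show ?thesis
    unfolding det pderiv_sum ps pp sum_distrib_left by (rule sum.swap)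
qed

abbreviation wmat :: "(nat \<Rightarrow> nat) \<Rightarrow> complex poly list \<Rightarrow> complex poly" where
  "wmat \<rho> fs \<equiv> Determinant.det (Matrix.mat (length fs) (length fs) (\<lambda>(i, j). (pderiv ^^ \<rho> i) (fs ! j)))"

text \<open>The coefficient of the derivative of order \<open>i\<close> in the differential operator
  that sends \<open>h\<close> to the Wronskian of \<open>fs\<close> and \<open>h\<close>. It depends
  on \<open>fs\<close> only, so all growth in \<open>N\<close> comes from the derivatives of the
  last function.\<close>

definition wcof :: "complex poly list \<Rightarrow> nat \<Rightarrow> complex poly" where
  "wcof fs i = (-1) ^ (i + length fs) * wmat (\<lambda>i'. if i' < i then i' else Suc i') fs"

lemma wronskian_snoc:
  "wronskian (fs @ [h]) = (\<Sum>i\<le>length fs. wcof fs i * (pderiv ^^ i) h)"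
proof -
  have "wronskian (fs @ [h]) = (\<Sum>i\<le>length fs. (pderiv ^^ i) ((fs @ [h]) ! length fs) *
     ((-1) ^ (i + length fs) * Determinant.det (Matrix.mat (length fs) (length fs) (\<lambda>(i', j).
        (pderiv ^^ (if i' < i then i' else Suc i')) ((fs @ [h]) ! (if j < length fs then j else Suc j))))))"
    unfolding wronskian_def length_append_singleton by (rule det_mat_laplace_column) simp
  also have "\<dots> = (\<Sum>i\<le>length fs. wcof fs i * (pderiv ^^ i) h)"
  proof (rule sum.cong[OF refl])
    fix i
    have "wmat (\<lambda>i'. if i' < i then i' else Suc i') fs =
      Determinant.det (Matrix.mat (length fs) (length fs) (\<lambda>(i', j).
        (pderiv ^^ (if i' < i then i' else Suc i')) ((fs @ [h]) ! (if j < length fs then j else Suc j))))"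
      by (rule det_cong) (simp add: nth_append)
    thus "(pderiv ^^ i) ((fs @ [h]) ! length fs) *
     ((-1) ^ (i + length fs) * Determinant.det (Matrix.mat (length fs) (length fs) (\<lambda>(i', j).
        (pderiv ^^ (if i' < i then i' else Suc i')) ((fs @ [h]) ! (if j < length fs then j else Suc j))))) =
      wcof fs i * (pderiv ^^ i) h"
      unfolding wcof_def by simp
  qed
  finally show ?thesis .
qed

lemma wcof_length: "wcof fs (length fs) = wronskian fs"
proof -
  have "wmat (\<lambda>i'. if i' < length fs then i' else Suc i') fs = wronskian fs"
    unfolding wronskian_def by (rule det_cong) simp
  moreover have "(-1) ^ (length fs + length fs) = (1 :: complex poly)"
    by (metis mult_2 power_minus1_even)
  ultimately show ?thesis by (simp only: wcof_def mult_1)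
qed

text \<open>Differentiating a row other than the last one repeats the row below it, so only the last
  row contributes. With \<open>wcof_length\<close> this makes the two highest coefficients of the
  operator the Wronskian and minus its derivative.\<close>

lemma pderiv_wronskian:
  assumes "length fs = Suc r"
  shows "pderiv (wronskian fs) = - wcof fs r"
proof -
  have "pderiv (wronskian fs) = (\<Sum>k<Suc r. Determinant.det (Matrix.mat (Suc r) (Suc r)
     (\<lambda>(i, j). if i = k then pderiv ((pderiv ^^ i) (fs ! j)) else (pderiv ^^ i) (fs ! j))))"
    unfolding wronskian_def assms by (rule pderiv_det)
  also have "\<dots> = (\<Sum>k<Suc r. if k = r then wmat (\<lambda>i'. if i' < r then i' else Suc i') fs else 0)"
  proof (rule sum.cong[OF refl])
    fix k assume "k \<in> {..<Suc r}"
    let ?A = "Matrix.mat (Suc r) (Suc r)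
     (\<lambda>(i, j). if i = k then pderiv ((pderiv ^^ i) (fs ! j)) else (pderiv ^^ i) (fs ! j))"
    show "Determinant.det ?A = (if k = r then wmat (\<lambda>i'. if i' < r then i' else Suc i') fs else 0)"
    proof (cases "k = r")
      case True
      thus ?thesis unfolding assms by (simp, intro det_cong) auto
    next
      case False
      hence k: "k < r" using \<open>k \<in> {..<Suc r}\<close> by auto
      have "Determinant.det ?A = 0"
        by (rule Determinant.det_identical_rows[of _ "Suc r" k "Suc k"])
           (use k in \<open>auto intro!: eq_vecI\<close>)
      thus ?thesis using False by simp
    qed
  qed
  also have "\<dots> = wmat (\<lambda>i'. if i' < r then i' else Suc i') fs"
    by (subst sum.delta) auto
  also have "\<dots> = - wcof fs r"
  proof -
    have "(-1) ^ (r + Suc r) = (-1 :: complex poly)"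
      by (metis add_Suc_right mult_2 power_minus1_odd)
    thus ?thesis unfolding wcof_def assms by (simp only: mult_minus_left mult_1 minus_minus)
  qed
  finally show ?thesis .
qed

lemma wronskian_snoc_member:
  assumes "j < length fs"
  shows "wronskian (fs @ [fs ! j]) = 0"
  unfolding wronskian_def length_append_singleton
  by (rule Determinant.det_identical_columns[of _ "Suc (length fs)" j "length fs"])
     (use assms in \<open>auto intro!: eq_vecI simp: nth_append\<close>)

lemma smult_sum_right: "Polynomial.smult c (\<Sum>x\<in>A. f x) = (\<Sum>x\<in>A. Polynomial.smult c (f x))"
  by (induction A rule: infinite_finite_induct) (simp_all add: smult_add_right)

lemma wronskian_snoc_add_combination:
  "wronskian (fs @ [h + (\<Sum>j<length fs. smult (c j) (fs ! j))]) = wronskian (fs @ [h])"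
proof -
  have "wronskian (fs @ [h + (\<Sum>j<length fs. smult (c j) (fs ! j))]) =
    wronskian (fs @ [h]) + (\<Sum>i\<le>length fs. \<Sum>j<length fs. smult (c j) (wcof fs i * (pderiv ^^ i) (fs ! j)))"
    unfolding wronskian_snoc higher_pderiv_add higher_pderiv_sum higher_pderiv_smult
    by (simp add: distrib_left sum.distrib sum_distrib_left)
  also have "(\<Sum>i\<le>length fs. \<Sum>j<length fs. smult (c j) (wcof fs i * (pderiv ^^ i) (fs ! j))) =
     (\<Sum>j<length fs. smult (c j) (wronskian (fs @ [fs ! j])))"
    unfolding wronskian_snoc by (subst sum.swap) (simp add: smult_sum_right)
  also have "\<dots> = 0" by (simp add: wronskian_snoc_member)
  finally show ?thesis by simp
qed

section \<open>Hermite polynomials\<close>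

lemma pderiv_hermite: "pderiv (hermite (Suc n)) = smult (2 * of_nat (Suc n)) (hermite n)"
proof (induction n rule: hermite.induct)
  case 1
  show ?case by (simp add: pderiv_pCons)
next
  case 2
  show ?case by (simp add: pderiv_pCons pderiv_diff)
next
  case (3 n)
  have "pderiv (hermite (Suc (Suc (Suc n)))) =
     [:2:] * hermite (Suc (Suc n)) + [:0, 2:] * pderiv (hermite (Suc (Suc n)))
       - smult (2 * of_nat (Suc (Suc n))) (pderiv (hermite (Suc n)))"
    by (subst hermite.simps(3)) (simp add: pderiv_diff pderiv_mult pderiv_smult pderiv_pCons del: hermite.simps(3) of_nat_Suc)
  also have "\<dots> = smult 2 (hermite (Suc (Suc n))) + smult (2 * of_nat (Suc (Suc n))) ([:0, 2:] * hermite (Suc n)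
       - smult (2 * of_nat (Suc n)) (hermite n))"
    unfolding 3
    by (subst poly_eq_poly_eq_iff[symmetric], rule ext)
      (simp add: algebra_simps del: hermite.simps(3) of_nat_Suc)
  also have "\<dots> = smult (2 + 2 * of_nat (Suc (Suc n))) (hermite (Suc (Suc n)))"
    by (simp only: hermite.simps(3)[symmetric] smult_add_left)
  also have "(2 + 2 * of_nat (Suc (Suc n)) :: complex) = 2 * of_nat (Suc (Suc (Suc n)))"
    by simp
  finally show ?case .
qed

definition hermite_op :: "complex poly \<Rightarrow> complex poly" where
  "hermite_op p = pderiv (pderiv p) - [:0, 2:] * pderiv p"

lemma hermite_op_hermite: "hermite_op (hermite n) = smult (- 2 * of_nat n) (hermite n)"
proof (cases n rule: hermite.cases)
  case (3 k)
  show ?thesis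
    unfolding 3 hermite_op_def pderiv_hermite pderiv_smult
    by (subst poly_eq_poly_eq_iff[symmetric], rule ext) (simp add: algebra_simps)
qed (auto simp: hermite_op_def pderiv_pCons)

lemma hermite_op_add: "hermite_op (p + q) = hermite_op p + hermite_op q"
  by (simp add: hermite_op_def pderiv_add smult_add_right algebra_simps)

lemma hermite_op_smult: "hermite_op (smult c p) = smult c (hermite_op p)"
  by (simp add: hermite_op_def pderiv_smult smult_diff_right)

lemma hermite_op_sum: "hermite_op (\<Sum>j\<in>A. f j) = (\<Sum>j\<in>A. hermite_op (f j))"
  by (induction A rule: infinite_finite_induct) (simp_all add: hermite_op_add, simp_all add: hermite_op_def)

text \<open>The commutator of \<open>D\<close> with \<open>D\<^sup>2 - 2 x D\<close> is
  \<open>- 2 D\<close>, so every derivative shifts the operator by \<open>- 2\<close>.\<close>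

lemma higher_pderiv_hermite_op:
  "(pderiv ^^ i) (hermite_op p) = hermite_op ((pderiv ^^ i) p) - smult (2 * of_nat i) ((pderiv ^^ i) p)"
proof (induction i)
  case (Suc i)
  show ?case
    unfolding funpow.simps o_def Suc.IH
    by (simp add: hermite_op_def pderiv_diff pderiv_add pderiv_smult pderiv_pCons smult_add_left)
qed simp

lemma hermite_consecutive_roots: "\<not> (poly (hermite n) x = 0 \<and> poly (hermite (Suc n)) x = 0)"
  by (induction n) (auto simp del: of_nat_Suc)

lemma hermite_simple_root: "\<not> (poly (hermite n) x = 0 \<and> poly (pderiv (hermite n)) x = 0)"
proof (cases n)
  case (Suc k)
  thus ?thesis using hermite_consecutive_roots[of k x] by (auto simp: pderiv_hermite simp del: of_nat_Suc)
qed simp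

text \<open>
  Modulo the span of \<open>fs\<close> the last function may be replaced by one that vanishes at \<open>x\<close> to order
  \<open>length fs + 2\<close>. The operator \<open>D\<^sup>2 - 2 x D\<close> lowers this order by two only, and so it maps that
  function to a combination of \<open>fs\<close> vanishing to order \<open>length fs\<close>, that is, to zero.
\<close>

lemma wronskian_hermite_snoc_simple_root:
  assumes "k \<notin> set ks" and "poly (wronskian (map hermite ks)) x \<noteq> 0"
  shows "\<not> (poly (wronskian (map hermite ks @ [hermite k])) x = 0 \<and>
            poly (pderiv (wronskian (map hermite ks @ [hermite k]))) x = 0)"
proof
  assume P: "poly (wronskian (map hermite ks @ [hermite k])) x = 0 \<and>
            poly (pderiv (wronskian (map hermite ks @ [hermite k]))) x = 0"
  define fs where "fs = map hermite ks"
  define r where "r = length fs"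
  define a where "a = (\<lambda>i j. poly ((pderiv ^^ i) (fs ! j)) x)"
  have "poly (wronskian fs) x = Determinant.det (Matrix.mat r r (\<lambda>(i, j). a i j))"
    unfolding wronskian_def poly_det r_def a_def ..
  with assms(2) have det: "Determinant.det (Matrix.mat r r (\<lambda>(i, j). a i j)) \<noteq> 0"
    by (simp add: fs_def)
  obtain c where c: "\<And>i. i < r \<Longrightarrow> (\<Sum>j<r. a i j * c j) = - poly ((pderiv ^^ i) (hermite k)) x"
    by (rule det_mat_solve[OF det, of "\<lambda>i. - poly ((pderiv ^^ i) (hermite k)) x"], rule that)
  define g where "g = hermite k + (\<Sum>j<r. smult (c j) (fs ! j))"
  define d where "d = (\<lambda>i. poly ((pderiv ^^ i) g) x)"
  have d_less: "d i = 0" if "i < r" for i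
    using c[OF that] unfolding d_def g_def higher_pderiv_add higher_pderiv_sum higher_pderiv_smult
    by (simp add: poly_sum a_def mult.commute)
  have W: "wronskian (fs @ [hermite k]) = (\<Sum>i\<le>r. wcof fs i * (pderiv ^^ i) g)"
    using wronskian_snoc_add_combination[of fs "hermite k" c] unfolding g_def r_def wronskian_snoc[of fs] by simp
  have wr: "poly (wcof fs r) x \<noteq> 0" using assms(2) unfolding r_def wcof_length fs_def .
  have "poly (wronskian (fs @ [hermite k])) x = (\<Sum>i\<le>r. poly (wcof fs i) x * d i)"
    unfolding W by (simp add: poly_sum d_def)
  also have "\<dots> = poly (wcof fs r) x * d r"
    by (subst sum.remove[of _ r]) (auto intro!: sum.neutral simp: d_less)
  finally have d_r: "d r = 0" using P wr by (simp add: fs_def)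
  hence d_le: "d i = 0" if "i \<le> r" for i using d_less that by (cases "i = r") auto
  have "poly (pderiv (wronskian (fs @ [hermite k]))) x =
     (\<Sum>i\<le>r. poly (wcof fs i) x * d (Suc i) + d i * poly (pderiv (wcof fs i)) x)"
    unfolding W pderiv_sum pderiv_mult by (simp add: poly_sum d_def)
  also have "\<dots> = (\<Sum>i\<le>r. poly (wcof fs i) x * d (Suc i))"
    by (rule sum.cong) (auto simp: d_le)
  also have "\<dots> = poly (wcof fs r) x * d (Suc r)"
    by (subst sum.remove[of _ r]) (auto intro!: sum.neutral simp: d_le)
  finally have d_Suc_r: "d (Suc r) = 0" using P wr by (simp add: fs_def)
  hence d_zero: "d i = 0" if "i \<le> Suc r" for i using d_le that by (cases "i = Suc r") auto
  have fs_nth: "fs ! j = hermite (ks ! j)" if "j < r" for j using that by (simp add: fs_def r_def)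
  \<comment> \<open>Adding \<open>2 k\<close> to the operator kills its eigenfunction
    \<open>hermite k\<close> and leaves a combination of \<open>fs\<close> with these coefficients;
    the eigenvalue differences are nonzero because \<open>k\<close> is not in
    \<open>ks\<close>.\<close>
  define e where "e = (\<lambda>j. c j * (2 * (of_nat k - of_nat (ks ! j))))"
  have Lg: "hermite_op g = smult (- 2 * of_nat k) (hermite k) + (\<Sum>j<r. smult (c j) (smult (- 2 * of_nat (ks ! j)) (fs ! j)))"
    unfolding g_def hermite_op_add hermite_op_sum hermite_op_smult hermite_op_hermite
    by (simp add: fs_nth hermite_op_hermite)
  have "hermite_op g + smult (2 * of_nat k) g = (\<Sum>j<r. smult (e j) (fs ! j))"
    by (subst poly_eq_poly_eq_iff[symmetric], rule ext, unfold Lg)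
      (simp add: g_def e_def poly_sum sum_distrib_left sum_subtractf sum_negf algebra_simps)
  from arg_cong[OF this, of "pderiv ^^ _"]
  have "(pderiv ^^ i) (hermite_op g) + smult (2 * of_nat k) ((pderiv ^^ i) g) = (\<Sum>j<r. smult (e j) ((pderiv ^^ i) (fs ! j)))" for i
    unfolding higher_pderiv_add higher_pderiv_smult higher_pderiv_sum .
  from arg_cong[OF this, of "\<lambda>p. poly p x"]
  have "poly ((pderiv ^^ i) (hermite_op g) + smult (2 * of_nat k) ((pderiv ^^ i) g)) x = (\<Sum>j<r. a i j * e j)" for i
    by (simp add: poly_sum a_def mult.commute)
  \<comment> \<open>The orders \<open>i\<close>, \<open>i + 1\<close> and \<open>i + 2\<close>
    enter, so \<open>g\<close> has to vanish up to order \<open>r + 1\<close>. This is why both the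
    value and the derivative of the Wronskian are assumed to be zero.\<close>
  moreover have "poly ((pderiv ^^ i) (hermite_op g) + smult (2 * of_nat k) ((pderiv ^^ i) g)) x = 0" if "i < r" for i
    using d_zero[of i] d_zero[of "Suc i"] d_zero[of "Suc (Suc i)"] that
    unfolding higher_pderiv_hermite_op by (simp add: hermite_op_def d_def)
  ultimately have "\<forall>i<r. (\<Sum>j<r. a i j * e j) = 0" by metis
  with det have e: "\<forall>j<r. e j = 0" unfolding det_mat_eq_0_iff by blast
  have "c j = 0" if "j < r" for j
  proof -
    have "ks ! j \<noteq> k" using that assms(1) by (auto simp: r_def fs_def)
    thus ?thesis using e that by (auto simp: e_def)
  qed
  hence "g = hermite k" by (simp add: g_def)
  hence "poly (hermite k) x = 0 \<and> poly (pderiv (hermite k)) x = 0"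
    using d_zero[of 0] d_zero[of "Suc 0"] by (simp add: d_def)
  thus False using hermite_simple_root by blast
qed

text \<open>If the longer Wronskian were identically zero, its value and derivative would vanish at
  a point where the shorter one does not, against the preceding lemma.\<close>

lemma wronskian_hermite_nonzero:
  assumes "distinct ks"
  shows "wronskian (map hermite ks) \<noteq> 0"
  using assms
proof (induction ks rule: rev_induct)
  case Nil
  show ?case by (simp add: wronskian_def)
next
  case (snoc k ks)
  hence "wronskian (map hermite ks) \<noteq> 0" "k \<notin> set ks" by auto
  then obtain x where "poly (wronskian (map hermite ks)) x \<noteq> 0"
    using poly_all_0_iff_0 by blast
  with wronskian_hermite_snoc_simple_root[OF \<open>k \<notin> set ks\<close> this] show ?case by auto
qed

section \<open>Krawtchouk polynomials\<close>

text \<open>The Krawtchouk polynomial of degree \<open>k\<close> at the point \<open>x\<close> of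
  the lattice \<open>0, ..., M\<close>, given by its generating function. The parameters
  \<open>x\<close>, \<open>y\<close> with \<open>x + y = M\<close> keep subtraction out of the
  recurrences.\<close>

definition krawtchouk :: "nat \<Rightarrow> nat \<Rightarrow> nat \<Rightarrow> real" where
  "krawtchouk x y k = coeff ([:1, -1:] ^ x * [:1, 1:] ^ y) k"

text \<open>The logarithmic derivative of \<open>G\<close> is
  \<open>y / (1 + t) - x / (1 - t)\<close>, cleared of denominators here. Comparing coefficients
  yields the recurrence in \<open>k\<close>.\<close>

lemma krawtchouk_ode:
  fixes G :: "real poly"
  assumes "G = [:1, -1:] ^ x * [:1, 1:] ^ y"
  shows "[:1, 0, -1:] * pderiv G = [:real y - real x, - (real x + real y):] * G"
proof -
  have a: "[:1, -1:] * pderiv ([:1, -1:] ^ x) = smult (- real x) ([:1, -1::real:] ^ x)"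
    by (cases x) (simp_all add: pderiv_power_Suc pderiv_pCons del: power_Suc, simp_all)
  have b: "[:1, 1:] * pderiv ([:1, 1:] ^ y) = smult (real y) ([:1, 1::real:] ^ y)"
    by (cases y) (simp_all add: pderiv_power_Suc pderiv_pCons del: power_Suc, simp_all)
  have "[:1, 0, -1:] * pderiv G =
     ([:1, -1:] * pderiv ([:1, -1:] ^ x)) * [:1, 1:] * [:1, 1:] ^ y +
     [:1, -1:] * [:1, -1:] ^ x * ([:1, 1:] * pderiv ([:1, 1:] ^ y))"
    unfolding assms pderiv_mult
    by (subst poly_eq_poly_eq_iff[symmetric], rule ext) (simp add: algebra_simps)
  also have "\<dots> = (smult (- real x) [:1, 1:] + smult (real y) [:1, -1:]) * G"
    unfolding a b assms by (subst poly_eq_poly_eq_iff[symmetric], rule ext) (simp add: algebra_simps)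
  finally show ?thesis by simp
qed

lemma krawtchouk_0: "krawtchouk x y 0 = 1"
  by (simp add: krawtchouk_def coeff_mult_0 coeff_0_power)

lemma krawtchouk_1: "krawtchouk x y (Suc 0) = real y - real x"
proof -
  define G where "G = [:1, -1:] ^ x * [:1, 1::real:] ^ y"
  have "coeff ([:1, 0, -1:] * pderiv G) 0 = coeff ([:real y - real x, - (real x + real y):] * G) 0"
    using krawtchouk_ode[OF G_def] by simp
  thus ?thesis using krawtchouk_0[of x y] by (simp add: coeff_pderiv krawtchouk_def G_def coeff_mult_0)
qed

lemma krawtchouk_Suc_Suc:
  "real (Suc (Suc k)) * krawtchouk x y (Suc (Suc k)) =
    (real y - real x) * krawtchouk x y (Suc k) - (real x + real y - real k) * krawtchouk x y k"
proof -
  define G where "G = [:1, -1:] ^ x * [:1, 1::real:] ^ y"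
  have "coeff ([:1, 0, -1:] * pderiv G) (Suc k) = coeff ([:real y - real x, - (real x + real y):] * G) (Suc k)"
    using krawtchouk_ode[OF G_def] by simp
  hence "real (Suc (Suc k)) * coeff G (Suc (Suc k)) - real k * coeff G k =
     (real y - real x) * coeff G (Suc k) - (real x + real y) * coeff G k"
    by (cases k) (simp_all add: coeff_pderiv coeff_pCons algebra_simps)
  thus ?thesis by (simp add: krawtchouk_def G_def algebra_simps)
qed

text \<open>Applied to \<open>G = (1 - t)^a (1 + t)^b\<close>, the operator
  \<open>(a + b) - 2 t D\<close> yields \<open>a (1 - t)^(a-1) (1 + t)^(b+1) + b (1 - t)^(a+1) (1 +
  t)^(b-1)\<close>, and it multiplies the coefficient of \<open>t^k\<close> by
  \<open>a + b - 2 k\<close>. This is a recurrence in \<open>x\<close> at fixed \<open>x + y\<close>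
  with coefficients linear in \<open>k\<close>, the source of duality.\<close>

lemma krawtchouk_shift:
  "real (Suc y) * krawtchouk (Suc (Suc x)) y k + real (Suc x) * krawtchouk x (Suc (Suc y)) k =
    (real (Suc x + Suc y) - 2 * real k) * krawtchouk (Suc x) (Suc y) k"
proof -
  define G where "G = [:1, -1:] ^ Suc x * [:1, 1::real:] ^ Suc y"
  have dG: "pderiv G = [:1, -1:] ^ Suc x * smult (real (Suc y)) ([:1, 1:] ^ y) +
     smult (- real (Suc x)) ([:1, -1:] ^ x) * [:1, 1:] ^ Suc y"
  proof -
    have "pderiv [:1, -1::real:] = [:-1:]" "pderiv [:1, 1::real:] = [:1:]"
      by (simp_all add: pderiv_pCons)
    thus ?thesis unfolding G_def pderiv_mult pderiv_power_Suc
      by (subst poly_eq_poly_eq_iff[symmetric], intro ext) (simp add: algebra_simps)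
  qed
  have "smult (real (Suc y)) ([:1, -1:] ^ Suc (Suc x) * [:1, 1:] ^ y) +
     smult (real (Suc x)) ([:1, -1:] ^ x * [:1, 1:] ^ Suc (Suc y)) =
     smult (real (Suc x + Suc y)) G - [:0, 2:] * pderiv G"
    unfolding dG unfolding G_def
    by (subst poly_eq_poly_eq_iff[symmetric], rule ext) (simp add: algebra_simps)
  moreover have "coeff ([:0, 2:] * pderiv G) k = 2 * real k * coeff G k"
    by (cases k) (simp_all add: coeff_pderiv)
  moreover have "krawtchouk (Suc x) (Suc y) k = coeff G k" by (simp only: krawtchouk_def G_def)
  ultimately show ?thesis
    unfolding krawtchouk_def[of "Suc (Suc x)"] krawtchouk_def[of x] left_diff_distrib
    by (metis coeff_add coeff_diff coeff_smult)
qed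

lemma krawtchouk_shift_0:
  "real (Suc y) * krawtchouk (Suc 0) y k = (real (Suc y) - 2 * real k) * krawtchouk 0 (Suc y) k"
proof -
  define G where "G = [:1, 1::real:] ^ Suc y"
  have dG: "pderiv G = smult (real (Suc y)) ([:1, 1:] ^ y)"
    unfolding G_def pderiv_mult pderiv_power_Suc by (simp add: pderiv_pCons)
  have "smult (real (Suc y)) ([:1, -1:] * [:1, 1:] ^ y) = smult (real (Suc y)) G - [:0, 2:] * pderiv G"
    unfolding dG unfolding G_def
    by (subst poly_eq_poly_eq_iff[symmetric], rule ext) (simp add: algebra_simps)
  moreover have "coeff ([:0, 2:] * pderiv G) k = 2 * real k * coeff G k"
    by (cases k) (simp_all add: coeff_pderiv)
  moreover have "krawtchouk 0 (Suc y) k = coeff G k" "krawtchouk (Suc 0) y k = coeff ([:1, -1:] * [:1, 1:] ^ y) k"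
    by (simp_all add: krawtchouk_def G_def)
  ultimately show ?thesis
    unfolding left_diff_distrib by (metis coeff_diff coeff_smult)
qed

lemma krawtchouk_binomial: "krawtchouk 0 M k = real (M choose k)"
  by (cases "k \<le> M") (simp_all add: krawtchouk_def coeff_linear_poly_power binomial_eq_0 coeff_eq_0 degree_linear_power)

text \<open>Duality: up to the binomial weight, \<open>krawtchouk x y k\<close> is a polynomial of degree \<open>x\<close> in \<open>k\<close>.\<close>

fun dual_krawtchouk :: "nat \<Rightarrow> nat \<Rightarrow> real poly" where
  "dual_krawtchouk M 0 = 1"
| "dual_krawtchouk M (Suc 0) = smult (1 / real M) [:real M, -2:]"
| "dual_krawtchouk M (Suc (Suc x)) = smult (1 / real (M - Suc x))
     ([:real M, -2:] * dual_krawtchouk M (Suc x) - smult (real (Suc x)) (dual_krawtchouk M x))"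

text \<open>Each step of the recursion multiplies the leading coefficient by a negative number as
  long as \<open>x \<le> M\<close>. The alternation makes leading coefficients at an even distance
  \<open>r\<close> agree in sign.\<close>

lemma dual_krawtchouk_degree:
  "x \<le> M \<Longrightarrow> degree (dual_krawtchouk M x) \<le> x \<and> (-1) ^ x * coeff (dual_krawtchouk M x) x > 0"
proof (induction M x rule: dual_krawtchouk.induct)
  case (3 M x)
  hence IH: "degree (dual_krawtchouk M (Suc x)) \<le> Suc x" "(-1) ^ Suc x * coeff (dual_krawtchouk M (Suc x)) (Suc x) > 0"
    "degree (dual_krawtchouk M x) \<le> x" by auto
  have "degree ([:real M, -2:] * dual_krawtchouk M (Suc x)) \<le> Suc (Suc x)"
    using degree_mult_le[of "[:real M, -2:]" "dual_krawtchouk M (Suc x)"] IH(1) by simp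
  hence deg: "degree ([:real M, -2:] * dual_krawtchouk M (Suc x) - smult (real (Suc x)) (dual_krawtchouk M x)) \<le> Suc (Suc x)"
    using IH(3) by (intro degree_diff_le) (auto intro: order.trans[OF degree_smult_le])
  have z: "coeff (dual_krawtchouk M (Suc x)) (Suc (Suc x)) = 0" "coeff (dual_krawtchouk M x) (Suc (Suc x)) = 0"
    using IH by (auto intro!: coeff_eq_0)
  have "(-1) ^ Suc (Suc x) * coeff (dual_krawtchouk M (Suc (Suc x))) (Suc (Suc x)) =
      (2 / real (M - Suc x)) * ((-1) ^ Suc x * coeff (dual_krawtchouk M (Suc x)) (Suc x))"
    by (simp add: z del: of_nat_Suc)
  also have "\<dots> > 0" by (rule mult_pos_pos) (use "3.prems" in simp, rule IH(2))
  finally have "(-1) ^ Suc (Suc x) * coeff (dual_krawtchouk M (Suc (Suc x))) (Suc (Suc x)) > 0" .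
  moreover have "degree (dual_krawtchouk M (Suc (Suc x))) \<le> Suc (Suc x)"
    unfolding dual_krawtchouk.simps by (rule order.trans[OF degree_smult_le deg])
  ultimately show ?case by blast
qed auto

lemma dual_krawtchouk:
  "x \<le> M \<Longrightarrow> krawtchouk x (M - x) k = real (M choose k) * poly (dual_krawtchouk M x) (real k)"
proof (induction M x rule: dual_krawtchouk.induct)
  case (1 M)
  show ?case by (simp add: krawtchouk_binomial)
next
  case (2 M)
  then obtain y where M: "M = Suc y" by (cases M) auto
  show ?case using krawtchouk_shift_0[of y k] by (simp add: M krawtchouk_binomial field_simps)
next
  case (3 M x)
  define y where "y = M - Suc (Suc x)"
  have M: "M = Suc (Suc (x + y))" using 3 by (simp add: y_def)
  have IH: "krawtchouk (Suc x) (Suc y) k = real (M choose k) * poly (dual_krawtchouk M (Suc x)) (real k)"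
    "krawtchouk x (Suc (Suc y)) k = real (M choose k) * poly (dual_krawtchouk M x) (real k)"
    using "3.IH" by (auto simp: M Suc_diff_le)
  have "real (Suc y) * krawtchouk (Suc (Suc x)) y k =
     (real M - 2 * real k) * krawtchouk (Suc x) (Suc y) k - real (Suc x) * krawtchouk x (Suc (Suc y)) k"
    using krawtchouk_shift[of y x k] by (simp add: M algebra_simps)
  also have "\<dots> = real (M choose k) * ((real M - 2 * real k) * poly (dual_krawtchouk M (Suc x)) (real k) -
      real (Suc x) * poly (dual_krawtchouk M x) (real k))"
    unfolding IH by (simp add: algebra_simps)
  finally have eq: "krawtchouk (Suc (Suc x)) y k = real (M choose k) * ((real M - 2 * real k) * poly (dual_krawtchouk M (Suc x)) (real k) -
      real (Suc x) * poly (dual_krawtchouk M x) (real k)) / real (Suc y)"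
    by (simp add: field_simps)
  have MS: "M - Suc (Suc x) = y" "M - Suc x = Suc y" by (simp_all add: M)
  have "poly (dual_krawtchouk M (Suc (Suc x))) (real k) =
     ((real M - 2 * real k) * poly (dual_krawtchouk M (Suc x)) (real k) -
      real (Suc x) * poly (dual_krawtchouk M x) (real k)) / real (Suc y)"
    unfolding dual_krawtchouk.simps MS by (simp add: field_simps)
  thus ?case unfolding MS eq by simp
qed

section \<open>Orthogonality from the zero of the generating function at 1\<close>

definition euler_op :: "real poly \<Rightarrow> real poly" where
  "euler_op p = [:0, 1:] * pderiv p"

lemma coeff_euler_op: "coeff (euler_op p) k = real k * coeff p k"
  by (cases k) (simp_all add: euler_op_def coeff_pderiv)

lemma coeff_euler_op_iter: "coeff ((euler_op ^^ i) p) k = real k ^ i * coeff p k"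
  by (induction i) (simp_all add: coeff_euler_op)

lemma euler_op_dvd:
  assumes "[:1, -1:] ^ Suc n dvd p"
  shows "[:1, -1:] ^ n dvd euler_op p"
proof -
  obtain q where q: "p = [:1, -1:] ^ Suc n * q" using assms by (elim dvdE)
  have "pderiv p = [:1, -1:] ^ n * ([:1, -1:] * pderiv q + smult (real (Suc n)) (pderiv [:1, -1:] * q))"
    unfolding q pderiv_mult pderiv_power_Suc by (simp add: algebra_simps del: of_nat_Suc)
  thus ?thesis unfolding euler_op_def by (metis dvd_mult dvd_triv_left)
qed

lemma euler_op_iter_dvd: "i \<le> n \<Longrightarrow> [:1, -1:] ^ n dvd p \<Longrightarrow> [:1, -1:] ^ (n - i) dvd (euler_op ^^ i) p"
proof (induction i)
  case (Suc i)
  hence "[:1, -1:] ^ Suc (n - Suc i) dvd (euler_op ^^ i) p" by (simp add: Suc_diff_Suc del: power_Suc)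
  thus ?case using euler_op_dvd by simp
qed simp

lemma poly_1_sum_coeff:
  assumes "\<And>k. k > M \<Longrightarrow> coeff p k = 0"
  shows "poly p (1::real) = (\<Sum>k\<le>M. coeff p k)"
proof -
  have "degree p \<le> M" using assms by (intro degree_le) auto
  hence "(\<Sum>k\<le>degree p. coeff p k) = (\<Sum>k\<le>M. coeff p k)"
    by (intro sum.mono_neutral_left) (auto simp: coeff_eq_0)
  thus ?thesis by (simp add: poly_altdef)
qed

lemma krawtchouk_eq_0: "k > x + y \<Longrightarrow> krawtchouk x y k = 0"
  unfolding krawtchouk_def
  by (intro coeff_eq_0 le_less_trans[OF degree_mult_le]) (simp add: degree_linear_power degree_power_eq)

text \<open>Moments of the coefficient sequence are values at \<open>t = 1\<close> of iterates of
  \<open>t d/dt\<close>. The generating function vanishes there to order \<open>x\<close>, and each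
  application lowers that order by at most one.\<close>

lemma krawtchouk_power_sum:
  assumes "i < x"
  shows "(\<Sum>k\<le>x + y. krawtchouk x y k * real k ^ i) = 0"
proof -
  define G where "G = [:1, -1:] ^ x * [:1, 1::real:] ^ y"
  have "(\<Sum>k\<le>x + y. krawtchouk x y k * real k ^ i) = (\<Sum>k\<le>x + y. coeff ((euler_op ^^ i) G) k)"
    by (simp add: coeff_euler_op_iter krawtchouk_def G_def mult.commute)
  also have "\<dots> = poly ((euler_op ^^ i) G) 1"
    using krawtchouk_eq_0 by (intro poly_1_sum_coeff[symmetric]) (auto simp: coeff_euler_op_iter krawtchouk_def G_def)
  also have "\<dots> = 0"
  proof -
    have "[:1, -1:] ^ (x - i) dvd (euler_op ^^ i) G"
      by (rule euler_op_iter_dvd) (use assms in \<open>auto simp: G_def\<close>)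
    then obtain q where q: "(euler_op ^^ i) G = [:1, -1:] ^ (x - i) * q" by (elim dvdE)
    show ?thesis using assms unfolding q by (simp add: zero_power)
  qed
  finally show ?thesis .
qed

text \<open>Bounding coefficients instead of the degree covers \<open>x = 0\<close>, where the
  hypothesis forces \<open>q = 0\<close>.\<close>

lemma krawtchouk_orthogonal:
  assumes "\<And>i. i \<ge> x \<Longrightarrow> coeff q i = 0"
  shows "(\<Sum>k\<le>x + y. krawtchouk x y k * poly q (real k)) = 0"
proof (cases "q = 0")
  case False
  have deg: "degree q < x"
    using assms False leading_coeff_0_iff not_le by blast
  have "(\<Sum>k\<le>x + y. krawtchouk x y k * poly q (real k)) =
     (\<Sum>i\<le>degree q. coeff q i * (\<Sum>k\<le>x + y. krawtchouk x y k * real k ^ i))"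
    unfolding poly_altdef sum_distrib_left by (subst sum.swap) (simp add: mult_ac)
  also have "\<dots> = 0" using deg by (intro sum.neutral) (auto simp: krawtchouk_power_sum)
  finally show ?thesis .
qed simp

lemma prod_linear_dvd:
  fixes Q :: "real poly"
  assumes "finite A" and "inj_on f A" and "\<And>i. i \<in> A \<Longrightarrow> poly Q (f i) = 0"
  shows "(\<Prod>i\<in>A. [:- f i, 1:]) dvd Q"
  using assms
proof (induction A)
  case (insert a A)
  then obtain q where q: "Q = (\<Prod>i\<in>A. [:- f i, 1:]) * q" by (auto elim: dvdE)
  have "poly (\<Prod>i\<in>A. [:- f i, 1:]) (f a) \<noteq> 0"
    using insert by (auto simp: poly_prod inj_on_def)
  with insert.prems(2)[of a] have "poly q (f a) = 0" by (simp add: q)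
  hence "[:- f a, 1:] dvd q" by (simp add: poly_eq_0_iff_dvd)
  hence "(\<Prod>i\<in>A. [:- f i, 1:]) * [:- f a, 1:] dvd Q" unfolding q by (intro mult_dvd_mono) auto
  thus ?case unfolding prod.insert[OF insert.hyps] by (simp only: mult.commute)
qed simp

text \<open>
  A combination \<open>Q\<close> of \<open>r + 1\<close> consecutive dual polynomials that vanishes at all \<open>f i\<close> is a multiple
  \<open>\<omega> q\<close> of \<open>\<omega> = \<Prod>(k - f i)\<close>. By orthogonality \<open>\<langle>\<omega> q, q\<rangle>\<close> only sees the product of the
  two extreme coefficients, whereas the nonnegativity of \<open>\<omega>\<close> on the lattice gives its sign.
\<close>

lemma krawtchouk_null_combination:
  fixes f :: "nat \<Rightarrow> nat" and \<alpha> :: "nat \<Rightarrow> real"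
  assumes M: "x + r \<le> M" and r: "even r" and inj: "inj_on f {..<r}" and fM: "\<And>i. i < r \<Longrightarrow> f i \<le> M"
    and pos: "\<And>k. (\<Prod>i<r. real k - real (f i)) \<ge> 0"
    and null: "\<And>i. i < r \<Longrightarrow> (\<Sum>j\<le>r. \<alpha> j * krawtchouk (x + j) (M - (x + j)) (f i)) = 0"
  shows "\<alpha> 0 * \<alpha> r \<ge> 0" and "\<alpha> 0 * \<alpha> r = 0 \<Longrightarrow> \<forall>j\<le>r. \<alpha> j = 0"
proof -
  define E where "E = dual_krawtchouk M"
  define e where "e = (\<lambda>x. coeff (E x) x)"
  have degE: "degree (E i) \<le> i" and e: "(-1) ^ i * e i > 0" if "i \<le> M" for i
    using dual_krawtchouk_degree[OF that] by (auto simp: E_def e_def)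
  have e_nz: "e i \<noteq> 0" if "i \<le> M" for i using e[OF that] by auto
  have K: "krawtchouk i (M - i) k = real (M choose k) * poly (E i) (real k)" if "i \<le> M" for i k
    using dual_krawtchouk[OF that] by (simp add: E_def)
  define Q where "Q = (\<Sum>j\<le>r. smult (\<alpha> j) (E (x + j)))"
  define om where "om = (\<Prod>i<r. [:- real (f i), 1:])"
  have "poly Q (real (f i)) = 0" if "i < r" for i
  proof -
    have "0 = (\<Sum>j\<le>r. \<alpha> j * krawtchouk (x + j) (M - (x + j)) (f i))" using null[OF that] by simp
    also have "\<dots> = (\<Sum>j\<le>r. \<alpha> j * (real (M choose f i) * poly (E (x + j)) (real (f i))))"
      using M by (intro sum.cong refl, subst K) auto
    also have "\<dots> = real (M choose f i) * poly Q (real (f i))"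
      by (simp add: Q_def poly_sum sum_distrib_left mult_ac)
    finally show ?thesis using fM[OF that] by simp
  qed
  hence "om dvd Q" unfolding om_def
    by (intro prod_linear_dvd) (use inj in \<open>auto simp: inj_on_def\<close>)
  then obtain q where Q: "Q = om * q" by (elim dvdE)
  have deg_om: "degree om = r"
    unfolding om_def by (simp add: degree_prod_eq_sum_degree)
  have "lead_coeff om = (\<Prod>i<r. lead_coeff [:- real (f i), 1:])"
    unfolding om_def by (rule lead_coeff_prod)
  hence om_monic: "lead_coeff om = 1" by simp
  have coeffQ: "coeff Q i = 0" if "i > x + r" for i
    unfolding Q_def coeff_sum coeff_smult
  proof (intro sum.neutral ballI)
    fix j assume "j \<in> {..r}"
    hence "coeff (E (x + j)) i = 0"
      using degE[of "x + j"] M that by (intro coeff_eq_0) auto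
    thus "\<alpha> j * coeff (E (x + j)) i = 0" by simp
  qed
  have coeffq: "coeff q i = 0" if "i > x" for i
  proof (cases "q = 0")
    case False
    have "degree Q = r + degree q" unfolding Q using False om_monic
      by (subst degree_mult_eq) (auto simp: deg_om)
    moreover have "degree Q \<le> x + r" using coeffQ by (intro degree_le) auto
    ultimately show ?thesis using that by (intro coeff_eq_0) auto
  qed simp
  have "coeff Q (x + r) = coeff q x"
  proof -
    have "coeff Q (r + x) = (\<Sum>i\<le>r + x. coeff om i * coeff q (r + x - i))" unfolding Q coeff_mult ..
    also have "\<dots> = (\<Sum>i\<le>r + x. if i = r then coeff q x else 0)"
    proof (rule sum.cong[OF refl])
      fix i assume i: "i \<in> {..r + x}"
      show "coeff om i * coeff q (r + x - i) = (if i = r then coeff q x else 0)"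
      proof (cases i r rule: linorder_cases)
        case less
        thus ?thesis using coeffq[of "r + x - i"] by simp
      next
        case equal
        thus ?thesis using om_monic deg_om by simp
      next
        case greater
        thus ?thesis using coeff_eq_0[of om i] deg_om by simp
      qed
    qed
    finally show ?thesis by (simp add: add.commute)
  qed
  moreover have "coeff Q (x + r) = \<alpha> r * e (x + r)"
  proof -
    have "coeff Q (x + r) = (\<Sum>j\<le>r. if j = r then \<alpha> r * e (x + r) else 0)"
      unfolding Q_def coeff_sum coeff_smult
    proof (rule sum.cong[OF refl])
      fix j assume "j \<in> {..r}"
      thus "\<alpha> j * coeff (E (x + j)) (x + r) = (if j = r then \<alpha> r * e (x + r) else 0)"
        using degE[of "x + j"] M coeff_eq_0[of "E (x + j)" "x + r"] by (auto simp: e_def)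
    qed
    thus ?thesis by simp
  qed
  ultimately have qx: "coeff q x = \<alpha> r * e (x + r)" by simp
  \<comment> \<open>\<open>S\<close> is the weighted pairing of \<open>Q\<close> with
    \<open>q\<close>, computed in two ways: as a sum of nonnegative terms and by orthogonality.
    \<open>N\<close> is the squared norm of \<open>E x\<close>.\<close>
  define S where "S = (\<Sum>k\<le>M. real (M choose k) * (poly om (real k) * poly q (real k) ^ 2))"
  define N where "N = (\<Sum>k\<le>M. real (M choose k) * poly (E x) (real k) ^ 2)"
  have "N > 0"
  proof -
    have "E x \<noteq> 0" using e_nz[of x] M by (auto simp: e_def)
    have "\<exists>k\<le>M. poly (E x) (real k) \<noteq> 0"
    proof (rule ccontr)
      assume "\<not> (\<exists>k\<le>M. poly (E x) (real k) \<noteq> 0)"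
      hence "real ` {..M} \<subseteq> {t. poly (E x) t = 0}" by auto
      hence "card (real ` {..M}) \<le> card {t. poly (E x) t = 0}"
        using poly_roots_finite[OF \<open>E x \<noteq> 0\<close>] by (intro card_mono) auto
      also have "\<dots> \<le> degree (E x)" by (rule card_poly_roots_bound) fact
      also have "\<dots> \<le> x" using degE M by simp
      finally show False using M by (simp add: card_image)
    qed
    then obtain k where k: "k \<le> M" "poly (E x) (real k) \<noteq> 0" by auto
    have "real (M choose k) * poly (E x) (real k) ^ 2 > 0" using k by simp
    thus ?thesis unfolding N_def using k(1) by (intro sum_pos2[of _ k]) auto
  qed
  \<comment> \<open>\<open>krawtchouk\<close> already contains the binomial weight, so
    \<open>E (x + j)\<close> is orthogonal to all polynomials of degree below
    \<open>x + j\<close>.\<close>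
  have ortho: "(\<Sum>k\<le>M. krawtchouk (x + j) (M - (x + j)) k * poly p (real k)) = 0"
    if "j \<le> r" "\<And>i. i \<ge> x + j \<Longrightarrow> coeff p i = 0" for j p
    using krawtchouk_orthogonal[of "x + j" p "M - (x + j)"] that M by simp
  have "S = (\<Sum>k\<le>M. real (M choose k) * poly Q (real k) * poly q (real k))"
    unfolding S_def Q by (simp add: power2_eq_square mult_ac)
  also have "\<dots> = (\<Sum>k\<le>M. \<Sum>j\<le>r. \<alpha> j * (krawtchouk (x + j) (M - (x + j)) k * poly q (real k)))"
  proof (rule sum.cong[OF refl])
    fix k
    have "(\<Sum>j\<le>r. \<alpha> j * (krawtchouk (x + j) (M - (x + j)) k * poly q (real k))) =
       (\<Sum>j\<le>r. \<alpha> j * (real (M choose k) * poly (E (x + j)) (real k) * poly q (real k)))"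
      using M by (intro sum.cong refl, subst K) auto
    thus "real (M choose k) * poly Q (real k) * poly q (real k) =
       (\<Sum>j\<le>r. \<alpha> j * (krawtchouk (x + j) (M - (x + j)) k * poly q (real k)))"
      by (simp add: Q_def poly_sum sum_distrib_left sum_distrib_right mult_ac)
  qed
  also have "\<dots> = (\<Sum>j\<le>r. \<alpha> j * (\<Sum>k\<le>M. krawtchouk (x + j) (M - (x + j)) k * poly q (real k)))"
    by (subst sum.swap) (simp add: sum_distrib_left)
  also have "\<dots> = (\<Sum>j\<le>r. if j = 0 then \<alpha> 0 * (\<Sum>k\<le>M. krawtchouk x (M - x) k * poly q (real k)) else 0)"
  proof (rule sum.cong[OF refl])
    fix j assume "j \<in> {..r}"
    thus "\<alpha> j * (\<Sum>k\<le>M. krawtchouk (x + j) (M - (x + j)) k * poly q (real k)) =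
       (if j = 0 then \<alpha> 0 * (\<Sum>k\<le>M. krawtchouk x (M - x) k * poly q (real k)) else 0)"
      using ortho[of j q] coeffq by auto
  qed
  also have "\<dots> = \<alpha> 0 * (\<Sum>k\<le>M. krawtchouk x (M - x) k * poly q (real k))" by simp
  also have "(\<Sum>k\<le>M. krawtchouk x (M - x) k * poly q (real k)) = coeff q x / e x * N"
  proof -
    \<comment> \<open>The multiple of \<open>E x\<close> that agrees with \<open>q\<close> in the
      coefficient of order \<open>x\<close>; the remainder has smaller degree and does not
      contribute.\<close>
    define t where "t = coeff q x / e x"
    have "coeff (q - smult t (E x)) i = 0" if "i \<ge> x" for i
    proof (cases "i = x")
      case True
      thus ?thesis using e_nz[of x] M by (simp add: t_def e_def)
    next
      case False
      thus ?thesis using coeffq[of i] coeff_eq_0[of "E x" i] degE[of x] M that by simp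
    qed
    hence "(\<Sum>k\<le>M. krawtchouk x (M - x) k * poly (q - smult t (E x)) (real k)) = 0"
      using ortho[of 0 "q - smult t (E x)"] by simp
    hence "(\<Sum>k\<le>M. krawtchouk x (M - x) k * poly q (real k)) = t * (\<Sum>k\<le>M. krawtchouk x (M - x) k * poly (E x) (real k))"
      by (simp add: algebra_simps sum_subtractf sum_distrib_left)
    also have "(\<Sum>k\<le>M. krawtchouk x (M - x) k * poly (E x) (real k)) = N"
      unfolding N_def using M by (subst K) (auto simp: power2_eq_square mult_ac)
    finally show ?thesis by (simp add: t_def)
  qed
  finally have S: "S = (\<alpha> 0 * \<alpha> r) * (e (x + r) / e x * N)" by (simp add: qx)
  have "e (x + r) / e x > 0"
  \<comment> \<open>The signs of the leading coefficients alternate, so the quotient is positive for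
    even \<open>r\<close>.\<close>
  proof -
    have "0 < ((-1) ^ (x + r) * e (x + r)) * ((-1) ^ x * e x)"
      by (rule mult_pos_pos) (use e M in simp_all)
    also have "\<dots> = e (x + r) * e x" using r by (simp add: power_add mult_ac flip: power_mult_distrib)
    finally show ?thesis by (simp add: zero_less_mult_iff zero_less_divide_iff)
  qed
  with \<open>N > 0\<close> have c: "e (x + r) / e x * N > 0" by (metis mult_pos_pos)
  have om_val: "poly om (real k) = (\<Prod>i<r. real k - real (f i))" for k
    by (simp add: om_def poly_prod)
  have S_ge: "S \<ge> 0" unfolding S_def om_val using pos by (intro sum_nonneg mult_nonneg_nonneg) auto
  with S show "\<alpha> 0 * \<alpha> r \<ge> 0" using mult_neg_pos[OF _ c, of "\<alpha> 0 * \<alpha> r"] by linarith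
  assume "\<alpha> 0 * \<alpha> r = 0"
  with S have "S = 0" by simp
  hence zero: "real (M choose k) * (poly om (real k) * poly q (real k) ^ 2) = 0" if "k \<le> M" for k
    unfolding S_def om_val using that pos
    by (subst (asm) sum_nonneg_eq_0_iff) (auto intro!: mult_nonneg_nonneg)
  have "q = 0"
  proof (rule ccontr)
    assume "q \<noteq> 0"
    \<comment> \<open>Off the nodes \<open>om\<close> is nonzero, so \<open>q\<close> would have at
      least \<open>M + 1 - r > x\<close> lattice zeros, too many for degree at most
      \<open>x\<close>.\<close>
    have "real ` ({..M} - f ` {..<r}) \<subseteq> {t. poly q t = 0}"
      using zero by (auto simp: om_val)
    hence "card (real ` ({..M} - f ` {..<r})) \<le> card {t. poly q t = 0}"
      using poly_roots_finite[OF \<open>q \<noteq> 0\<close>] by (intro card_mono) auto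
    also have "\<dots> \<le> degree q" by (rule card_poly_roots_bound) fact
    also have "\<dots> \<le> x" using coeffq by (intro degree_le) auto
    finally have "card ({..M} - f ` {..<r}) \<le> x" by (simp add: card_image)
    moreover have "card ({..M} - f ` {..<r}) = Suc M - r"
      using fM inj by (subst card_Diff_subset) (auto simp: card_image)
    ultimately show False using M by simp
  qed
  hence "Q = 0" by (simp add: Q)
  show "\<forall>j\<le>r. \<alpha> j = 0"
  proof (rule ccontr)
    assume "\<not> (\<forall>j\<le>r. \<alpha> j = 0)"
    define J where "J = {j. j \<le> r \<and> \<alpha> j \<noteq> 0}"
    have J: "finite J" "J \<noteq> {}" using \<open>\<not> (\<forall>j\<le>r. \<alpha> j = 0)\<close> by (auto simp: J_def)
    define j where "j = Max J"
    have j: "j \<le> r" "\<alpha> j \<noteq> 0" using Max_in[OF J] by (auto simp: J_def j_def)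
    have jmax: "\<alpha> i = 0" if "i \<le> r" "i > j" for i
    proof (rule ccontr)
      assume "\<alpha> i \<noteq> 0"
      hence "i \<in> J" using that by (simp add: J_def)
      hence "i \<le> j" unfolding j_def by (rule Max_ge[OF J(1)])
      thus False using that by simp
    qed
    have "coeff Q (x + j) = (\<Sum>i\<le>r. if i = j then \<alpha> j * e (x + j) else 0)"
      unfolding Q_def coeff_sum coeff_smult
    proof (rule sum.cong[OF refl])
      fix i assume i: "i \<in> {..r}"
      show "\<alpha> i * coeff (E (x + i)) (x + j) = (if i = j then \<alpha> j * e (x + j) else 0)"
        using i jmax[of i] degE[of "x + i"] M coeff_eq_0[of "E (x + i)" "x + j"]
        by (cases i j rule: linorder_cases) (auto simp: e_def)
    qed
    hence "coeff Q (x + j) = \<alpha> j * e (x + j)" using j by simp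
    thus False using j e_nz[of "x + j"] M \<open>Q = 0\<close> by simp
  qed
qed

section \<open>Signs of Casorati determinants\<close>

lemma det_mat_transpose:
  fixes a :: "nat \<Rightarrow> nat \<Rightarrow> 'a::comm_ring_1"
  shows "Determinant.det (Matrix.mat n n (\<lambda>(i, j). a i j)) = Determinant.det (Matrix.mat n n (\<lambda>(i, j). a j i))"
proof -
  have "transpose_mat (Matrix.mat n n (\<lambda>(i, j). a i j)) = Matrix.mat n n (\<lambda>(i, j). a j i)"
    by (rule eq_matI) auto
  thus ?thesis using Determinant.det_transpose[of "Matrix.mat n n (\<lambda>(i, j). a i j)" n] by simp
qed

lemma det_mat_leibniz:
  "Determinant.det (Matrix.mat n n (\<lambda>(i, j). b i j)) =
    (\<Sum>p | p permutes {0..<n}. signof p * (\<Prod>i=0..<n. b i (p i)))"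
  unfolding Determinant.det_def by (auto intro!: sum.cong prod.cong dest: permutes_in_image)

lemma det_mat_scale:
  fixes a :: "nat \<Rightarrow> nat \<Rightarrow> 'a::comm_ring_1"
  shows "Determinant.det (Matrix.mat n n (\<lambda>(i, j). u i * v j * a i j)) =
    (\<Prod>i<n. u i) * (\<Prod>j<n. v j) * Determinant.det (Matrix.mat n n (\<lambda>(i, j). a i j))"
  unfolding det_mat_leibniz sum_distrib_left
proof (rule sum.cong[OF refl])
  fix p assume "p \<in> {p. p permutes {0..<n}}"
  hence "(\<Prod>i=0..<n. v (p i)) = (\<Prod>i=0..<n. v i)"
    using prod.permute[of p "{0..<n}" v] by (simp add: o_def)
  thus "signof p * (\<Prod>i=0..<n. u i * v (p i) * a i (p i)) =
    (\<Prod>i<n. u i) * (\<Prod>j<n. v j) * (signof p * (\<Prod>i=0..<n. a i (p i)))"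
    by (simp add: prod.distrib atLeast0LessThan mult_ac)
qed

lemma tendsto_det_mat:
  fixes a :: "'b \<Rightarrow> nat \<Rightarrow> nat \<Rightarrow> 'a::real_normed_field"
  assumes "\<And>i j. i < n \<Longrightarrow> j < n \<Longrightarrow> ((\<lambda>N. a N i j) \<longlongrightarrow> l i j) F"
  shows "((\<lambda>N. Determinant.det (Matrix.mat n n (\<lambda>(i, j). a N i j))) \<longlongrightarrow>
    Determinant.det (Matrix.mat n n (\<lambda>(i, j). l i j))) F"
  unfolding det_mat_leibniz
  by (intro tendsto_sum tendsto_mult tendsto_const tendsto_prod assms)
     (auto dest: permutes_in_image)

text \<open>The Casorati determinant in \<open>x\<close>, the discrete counterpart of a Wronskian,
  with shifts at fixed \<open>M\<close> in place of derivatives.\<close>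

definition krawtchouk_det :: "nat \<Rightarrow> (nat \<Rightarrow> nat) \<Rightarrow> nat \<Rightarrow> nat \<Rightarrow> real" where
  "krawtchouk_det r f M x =
     Determinant.det (Matrix.mat r r (\<lambda>(i, j). krawtchouk (x + j) (M - (x + j)) (f i)))"

context
  fixes r :: nat and f :: "nat \<Rightarrow> nat"
  assumes r: "even r" and inj: "inj_on f {..<r}"
    and pos: "\<And>k. (\<Prod>i<r. real k - real (f i)) \<ge> 0"
begin

text \<open>A dependence between the \<open>r\<close> columns is a null combination of
  \<open>r + 1\<close> columns whose last coefficient is zero, and such a combination is
  trivial.\<close>

lemma krawtchouk_det_nonzero:
  assumes "x + r \<le> M" and "\<And>i. i < r \<Longrightarrow> f i \<le> M"
  shows "krawtchouk_det r f M x \<noteq> 0"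
proof
  assume "krawtchouk_det r f M x = 0"
  then obtain c j where c: "j < r" "c j \<noteq> 0"
    "\<And>i. i < r \<Longrightarrow> (\<Sum>j<r. krawtchouk (x + j) (M - (x + j)) (f i) * c j) = 0"
    unfolding krawtchouk_det_def det_mat_eq_0_iff by auto
  define \<alpha> where "\<alpha> = (\<lambda>j. if j < r then c j else 0)"
  have "(\<Sum>j\<le>r. \<alpha> j * krawtchouk (x + j) (M - (x + j)) (f i)) = 0" if "i < r" for i
  proof -
    have "(\<Sum>j\<le>r. \<alpha> j * krawtchouk (x + j) (M - (x + j)) (f i)) =
       (\<Sum>j<r. krawtchouk (x + j) (M - (x + j)) (f i) * c j)"
      by (simp add: \<alpha>_def mult.commute flip: lessThan_Suc_atMost)
    thus ?thesis using c(3)[OF that] by simp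
  qed
  hence "\<forall>j\<le>r. \<alpha> j = 0"
    by (intro krawtchouk_null_combination(2)[OF assms(1) r inj assms(2) pos]) (auto simp: \<alpha>_def)
  hence "\<alpha> j = 0" using c(1) by simp
  thus False using c(1,2) by (simp add: \<alpha>_def)
qed

text \<open>The maximal minors of the array with \<open>r\<close> rows and \<open>r + 1\<close>
  columns, taken with alternating signs, form a null combination. Its first and last coefficients
  are the two determinants, without a sign because \<open>r\<close> is even.\<close>

lemma krawtchouk_det_Suc:
  assumes M: "x + r \<le> M" and fM: "\<And>i. i < r \<Longrightarrow> f i \<le> M"
  shows "krawtchouk_det r f M x * krawtchouk_det r f M (Suc x) > 0"
proof -
  define K where "K = (\<lambda>i j. krawtchouk (x + j) (M - (x + j)) (f i))"
  define \<alpha> where "\<alpha> = (\<lambda>j. (-1) ^ (j + 0) * Determinant.det (Matrix.mat r r (\<lambda>(j', i).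
     K i (if j' < j then j' else Suc j'))))"
  have "(\<Sum>j\<le>r. \<alpha> j * K i0 j) = 0" if i0: "i0 < r" for i0
  proof -
    \<comment> \<open>The array bordered by a copy of its row \<open>i0\<close>: the determinant is
      zero, and its expansion along the copy is the desired relation.\<close>
    define a where "a = (\<lambda>j i. if i = 0 then K i0 j else K (i - 1) j)"
    have "Determinant.det (Matrix.mat (Suc r) (Suc r) (\<lambda>(j, i). a j i)) =
      (\<Sum>j\<le>r. a j 0 * ((-1) ^ (j + 0) * Determinant.det (Matrix.mat r r (\<lambda>(j', i).
         a (if j' < j then j' else Suc j') (if i < 0 then i else Suc i)))))"
      by (rule det_mat_laplace_column) simp
    also have "\<dots> = (\<Sum>j\<le>r. \<alpha> j * K i0 j)"
      by (simp add: a_def \<alpha>_def mult.commute)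
    also have "Determinant.det (Matrix.mat (Suc r) (Suc r) (\<lambda>(j, i). a j i)) = 0"
      by (rule Determinant.det_identical_columns[of _ "Suc r" 0 "Suc i0"])
         (use i0 in \<open>auto intro!: eq_vecI simp: a_def\<close>)
    finally show ?thesis by simp
  qed
  note null = this[unfolded K_def]
  have "\<alpha> 0 = krawtchouk_det r f M (Suc x)"
    unfolding \<alpha>_def krawtchouk_det_def by (subst det_mat_transpose) (simp add: K_def)
  moreover have "\<alpha> r = krawtchouk_det r f M x"
  proof -
    have "\<alpha> r = Determinant.det (Matrix.mat r r (\<lambda>(j', i). K i (if j' < r then j' else Suc j')))"
      using r by (simp add: \<alpha>_def)
    also have "\<dots> = Determinant.det (Matrix.mat r r (\<lambda>(j', i). K i j'))"
      by (rule det_cong) simp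
    also have "\<dots> = krawtchouk_det r f M x"
      unfolding krawtchouk_det_def K_def by (rule det_mat_transpose)
    finally show ?thesis .
  qed
  moreover note krawtchouk_null_combination[OF M r inj fM pos null]
  moreover have "\<alpha> r \<noteq> 0"
    using krawtchouk_det_nonzero[OF M fM] \<open>\<alpha> r = krawtchouk_det r f M x\<close> by simp
  ultimately show ?thesis
    by (metis less_eq_real_def mult.commute order_refl)
qed

lemma krawtchouk_det_same_sign:
  assumes "x \<le> y" and "y + r \<le> M" and "\<And>i. i < r \<Longrightarrow> f i \<le> M"
  shows "krawtchouk_det r f M x * krawtchouk_det r f M y > 0"
  using assms(1,2)
proof (induction y rule: dec_induct)
  case base
  show ?case using krawtchouk_det_nonzero[of x M] assms base by (auto simp: zero_less_mult_iff linorder_neq_iff)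
next
  case (step y)
  have "krawtchouk_det r f M x * krawtchouk_det r f M y > 0" using step by simp
  moreover have "krawtchouk_det r f M y * krawtchouk_det r f M (Suc y) > 0"
    using krawtchouk_det_Suc[of y M] step assms by simp
  ultimately show ?case by (auto simp: zero_less_mult_iff)
qed

end

section \<open>The Hermite limit of the Casorati determinants\<close>

lemma krawtchouk_difference:
  assumes "j \<le> y"
  shows "(\<Sum>l\<le>j. real (j choose l) * (-1) ^ (j - l) * krawtchouk (x + l) (y - l) k) =
    (-2) ^ j * (if j \<le> k then krawtchouk x (y - j) (k - j) else 0)"
proof -
  let ?a = "[:1, -1::real:]" and ?b = "[:1, 1::real:]"
  \<comment> \<open>A shift of \<open>x\<close> by one at fixed \<open>x + y\<close> replaces a
    factor \<open>1 + t\<close> by \<open>1 - t\<close>, so the \<open>j\<close>-th difference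
    replaces \<open>j\<close> factors \<open>1 + t\<close> by \<open>(- 2 t) ^ j\<close>.\<close>
  have "(?a + - ?b) ^ j = (\<Sum>l\<le>j. of_nat (j choose l) * ?a ^ l * (- ?b) ^ (j - l))"
    by (rule binomial_ring)
  also have "?a + - ?b = monom (-2) 1" by (simp add: monom_altdef)
  finally have "monom ((-2) ^ j) j * (?a ^ x * ?b ^ (y - j)) =
     (\<Sum>l\<le>j. of_nat (j choose l) * ?a ^ l * (- ?b) ^ (j - l)) * (?a ^ x * ?b ^ (y - j))"
    by (simp add: monom_power)
  also have "\<dots> = (\<Sum>l\<le>j. smult (real (j choose l) * (-1) ^ (j - l)) (?a ^ (x + l) * ?b ^ (y - l)))"
    unfolding sum_distrib_right
  proof (rule sum.cong[OF refl])
    fix l assume "l \<in> {..j}"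
    hence "y - l = (j - l) + (y - j)" using assms by simp
    hence "?b ^ (y - l) = ?b ^ (j - l) * ?b ^ (y - j)" by (metis power_add)
    moreover have "(- ?b) ^ (j - l) = smult ((-1) ^ (j - l)) (?b ^ (j - l))"
      by (metis smult_minus_left smult_1_left smult_power)
    ultimately show "of_nat (j choose l) * ?a ^ l * (- ?b) ^ (j - l) * (?a ^ x * ?b ^ (y - j)) =
      smult (real (j choose l) * (-1) ^ (j - l)) (?a ^ (x + l) * ?b ^ (y - l))"
      by (simp add: of_nat_poly power_add mult_ac)
  qed
  finally have eq: "monom ((-2) ^ j) j * (?a ^ x * ?b ^ (y - j)) =
     (\<Sum>l\<le>j. smult (real (j choose l) * (-1) ^ (j - l)) (?a ^ (x + l) * ?b ^ (y - l)))" .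
  from arg_cong[OF this, of "\<lambda>p. coeff p k"] show ?thesis
    unfolding coeff_sum coeff_smult coeff_monom_mult krawtchouk_def[symmetric]
    by (auto simp: krawtchouk_def[symmetric])
qed

text \<open>Passing from shifted columns to their differences is a unipotent change of basis.
  Differences scale to derivatives, whereas the shifted columns all have the same limit.\<close>

lemma krawtchouk_det_difference:
  assumes "x + r \<le> M"
  shows "krawtchouk_det r f M x = Determinant.det (Matrix.mat r r (\<lambda>(i, j).
     (-2) ^ j * (if j \<le> f i then krawtchouk x (M - x - j) (f i - j) else 0)))"
proof -
  define A where "A = Matrix.mat r r (\<lambda>(i, j). krawtchouk (x + j) (M - (x + j)) (f i))"
  define L where "L = Matrix.mat r r (\<lambda>(l, j). if l \<le> j then real (j choose l) * (-1) ^ (j - l) else 0)"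
  have "Determinant.det L = prod_list (diag_mat L)"
    by (rule det_upper_triangular[of _ r]) (auto simp: L_def upper_triangular_def)
  also have "diag_mat L = replicate r 1"
    by (rule nth_equalityI) (auto simp: diag_mat_def L_def)
  finally have "Determinant.det L = 1" by simp
  moreover have "Determinant.det (A * L) = Determinant.det A * Determinant.det L"
    by (rule Determinant.det_mult[of _ r]) (auto simp: A_def L_def)
  moreover have "A * L = Matrix.mat r r (\<lambda>(i, j).
     (-2) ^ j * (if j \<le> f i then krawtchouk x (M - x - j) (f i - j) else 0))"
  proof (rule eq_matI)
    fix i j assume "i < dim_row (Matrix.mat r r (\<lambda>(i, j).
     (-2) ^ j * (if j \<le> f i then krawtchouk x (M - x - j) (f i - j) else (0::real))))"
     "j < dim_col (Matrix.mat r r (\<lambda>(i, j).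
     (-2) ^ j * (if j \<le> f i then krawtchouk x (M - x - j) (f i - j) else (0::real))))"
    hence ij: "i < r" "j < r" by auto
    have "(A * L) $$ (i, j) = (\<Sum>l\<in>{0..<r}. krawtchouk (x + l) (M - (x + l)) (f i) *
        (if l \<le> j then real (j choose l) * (-1) ^ (j - l) else 0))"
      using ij by (simp add: A_def L_def scalar_prod_def)
    also have "\<dots> = (\<Sum>l\<le>j. real (j choose l) * (-1) ^ (j - l) * krawtchouk (x + l) (M - x - l) (f i))"
      using ij by (intro sum.mono_neutral_cong_right) (auto simp: mult_ac)
    also have "\<dots> = (-2) ^ j * (if j \<le> f i then krawtchouk x (M - x - j) (f i - j) else 0)"
      by (rule krawtchouk_difference) (use assms ij in auto)
    finally show "(A * L) $$ (i, j) = Matrix.mat r r (\<lambda>(i, j).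
     (-2) ^ j * (if j \<le> f i then krawtchouk x (M - x - j) (f i - j) else 0)) $$ (i, j)"
      using ij by simp
  qed (auto simp: A_def L_def)
  ultimately show ?thesis by (simp add: krawtchouk_det_def A_def)
qed

text \<open>With the factor \<open>\<epsilon> ^ k\<close> the recurrence in \<open>k\<close> tends
  to \<open>(k + 2) L (k + 2) = 2 X L (k + 1) - 2 L k\<close>, the recurrence of
  \<open>hermite k / k!\<close>.\<close>

lemma krawtchouk_tendsto_hermite:
  fixes \<epsilon> :: "nat \<Rightarrow> real" and x y :: "nat \<Rightarrow> nat"
  assumes eps: "\<epsilon> \<longlonglongrightarrow> 0"
    and lim1: "(\<lambda>n. \<epsilon> n * (real (y n) - real (x n))) \<longlonglongrightarrow> 2 * X"
    and lim2: "(\<lambda>n. \<epsilon> n ^ 2 * (real (x n) + real (y n))) \<longlonglongrightarrow> 2"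
  shows "(\<lambda>n. of_real (\<epsilon> n ^ k * krawtchouk (x n) (y n) k)) \<longlonglongrightarrow> poly (hermite k) (of_real X) / fact k"
proof (induction k rule: hermite.induct)
  case 1
  show ?case by (simp add: krawtchouk_0)
next
  case 2
  show ?case using tendsto_of_real[OF lim1, where 'a = complex] by (simp add: krawtchouk_1 mult_ac)
next
  case (3 k)
  define c :: complex where "c = of_nat (Suc (Suc k))"
  have c: "c \<noteq> 0" unfolding c_def by (rule of_nat_neq_0)
  have eq: "of_real (\<epsilon> n ^ Suc (Suc k) * krawtchouk (x n) (y n) (Suc (Suc k))) =
     (of_real (\<epsilon> n * (real (y n) - real (x n))) * of_real (\<epsilon> n ^ Suc k * krawtchouk (x n) (y n) (Suc k)) -
      of_real (\<epsilon> n ^ 2 * (real (x n) + real (y n)) - \<epsilon> n ^ 2 * real k) * of_real (\<epsilon> n ^ k * krawtchouk (x n) (y n) k)) / c" for n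
  proof -
    have "real (Suc (Suc k)) * (\<epsilon> n ^ Suc (Suc k) * krawtchouk (x n) (y n) (Suc (Suc k))) =
      (\<epsilon> n * (real (y n) - real (x n))) * (\<epsilon> n ^ Suc k * krawtchouk (x n) (y n) (Suc k)) -
      (\<epsilon> n ^ 2 * (real (x n) + real (y n)) - \<epsilon> n ^ 2 * real k) * (\<epsilon> n ^ k * krawtchouk (x n) (y n) k)"
      using arg_cong[OF krawtchouk_Suc_Suc[of k "x n" "y n"], of "\<lambda>t. \<epsilon> n ^ Suc (Suc k) * t"]
      by (simp add: algebra_simps power2_eq_square)
    from arg_cong[OF this, of complex_of_real] show ?thesis
      using c unfolding of_real_mult of_real_diff of_real_of_nat_eq c_def[symmetric]
      by (simp add: eq_divide_eq mult.commute)
  qed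
  have "(\<lambda>n. (of_real (\<epsilon> n * (real (y n) - real (x n))) * of_real (\<epsilon> n ^ Suc k * krawtchouk (x n) (y n) (Suc k)) -
      of_real (\<epsilon> n ^ 2 * (real (x n) + real (y n)) - \<epsilon> n ^ 2 * real k) * of_real (\<epsilon> n ^ k * krawtchouk (x n) (y n) k)) / c)
    \<longlonglongrightarrow> (of_real (2 * X) * (poly (hermite (Suc k)) (of_real X) / fact (Suc k)) -
      of_real (2 - 0 ^ 2 * real k) * (poly (hermite k) (of_real X) / fact k)) / c"
    by (intro tendsto_intros lim1 lim2 eps 3 c)
  also have "(of_real (2 * X) * (poly (hermite (Suc k)) (of_real X) / fact (Suc k)) -
      of_real (2 - 0 ^ 2 * real k) * (poly (hermite k) (of_real X) / fact k)) / c =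
      poly (hermite (Suc (Suc k))) (of_real X) / fact (Suc (Suc k))"
  proof -
    define d :: complex where "d = of_nat (Suc k)"
    have d: "d \<noteq> 0" unfolding d_def by (rule of_nat_neq_0)
    have f: "fact (Suc k) = d * (fact k :: complex)" "fact (Suc (Suc k)) = c * (d * (fact k :: complex))"
      by (simp_all add: d_def c_def)
    show ?thesis using c d unfolding f hermite.simps d_def[symmetric] by (simp add: field_simps)
  qed
  finally show ?case unfolding eq .
qed

lemma higher_pderiv_hermite:
  "(pderiv ^^ j) (hermite k) = (if j \<le> k then smult (2 ^ j * fact k / fact (k - j)) (hermite (k - j)) else 0)"
proof (induction j)
  case (Suc j)
  show ?case
  proof (cases "j < k")
    case True
    then obtain i where i: "k - j = Suc i" "k - Suc j = i" by (metis Suc_diff_Suc)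
    have "2 ^ j * fact k / fact (Suc i) * (2 * of_nat (Suc i)) = (2 ^ Suc j * fact k / fact i :: complex)"
      by (simp add: field_simps del: of_nat_Suc)
    thus ?thesis using True Suc i by (simp add: pderiv_smult pderiv_hermite mult_ac del: of_nat_Suc)
  next
    case False
    thus ?thesis using Suc by (auto simp: pderiv_smult)
  qed
qed simp

text \<open>Of the scaling factor only nonnegativity is recorded, as the limit serves to transfer
  signs.\<close>

lemma krawtchouk_det_tendsto:
  fixes X :: real and r :: nat and f :: "nat \<Rightarrow> nat"
  obtains x :: "nat \<Rightarrow> nat" and \<epsilon> :: "nat \<Rightarrow> real"
  where "\<forall>\<^sub>F M in sequentially. x M + r \<le> M" and "\<And>M. \<epsilon> M \<ge> 0"
    and "(\<lambda>M. of_real (\<epsilon> M * krawtchouk_det r f M (x M))) \<longlonglongrightarrow>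
      (\<Prod>i<r. 1 / fact (f i)) * (\<Prod>j<r. (-1) ^ j) *
      poly (wronskian (map (\<lambda>i. hermite (f i)) [0..<r])) (of_real X)"
proof -
  \<comment> \<open>Central limit scaling around \<open>M / 2\<close>: it gives
    \<open>e M ^ 2 * M = 2\<close>, and \<open>e M * (M - 2 * x M)\<close> differs from
    \<open>2 * X\<close> by at most \<open>2 * e M\<close> because of rounding.\<close>
  define e where "e = (\<lambda>M. sqrt (2 / real M))"
  define x where "x = (\<lambda>M. nat \<lfloor>real M / 2 - X / e M\<rfloor>)"
  have e0: "e \<longlonglongrightarrow> 0" unfolding e_def by real_asymp
  have e_pos: "e M > 0" if "M > 0" for M using that by (simp add: e_def)
  have e2: "e M ^ 2 * real M = 2" if "M > 0" for M using that by (simp add: e_def)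
  have ev: "\<forall>\<^sub>F M in sequentially. real M / 2 - X / e M \<ge> 0 \<and> real M / 2 - X / e M + real r + 1 \<le> real M \<and> M > 0"
  proof (intro eventually_conj)
    show "\<forall>\<^sub>F M in sequentially. real M / 2 - X / e M \<ge> 0" unfolding e_def by real_asymp
    show "\<forall>\<^sub>F M in sequentially. real M / 2 - X / e M + real r + 1 \<le> real M" unfolding e_def by real_asymp
    show "\<forall>\<^sub>F M :: nat in sequentially. M > 0" by real_asymp
  qed
  have x_bounds: "real (x M) \<le> real M / 2 - X / e M" "real M / 2 - X / e M < real (x M) + 1"
    if "real M / 2 - X / e M \<ge> 0" for M
    using that unfolding x_def by linarith+
  have xr: "\<forall>\<^sub>F M in sequentially. x M + r \<le> M"
    using ev by eventually_elim (use x_bounds in force)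
  have lim0: "(\<lambda>M. e M * (real M - 2 * real (x M))) \<longlonglongrightarrow> 2 * X"
  proof (rule tendsto_sandwich[where f = "\<lambda>_. 2 * X" and h = "\<lambda>M. 2 * X + 2 * e M"])
    show "\<forall>\<^sub>F M in sequentially. 2 * X \<le> e M * (real M - 2 * real (x M))"
      using ev
    proof eventually_elim
      case (elim M)
      have "2 * X = e M * (2 * (X / e M))" using e_pos[of M] elim by simp
      also have "\<dots> \<le> e M * (real M - 2 * real (x M))"
        using x_bounds[of M] elim e_pos[of M] by (intro mult_left_mono) auto
      finally show ?case .
    qed
    show "\<forall>\<^sub>F M in sequentially. e M * (real M - 2 * real (x M)) \<le> 2 * X + 2 * e M"
      using ev
    proof eventually_elim
      case (elim M)
      have "e M * (real M - 2 * real (x M)) \<le> e M * (2 * (X / e M) + 2)"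
        using x_bounds[of M] elim e_pos[of M] by (intro mult_left_mono) auto
      also have "\<dots> = 2 * X + 2 * e M" using e_pos[of M] elim by (simp add: field_simps)
      finally show ?case .
    qed
    show "(\<lambda>M. 2 * X + 2 * e M) \<longlonglongrightarrow> 2 * X"
      using tendsto_add[OF tendsto_const tendsto_mult[OF tendsto_const e0], of "2 * X" 2] by simp
  qed simp
  define l :: "nat \<Rightarrow> nat \<Rightarrow> complex" where
    "l = (\<lambda>i j. (-2) ^ j * (if j \<le> f i then poly (hermite (f i - j)) (of_real X) / fact (f i - j) else 0))"
  define a where "a = (\<lambda>M i j. (-2) ^ j * (if j \<le> f i then krawtchouk (x M) (M - x M - j) (f i - j) else 0))"
  have lim: "(\<lambda>M. of_real (e M ^ f i * inverse (e M ^ j) * a M i j)) \<longlonglongrightarrow> l i j" if "j < r" for i j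
  proof (cases "j \<le> f i")
    case True
    have "(\<lambda>M. of_real (e M ^ (f i - j) * krawtchouk (x M) (M - x M - j) (f i - j)))
       \<longlonglongrightarrow> poly (hermite (f i - j)) (complex_of_real X) / fact (f i - j)"
    proof (rule krawtchouk_tendsto_hermite[OF e0])
      have "(\<lambda>M. e M * (real M - 2 * real (x M)) - e M * real j) \<longlonglongrightarrow> 2 * X - 0 * real j"
        by (intro tendsto_intros lim0 e0)
      moreover have "\<forall>\<^sub>F M in sequentially. e M * (real M - 2 * real (x M)) - e M * real j =
          e M * (real (M - x M - j) - real (x M))"
        using xr by eventually_elim (use that in \<open>simp add: algebra_simps of_nat_diff\<close>)
      ultimately show "(\<lambda>M. e M * (real (M - x M - j) - real (x M))) \<longlonglongrightarrow> 2 * X"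
        by (subst tendsto_cong[symmetric]) (auto simp: eq_commute elim!: eventually_mono)
      have "(\<lambda>M. 2 - e M ^ 2 * real j) \<longlonglongrightarrow> 2 - 0 ^ 2 * real j"
        by (intro tendsto_intros e0)
      moreover have "\<forall>\<^sub>F M in sequentially. 2 - e M ^ 2 * real j =
          e M ^ 2 * (real (x M) + real (M - x M - j))"
        using xr ev
      proof eventually_elim
        case (elim M)
        have "real (x M) + real (M - x M - j) = real M - real j" using elim that by (simp add: of_nat_diff)
        thus ?case using e2[of M] elim by (simp add: right_diff_distrib)
      qed
      ultimately show "(\<lambda>M. e M ^ 2 * (real (x M) + real (M - x M - j))) \<longlonglongrightarrow> 2"
        by (subst tendsto_cong[symmetric]) (auto simp: eq_commute elim!: eventually_mono)
    qed
    hence "(\<lambda>M. (-2) ^ j * of_real (e M ^ (f i - j) * krawtchouk (x M) (M - x M - j) (f i - j))) \<longlonglongrightarrow>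
        (-2) ^ j * (poly (hermite (f i - j)) (complex_of_real X) / fact (f i - j))"
      by (rule tendsto_mult[OF tendsto_const])
    hence "(\<lambda>M. (-2) ^ j * of_real (e M ^ (f i - j) * krawtchouk (x M) (M - x M - j) (f i - j))) \<longlonglongrightarrow> l i j"
      unfolding l_def if_P[OF True] .
    moreover have "\<forall>\<^sub>F M in sequentially. (-2) ^ j * complex_of_real (e M ^ (f i - j) * krawtchouk (x M) (M - x M - j) (f i - j))
       = of_real (e M ^ f i * inverse (e M ^ j) * a M i j)"
      using ev
    proof eventually_elim
      case (elim M)
      have "e M ^ (f i - j) = e M ^ f i / e M ^ j"
        by (rule power_diff) (use True e_pos[of M] elim in auto)
      hence eq: "e M ^ f i * inverse (e M ^ j) = e M ^ (f i - j)" by (simp only: divide_inverse)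
      show ?case unfolding eq a_def if_P[OF True] by simp
    qed
    ultimately show ?thesis by (rule Lim_transform_eventually)
  next
    case False
    thus ?thesis by (simp add: a_def l_def)
  qed
  \<comment> \<open>Entry \<open>(i, j)\<close> is scaled by \<open>e\<close> to the power
    \<open>f i - j\<close>, a product of a row factor and a column factor, so the scaling comes out
    of the determinant.\<close>
  define E where "E = (\<lambda>M. (\<Prod>i<r. e M ^ f i) * (\<Prod>j<r. inverse (e M ^ j)))"
  have "(\<lambda>M. Determinant.det (Matrix.mat r r (\<lambda>(i, j). complex_of_real (e M ^ f i * inverse (e M ^ j) * a M i j))))
     \<longlonglongrightarrow> Determinant.det (Matrix.mat r r (\<lambda>(i, j). l i j))"
    by (intro tendsto_det_mat lim)
  also have "Determinant.det (Matrix.mat r r (\<lambda>(i, j). l i j)) =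
     (\<Prod>i<r. 1 / fact (f i)) * (\<Prod>j<r. (-1) ^ j) *
      poly (wronskian (map (\<lambda>i. hermite (f i)) [0..<r])) (of_real X)"
  proof -
    have leq: "l i j = 1 / fact (f i) * (-1) ^ j * poly ((pderiv ^^ j) (hermite (f i))) (of_real X)" for i j
    proof -
      have "(-2) ^ j = (-1) ^ j * (2 ^ j :: complex)" by (simp flip: power_mult_distrib)
      thus ?thesis unfolding l_def higher_pderiv_hermite by simp
    qed
    have "Determinant.det (Matrix.mat r r (\<lambda>(i, j). l i j)) = (\<Prod>i<r. 1 / fact (f i)) * (\<Prod>j<r. (-1) ^ j) *
      Determinant.det (Matrix.mat r r (\<lambda>(i, j). poly ((pderiv ^^ j) (hermite (f i))) (of_real X)))"
      unfolding leq by (rule det_mat_scale)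
    also have "Determinant.det (Matrix.mat r r (\<lambda>(i, j). poly ((pderiv ^^ j) (hermite (f i))) (of_real X))) =
      Determinant.det (Matrix.mat r r (\<lambda>(j, i). poly ((pderiv ^^ j) (hermite (f i))) (of_real X)))"
      by (rule det_mat_transpose)
    also have "\<dots> = poly (wronskian (map (\<lambda>i. hermite (f i)) [0..<r])) (of_real X)"
      unfolding wronskian_def poly_det by (simp, rule det_cong) simp
    finally show ?thesis .
  qed
  finally have L: "(\<lambda>M. Determinant.det (Matrix.mat r r (\<lambda>(i, j). complex_of_real (e M ^ f i * inverse (e M ^ j) * a M i j))))
     \<longlonglongrightarrow> (\<Prod>i<r. 1 / fact (f i)) * (\<Prod>j<r. (-1) ^ j) *
      poly (wronskian (map (\<lambda>i. hermite (f i)) [0..<r])) (of_real X)" .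
  have D: "Determinant.det (Matrix.mat r r (\<lambda>(i, j). complex_of_real (e M ^ f i * inverse (e M ^ j) * a M i j))) =
     of_real (E M * krawtchouk_det r f M (x M))" if "x M + r \<le> M" for M
  proof -
    have "Determinant.det (Matrix.mat r r (\<lambda>(i, j). complex_of_real (e M ^ f i * inverse (e M ^ j) * a M i j))) =
       of_real (Determinant.det (Matrix.mat r r (\<lambda>(i, j). e M ^ f i * inverse (e M ^ j) * a M i j)))"
      unfolding det_mat_leibniz by (simp add: sign_def)
    also have "Determinant.det (Matrix.mat r r (\<lambda>(i, j). e M ^ f i * inverse (e M ^ j) * a M i j)) =
      E M * Determinant.det (Matrix.mat r r (\<lambda>(i, j). a M i j))"
      unfolding E_def by (rule det_mat_scale)
    also have "Determinant.det (Matrix.mat r r (\<lambda>(i, j). a M i j)) = krawtchouk_det r f M (x M)"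
      unfolding krawtchouk_det_difference[OF that] a_def ..
    finally show ?thesis .
  qed
  have "E M \<ge> 0" for M unfolding E_def e_def by (intro mult_nonneg_nonneg prod_nonneg) auto
  moreover have "(\<lambda>M. of_real (E M * krawtchouk_det r f M (x M))) \<longlonglongrightarrow>
      (\<Prod>i<r. 1 / fact (f i)) * (\<Prod>j<r. (-1) ^ j) *
      poly (wronskian (map (\<lambda>i. hermite (f i)) [0..<r])) (of_real X)"
    by (rule Lim_transform_eventually[OF L]) (use xr D in \<open>auto elim!: eventually_mono\<close>)
  ultimately show ?thesis using xr that by blast
qed

text \<open>For large \<open>M\<close> the determinants at the lattice points belonging to
  \<open>X\<close> and \<open>Y\<close> have the same sign, and the closed set of nonnegative reals
  keeps this in the limit. As \<open>W\<close> is a complex polynomial, equality of signs is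
  expressed by a product.\<close>

lemma wronskian_hermite_same_sign:
  fixes X Y :: real
  assumes r: "even r" and inj: "inj_on f {..<r}"
    and pos: "\<And>k. (\<Prod>i<r. real k - real (f i)) \<ge> 0"
  defines "W \<equiv> wronskian (map (\<lambda>i. hermite (f i)) [0..<r])"
  shows "poly W (of_real X) * poly W (of_real Y) \<in> \<real>\<^sub>\<ge>\<^sub>0"
proof -
  define c :: complex where "c = (\<Prod>i<r. 1 / fact (f i)) * (\<Prod>j<r. (-1) ^ j)"
  define d :: real where "d = (\<Prod>i<r. 1 / fact (f i)) * (\<Prod>j<r. (-1) ^ j)"
  have c: "c = of_real d" by (simp add: c_def d_def)
  have d: "d \<noteq> 0" by (simp add: d_def)
  obtain x e where x: "\<forall>\<^sub>F M in sequentially. x M + r \<le> M" "\<And>M. e M \<ge> 0"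
    "(\<lambda>M. of_real (e M * krawtchouk_det r f M (x M))) \<longlonglongrightarrow> c * poly W (of_real X)"
    using krawtchouk_det_tendsto[of r f X, folded c_def W_def[THEN meta_eq_to_obj_eq]] by blast
  obtain y e' where y: "\<forall>\<^sub>F M in sequentially. y M + r \<le> M" "\<And>M. e' M \<ge> 0"
    "(\<lambda>M. of_real (e' M * krawtchouk_det r f M (y M))) \<longlonglongrightarrow> c * poly W (of_real Y)"
    using krawtchouk_det_tendsto[of r f Y, folded c_def W_def[THEN meta_eq_to_obj_eq]] by blast
  have lim: "(\<lambda>M. of_real (e M * krawtchouk_det r f M (x M)) * of_real (e' M * krawtchouk_det r f M (y M)))
     \<longlonglongrightarrow> (c * poly W (of_real X)) * (c * poly W (of_real Y))"
    by (intro tendsto_mult x y)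
  have "\<forall>\<^sub>F M in sequentially. \<forall>i\<in>{..<r}. f i \<le> M"
    by (rule eventually_ball_finite) (auto intro: eventually_ge_at_top)
  hence f: "\<forall>\<^sub>F M in sequentially. \<forall>i<r. f i \<le> M" by (rule eventually_mono) simp
  have "\<forall>\<^sub>F M in sequentially. complex_of_real (e M * krawtchouk_det r f M (x M)) * of_real (e' M * krawtchouk_det r f M (y M)) \<in> \<real>\<^sub>\<ge>\<^sub>0"
    using x(1) y(1) f
  proof eventually_elim
    case (elim M)
    have "krawtchouk_det r f M (x M) * krawtchouk_det r f M (y M) > 0"
      using krawtchouk_det_same_sign[OF r inj pos, of "x M" "y M" M]
        krawtchouk_det_same_sign[OF r inj pos, of "y M" "x M" M] elim
      by (cases "x M \<le> y M") (auto simp: mult.commute)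
    hence "(e M * e' M) * (krawtchouk_det r f M (x M) * krawtchouk_det r f M (y M)) \<ge> 0"
      using x(2)[of M] y(2)[of M] by (metis less_imp_le mult_nonneg_nonneg)
    moreover have "complex_of_real (e M * krawtchouk_det r f M (x M)) * of_real (e' M * krawtchouk_det r f M (y M)) =
       of_real ((e M * e' M) * (krawtchouk_det r f M (x M) * krawtchouk_det r f M (y M)))"
      by (simp add: mult_ac)
    ultimately show ?case by (simp only: nonneg_Reals_of_real_iff)
  qed
  with lim have "(c * poly W (of_real X)) * (c * poly W (of_real Y)) \<in> \<real>\<^sub>\<ge>\<^sub>0"
    by (intro Lim_in_closed_set[OF closed_nonneg_Reals_complex _ _ lim]) auto
  moreover have "complex_of_real (inverse (d ^ 2)) \<in> \<real>\<^sub>\<ge>\<^sub>0"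
    unfolding nonneg_Reals_of_real_iff by simp
  ultimately have "of_real (inverse (d ^ 2)) * ((c * poly W (of_real X)) * (c * poly W (of_real Y))) \<in> \<real>\<^sub>\<ge>\<^sub>0"
    by (metis nonneg_Reals_mult_I)
  also have "of_real (inverse (d ^ 2)) * ((c * poly W (of_real X)) * (c * poly W (of_real Y))) =
     poly W (of_real X) * poly W (of_real Y)"
    using d by (simp add: c power2_eq_square field_simps)
  finally show ?thesis .
qed

text \<open>Write \<open>W = (z - t) V\<close>. Points on the same side and on opposite sides of
  \<open>t\<close> show in the limit that both \<open>V(t)^2\<close> and \<open>- V(t)^2\<close> are
  nonnegative, so \<open>V(t) = 0\<close>, against simplicity.\<close>

lemma simple_root_same_sign_not_real:
  fixes W :: "complex poly"
  assumes "\<And>X Y :: real. poly W (of_real X) * poly W (of_real Y) \<in> \<real>\<^sub>\<ge>\<^sub>0" and "order (of_real t) W = 1"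
  shows "W = 0"
proof (rule ccontr)
  assume W: "W \<noteq> 0"
  obtain V where V: "W = [:- of_real t, 1:] ^ 1 * V" "\<not> [:- of_real t, 1:] dvd V"
    using order_decomp[OF W, of "of_real t"] unfolding assms(2) by blast
  have V0: "poly V (of_real t) \<noteq> 0" using V(2) by (simp add: poly_eq_0_iff_dvd)
  define s where "s = (\<lambda>n. 1 / real (Suc n))"
  have s: "s \<longlonglongrightarrow> 0" unfolding s_def by (rule LIMSEQ_inverse_real_of_nat[unfolded inverse_eq_divide])
  have s_pos: "s n > 0" for n by (simp add: s_def)
  have lim: "(\<lambda>n. poly V (of_real (t + a * s n)) * poly V (of_real (t + b * s n))) \<longlonglongrightarrow> poly V (of_real t) * poly V (of_real t)" for a b
  proof -
    have "(\<lambda>n. poly V (of_real (t + a * s n)) * poly V (of_real (t + b * s n))) \<longlonglongrightarrow>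
       poly V (of_real (t + a * 0)) * poly V (of_real (t + b * 0))"
      by (intro tendsto_intros s)
    thus ?thesis by simp
  qed
  have prod: "of_real (a * b) * (poly V (of_real (t + a * s n)) * poly V (of_real (t + b * s n))) \<in> \<real>\<^sub>\<ge>\<^sub>0" for a b n
  proof -
    have "poly W (of_real (t + a * s n)) * poly W (of_real (t + b * s n)) =
       of_real (s n ^ 2) * (of_real (a * b) * (poly V (of_real (t + a * s n)) * poly V (of_real (t + b * s n))))"
      unfolding V(1) by (simp add: algebra_simps power2_eq_square)
    hence "of_real (inverse (s n ^ 2)) * (poly W (of_real (t + a * s n)) * poly W (of_real (t + b * s n))) =
       of_real (a * b) * (poly V (of_real (t + a * s n)) * poly V (of_real (t + b * s n)))"
      using s_pos[of n] by simp
    moreover have "complex_of_real (inverse (s n ^ 2)) \<in> \<real>\<^sub>\<ge>\<^sub>0"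
      unfolding nonneg_Reals_of_real_iff by simp
    hence "of_real (inverse (s n ^ 2)) * (poly W (of_real (t + a * s n)) * poly W (of_real (t + b * s n))) \<in> \<real>\<^sub>\<ge>\<^sub>0"
      by (rule nonneg_Reals_mult_I[OF _ assms(1)])
    ultimately show ?thesis by simp
  qed
  have "of_real (a * b) * (poly V (of_real t) * poly V (of_real t)) \<in> \<real>\<^sub>\<ge>\<^sub>0" for a b :: real
    by (rule Lim_in_closed_set[OF closed_nonneg_Reals_complex _ _ tendsto_mult[OF tendsto_const lim[of a b]]])
       (use prod in auto)
  from this[of 1 1] this[of 1 "-1"]
  have "poly V (of_real t) * poly V (of_real t) \<in> \<real>\<^sub>\<ge>\<^sub>0" "- (poly V (of_real t) * poly V (of_real t)) \<in> \<real>\<^sub>\<ge>\<^sub>0" by simp_all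
  hence "poly V (of_real t) * poly V (of_real t) = 0"
    by (auto simp: complex_nonneg_Reals_iff complex_eq_iff)
  thus False using V0 by simp
qed

section \<open>Logarithmic derivatives off the real axis\<close>

lemma log_derivative_poly:
  fixes p :: "complex poly"
  assumes "poly p z \<noteq> 0"
  shows "poly (pderiv p) z = poly p z * (\<Sum>a\<in>#proots p. 1 / (z - a))" (is ?A)
    and "poly (pderiv (pderiv p)) z = poly p z *
      ((\<Sum>a\<in>#proots p. 1 / (z - a)) ^ 2 - (\<Sum>a\<in>#proots p. 1 / (z - a) ^ 2))" (is ?B)
proof -
  have aux: "z \<notin># A \<Longrightarrow>
    poly (pderiv (\<Prod>x\<in>#A. [:-x, 1:])) z = poly (\<Prod>x\<in>#A. [:-x, 1:]) z * (\<Sum>a\<in>#A. 1 / (z - a)) \<and>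
    poly (pderiv (pderiv (\<Prod>x\<in>#A. [:-x, 1:]))) z = poly (\<Prod>x\<in>#A. [:-x, 1:]) z *
      ((\<Sum>a\<in>#A. 1 / (z - a)) ^ 2 - (\<Sum>a\<in>#A. 1 / (z - a) ^ 2))" for A :: "complex multiset"
  proof (induction A)
    case (add x A)
    define q where "q = (\<Prod>x\<in>#A. [:-x, 1:])"
    define S where "S = (\<Sum>a\<in>#A. 1 / (z - a))"
    define T where "T = (\<Sum>a\<in>#A. 1 / (z - a) ^ 2)"
    define w where "w = z - x"
    have w: "w \<noteq> 0" using add.prems by (auto simp: w_def)
    have pw: "poly ([:-x, 1:] * q) z = w * poly q z" for q by (simp add: w_def algebra_simps)
    have IH: "poly (pderiv q) z = poly q z * S" "poly (pderiv (pderiv q)) z = poly q z * (S ^ 2 - T)"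
      using add unfolding q_def S_def T_def by auto
    have d1: "pderiv ([:-x, 1:] * q) = q + [:-x, 1:] * pderiv q"
      by (subst pderiv_mult) (simp add: pderiv_pCons)
    have d2: "pderiv (pderiv ([:-x, 1:] * q)) = 2 * pderiv q + [:-x, 1:] * pderiv (pderiv q)"
      unfolding d1 pderiv_add by (subst pderiv_mult) (simp add: pderiv_pCons)
    have "poly (pderiv ([:-x, 1:] * q)) z = poly ([:-x, 1:] * q) z * (1 / w + S)"
      unfolding d1 poly_add pw using w by (simp add: IH field_simps)
    moreover have "poly (pderiv (pderiv ([:-x, 1:] * q))) z =
       poly ([:-x, 1:] * q) z * ((1 / w + S) ^ 2 - (1 / w ^ 2 + T))"
      unfolding d2 poly_add pw using w by (simp add: IH field_simps power2_eq_square)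
    ultimately show ?case by (simp add: q_def S_def T_def w_def)
  qed simp
  define q where "q = (\<Prod>x\<in>#proots p. [:-x, 1:])"
  have p: "p = smult (lead_coeff p) q" unfolding q_def by (rule complex_poly_decompose_multiset[symmetric])
  have "p \<noteq> 0" using assms by auto
  hence "z \<notin># proots p" using assms by simp
  note aux = aux[OF this, folded q_def]
  have 0: "poly p z = lead_coeff p * poly q z" using arg_cong[OF p, of "\<lambda>p. poly p z"] by simp
  have 1: "poly (pderiv p) z = lead_coeff p * poly (pderiv q) z"
    using arg_cong[OF p, of "\<lambda>p. poly (pderiv p) z"] by (simp add: pderiv_smult)
  have 2: "poly (pderiv (pderiv p)) z = lead_coeff p * poly (pderiv (pderiv q)) z"
    using arg_cong[OF p, of "\<lambda>p. poly (pderiv (pderiv p)) z"] by (simp add: pderiv_smult)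
  show ?A unfolding 0 1 using aux by (simp only: mult.assoc)
  show ?B unfolding 0 2 using aux by (simp only: mult.assoc)
qed

text \<open>The ratio of consecutive Hermite polynomials evolves by sending \<open>w\<close> to
  \<open>2 z - 2 (n + 1) / w\<close>, which preserves the half plane containing \<open>z\<close>. So
  it never becomes zero.\<close>

lemma hermite_nonreal:
  assumes "Im z \<noteq> 0"
  shows "poly (hermite n) z \<noteq> 0"
proof -
  define s where "s = sgn (Im z)"
  have s: "s * Im z > 0" using assms by (simp add: s_def sgn_if)
  have "poly (hermite n) z \<noteq> 0 \<and> s * Im (poly (hermite (Suc n)) z / poly (hermite n) z) > 0"
  proof (induction n)
    case 0
    show ?case using s by simp
  next
    case (Suc n)
    define w where "w = poly (hermite (Suc n)) z / poly (hermite n) z"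
    have w: "s * Im w > 0" using Suc by (simp add: w_def)
    hence "w \<noteq> 0" by auto
    hence nz: "poly (hermite (Suc n)) z \<noteq> 0" by (auto simp: w_def)
    have "poly (hermite (Suc (Suc n))) z / poly (hermite (Suc n)) z = 2 * z - 2 * of_nat (Suc n) / w"
      using nz Suc by (simp add: w_def field_simps del: of_nat_Suc)
    moreover define k where "k = 2 * real (Suc n) / (cmod w)\<^sup>2"
    have "Im (2 * of_nat (Suc n) / w) = - k * Im w"
    proof -
      have "2 * of_nat (Suc n) / w = of_real k * cnj w"
        by (simp add: k_def complex_div_cnj[of _ w] del: of_nat_Suc)
      thus ?thesis by simp
    qed
    ultimately have "Im (poly (hermite (Suc (Suc n))) z / poly (hermite (Suc n)) z) = 2 * Im z + k * Im w"
      by (simp only: minus_complex.simps) simp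
    hence "s * Im (poly (hermite (Suc (Suc n))) z / poly (hermite (Suc n)) z) = 2 * (s * Im z) + k * (s * Im w)"
      by (simp only: distrib_left mult_ac)
    moreover have "k * (s * Im w) \<ge> 0"
      by (rule mult_nonneg_nonneg[OF _ less_imp_le[OF w]]) (simp add: k_def)
    ultimately show ?case using nz s by linarith
  qed
  thus ?thesis ..
qed

lemma Im_sum_mset: "Im (\<Sum>a\<in>#A. f a) = (\<Sum>a\<in>#A. Im (f a))"
  by (induction A) auto

lemma cmod_sum_mset_le: "cmod (\<Sum>a\<in>#A. f a) \<le> (\<Sum>a\<in>#A. cmod (f a))"
  by (induction A) (auto intro: order.trans[OF norm_triangle_ineq])

lemma Im_inverse_diff_real:
  assumes "a \<in> \<real>"
  shows "Im (1 / (z - a)) = - Im z * (1 / (cmod (z - a))\<^sup>2)"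
proof -
  have "1 / (z - a) = of_real (1 / (cmod (z - a))\<^sup>2) * cnj (z - a)"
    by (simp add: complex_div_cnj[of 1 "z - a"])
  thus ?thesis using assms by (auto elim!: Reals_cases)
qed

text \<open>With \<open>T\<close> the sum of \<open>1 / (z - a)\<^sup>2\<close> over the zeros, the
  Hermite equation reads \<open>u\<^sup>2 - T - 2 z u + 2 N = 0\<close>. All zeros are real, so
  \<open>|T|\<close> is at most \<open>|Im u| / |Im z|\<close>, and everything except
  \<open>u\<^sup>2\<close> and \<open>2 N\<close> is bounded linearly in \<open>|u|\<close>.\<close>

lemma hermite_log_derivative_quadratic:
  fixes N :: nat and z :: complex and K :: real
  assumes "\<delta> > 0" "\<bar>Im z\<bar> \<ge> \<delta>" and "2 * cmod z + 1 / \<delta> \<le> K"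
  defines "u \<equiv> poly (pderiv (hermite N)) z / poly (hermite N) z"
  shows "(cmod u)\<^sup>2 \<le> 2 * real N + K * cmod u" and "2 * real N \<le> (cmod u)\<^sup>2 + K * cmod u"
proof -
  have Im: "Im z \<noteq> 0" using assms by auto
  have nz: "poly (hermite N) z \<noteq> 0" by (rule hermite_nonreal[OF Im])
  define A where "A = proots (hermite N)"
  have real: "a \<in> \<real>" if "a \<in># A" for a
  proof -
    have "hermite N \<noteq> 0" using nz by auto
    hence "poly (hermite N) a = 0" using that by (simp add: A_def)
    thus ?thesis using hermite_nonreal[of a N] by (auto simp: complex_is_Real_iff)
  qed
  define T where "T = (\<Sum>a\<in>#A. 1 / (z - a) ^ 2)"
  have u: "u = (\<Sum>a\<in>#A. 1 / (z - a))"
    unfolding u_def log_derivative_poly(1)[OF nz] A_def using nz by (rule nonzero_mult_div_cancel_left)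
  have "Im u = (\<Sum>a\<in>#A. Im (1 / (z - a)))" unfolding u by (rule Im_sum_mset)
  also have "\<dots> = (\<Sum>a\<in>#A. - Im z * (1 / (cmod (z - a))\<^sup>2))"
    by (intro arg_cong[of _ _ sum_mset] image_mset_cong Im_inverse_diff_real real)
  also have "\<dots> = - Im z * (\<Sum>a\<in>#A. 1 / (cmod (z - a))\<^sup>2)" by (rule sum_mset_distrib_left[symmetric])
  finally have Im_u: "Im u = - Im z * (\<Sum>a\<in>#A. 1 / (cmod (z - a))\<^sup>2)" .
  define G where "G = (\<Sum>a\<in>#A. 1 / (cmod (z - a))\<^sup>2)"
  have T_le: "cmod T \<le> G"
    unfolding T_def G_def by (rule order.trans[OF cmod_sum_mset_le]) (simp add: norm_divide norm_power)
  have "\<delta> * cmod T \<le> \<bar>Im z\<bar> * G"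
    using assms T_le by (intro mult_mono) auto
  also have "\<dots> = \<bar>Im u\<bar>" unfolding Im_u G_def[symmetric] using order.trans[OF norm_ge_zero T_le] by (simp add: abs_mult)
  also have "\<dots> \<le> cmod u" by (rule abs_Im_le_cmod)
  finally have T: "cmod T \<le> 1 / \<delta> * cmod u" using assms(1) by (simp add: field_simps)
  have "poly (pderiv (pderiv (hermite N))) z - 2 * z * poly (pderiv (hermite N)) z + 2 * of_nat N * poly (hermite N) z = 0"
    using arg_cong[OF hermite_op_hermite[of N], of "\<lambda>p. poly p z"] by (simp add: hermite_op_def algebra_simps)
  hence "poly (hermite N) z * (u ^ 2 - T - 2 * z * u + 2 * of_nat N) = 0"
    unfolding log_derivative_poly[OF nz] A_def[symmetric] u[symmetric] T_def[symmetric] by (simp add: algebra_simps)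
  hence eq: "u ^ 2 - T - 2 * z * u + 2 * of_nat N = 0" using nz by simp
  have "cmod (T + 2 * z * u) \<le> cmod T + 2 * cmod z * cmod u"
    by (rule order.trans[OF norm_triangle_ineq]) (simp add: norm_mult)
  also have "\<dots> \<le> (2 * cmod z + 1 / \<delta>) * cmod u" using T by (simp add: algebra_simps)
  also have "\<dots> \<le> K * cmod u" using assms(3) by (intro mult_right_mono) auto
  finally have b: "cmod (T + 2 * z * u) \<le> K * cmod u" .
  have "(cmod u)\<^sup>2 = cmod ((T + 2 * z * u) - 2 * of_nat N)"
  proof -
    have "u ^ 2 = (T + 2 * z * u) - 2 * of_nat N" using eq by (simp add: eq_diff_eq algebra_simps)
    thus ?thesis by (metis norm_power)
  qed
  also have "\<dots> \<le> cmod (T + 2 * z * u) + 2 * real N"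
    by (rule order.trans[OF norm_triangle_ineq4]) (simp add: norm_mult)
  finally show "(cmod u)\<^sup>2 \<le> 2 * real N + K * cmod u" using b by linarith
  have "2 * real N = cmod ((T + 2 * z * u) - u ^ 2)"
  proof -
    have "(T + 2 * z * u) - u ^ 2 = 2 * of_nat N" using eq by (simp add: algebra_simps)
    thus ?thesis by (simp only: norm_mult norm_of_nat norm_numeral)
  qed
  also have "\<dots> \<le> cmod (T + 2 * z * u) + (cmod u)\<^sup>2"
    by (rule order.trans[OF norm_triangle_ineq4]) (simp add: norm_power)
  finally show "2 * real N \<le> (cmod u)\<^sup>2 + K * cmod u" using b by linarith
qed

section \<open>Size of the higher derivatives of Hermite polynomials\<close>

definition hscale :: "nat \<Rightarrow> real" where
  "hscale N = sqrt (2 * real N)"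

lemma hscale_ge_1: "N \<ge> 1 \<Longrightarrow> hscale N \<ge> 1"
  by (simp add: hscale_def)

lemma hscale_sq: "(hscale N)\<^sup>2 = 2 * real N"
  by (simp add: hscale_def)

definition strip :: "real \<Rightarrow> real \<Rightarrow> complex set" where
  "strip \<delta> R = {z. \<delta> \<le> \<bar>Im z\<bar> \<and> cmod z \<le> R}"

lemma hermite_log_derivative_bounds:
  assumes "\<delta> > 0" "R \<ge> 0"
  obtains K where "K \<ge> 0" and "\<And>N z. N \<ge> 1 \<Longrightarrow> z \<in> strip \<delta> R \<Longrightarrow>
    cmod (poly (pderiv (hermite N)) z / poly (hermite N) z) \<le> (K + 1) * hscale N \<and>
    hscale N \<le> (K + 1) * cmod (poly (pderiv (hermite N)) z / poly (hermite N) z)"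
proof -
  define K where "K = 2 * R + 1 / \<delta>"
  have K: "K \<ge> 0" using assms by (simp add: K_def)
  moreover have "cmod (poly (pderiv (hermite N)) z / poly (hermite N) z) \<le> (K + 1) * hscale N \<and>
    hscale N \<le> (K + 1) * cmod (poly (pderiv (hermite N)) z / poly (hermite N) z)"
    if "N \<ge> 1" "z \<in> strip \<delta> R" for N z
  proof -
    define U where "U = cmod (poly (pderiv (hermite N)) z / poly (hermite N) z)"
    define s where "s = hscale N"
    have s: "s \<ge> 1" "s\<^sup>2 = 2 * real N" using hscale_ge_1 hscale_sq that(1) by (auto simp: s_def)
    have U: "U \<ge> 0" by (simp add: U_def)
    have "2 * cmod z + 1 / \<delta> \<le> K" using that(2) by (simp add: K_def strip_def)
    hence b: "U\<^sup>2 \<le> s\<^sup>2 + K * U" "s\<^sup>2 \<le> U\<^sup>2 + K * U"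
      using hermite_log_derivative_quadratic[of \<delta> z K N] that assms s(2) unfolding U_def strip_def by auto
    \<comment> \<open>Since \<open>s \<ge> 1\<close>, the linear term \<open>K * U\<close> is at
      most \<open>K * U * s\<close>; this turns both estimates into one homogeneous inequality, used
      with the roles of \<open>U\<close> and \<open>s\<close> exchanged.\<close>
    have aux: "p \<le> (K + 1) * q" if "p\<^sup>2 \<le> q\<^sup>2 + K * (p * q)" "p \<ge> 0" "q \<ge> 0" for p q
    proof (rule ccontr)
      assume "\<not> p \<le> (K + 1) * q"
      hence p: "p > (K + 1) * q" by simp
      hence "p > 0" using K that by (meson le_less_trans mult_nonneg_nonneg add_nonneg_nonneg zero_le_one)
      have "q \<le> (K + 1) * q" using K that by (simp add: mult_right_mono[of 1 "K + 1" q, simplified])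
      hence "q * q \<le> q * p" using p that by (intro mult_left_mono) auto
      moreover have "(K + 1) * q * p < p * p" using p \<open>p > 0\<close> by simp
      ultimately show False using that(1) by (simp add: power2_eq_square algebra_simps)
    qed
    have "K * U \<le> K * (U * s)" using K U s mult_left_mono[of 1 s U] by (intro mult_left_mono) auto
    hence "U \<le> (K + 1) * s" using aux[of U s] b(1) U s by linarith
    moreover have "s \<le> (K + 1) * U"
    proof (rule aux)
      have "K * U \<le> K * (s * U)" using K U s mult_right_mono[of 1 s U] by (intro mult_left_mono) auto
      thus "s\<^sup>2 \<le> U\<^sup>2 + K * (s * U)" using b(2) by linarith
    qed (use U s in auto)
    ultimately show ?thesis by (simp add: U_def s_def)
  qed
  ultimately show ?thesis using that by blast
qed

definition hratio :: "nat \<Rightarrow> nat \<Rightarrow> complex \<Rightarrow> complex" where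
  "hratio N j z = poly ((pderiv ^^ j) (hermite N)) z / poly (hermite N) z"

lemma hratio_Suc_Suc:
  "hratio N (Suc (Suc j)) z = 2 * z * hratio N (Suc j) z + 2 * of_nat j * hratio N j z - of_real ((hscale N)\<^sup>2) * hratio N j z"
proof -
  have "(pderiv ^^ j) (hermite_op (hermite N)) = smult (- 2 * of_nat N) ((pderiv ^^ j) (hermite N))"
    unfolding hermite_op_hermite higher_pderiv_smult ..
  from arg_cong[OF this, of "\<lambda>p. poly p z"]
  have "poly ((pderiv ^^ Suc (Suc j)) (hermite N)) z = 2 * z * poly ((pderiv ^^ Suc j) (hermite N)) z +
     2 * of_nat j * poly ((pderiv ^^ j) (hermite N)) z - 2 * of_nat N * poly ((pderiv ^^ j) (hermite N)) z"
    unfolding higher_pderiv_hermite_op by (simp add: hermite_op_def algebra_simps)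
  thus ?thesis unfolding hratio_def hscale_sq
    by (simp add: diff_divide_distrib add_divide_distrib del: funpow.simps)
qed

lemma hratio_0: "z \<in> strip \<delta> R \<Longrightarrow> \<delta> > 0 \<Longrightarrow> hratio N 0 z = 1"
  using hermite_nonreal[of z N] by (fastforce simp: hratio_def strip_def)

context
  fixes \<delta> R :: real
  assumes \<delta>: "\<delta> > 0" and R: "R \<ge> 0"
begin

lemma hratio_bound:
  "\<exists>C\<ge>0. \<forall>N\<ge>1. \<forall>z\<in>strip \<delta> R. cmod (hratio N j z) \<le> C * hscale N ^ j"
\<comment> \<open>The induction rule of \<open>hermite\<close> serves as a two-step induction; order
  one is the estimate for \<open>h' / h\<close>.\<close>
proof (induction j rule: hermite.induct)
  case 1
  show ?case using hratio_0[OF _ \<delta>] by (intro exI[of _ 1]) auto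
next
  case 2
  obtain K where K: "K \<ge> 0" "\<And>N z. N \<ge> 1 \<Longrightarrow> z \<in> strip \<delta> R \<Longrightarrow>
    cmod (poly (pderiv (hermite N)) z / poly (hermite N) z) \<le> (K + 1) * hscale N \<and>
    hscale N \<le> (K + 1) * cmod (poly (pderiv (hermite N)) z / poly (hermite N) z)"
    using hermite_log_derivative_bounds[OF \<delta> R] by blast
  show ?case using K by (intro exI[of _ "K + 1"]) (auto simp: hratio_def)
next
  case (3 j)
  obtain C1 where C1: "C1 \<ge> 0" "\<And>N z. N \<ge> 1 \<Longrightarrow> z \<in> strip \<delta> R \<Longrightarrow> cmod (hratio N (Suc j) z) \<le> C1 * hscale N ^ Suc j"
    using 3(1) by blast
  obtain C0 where C0: "C0 \<ge> 0" "\<And>N z. N \<ge> 1 \<Longrightarrow> z \<in> strip \<delta> R \<Longrightarrow> cmod (hratio N j z) \<le> C0 * hscale N ^ j"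
    using 3(2) by blast
  show ?case
  proof (intro exI[of _ "2 * R * C1 + 2 * real j * C0 + C0"] conjI allI impI ballI)
    show "2 * R * C1 + 2 * real j * C0 + C0 \<ge> 0" using R C1 C0 by simp
    fix N :: nat and z assume N: "N \<ge> 1" and z: "z \<in> strip \<delta> R"
    define s where "s = hscale N"
    have s: "s \<ge> 1" using hscale_ge_1[OF N] by (simp add: s_def)
    have pw: "s ^ Suc j \<le> s ^ Suc (Suc j)" "s ^ j \<le> s ^ Suc (Suc j)"
      by (rule power_increasing; use s in simp)+
    have "cmod (hratio N (Suc (Suc j)) z) \<le> cmod (2 * z * hratio N (Suc j) z) + cmod (2 * of_nat j * hratio N j z)
       + cmod (of_real (s\<^sup>2) * hratio N j z)"
      unfolding hratio_Suc_Suc s_def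
      by (intro order.trans[OF norm_triangle_ineq4] add_right_mono norm_triangle_ineq)
    also have "\<dots> = 2 * cmod z * cmod (hratio N (Suc j) z) + 2 * real j * cmod (hratio N j z) + s\<^sup>2 * cmod (hratio N j z)"
      by (simp add: norm_mult norm_power)
    also have "\<dots> \<le> 2 * R * (C1 * s ^ Suc (Suc j)) + 2 * real j * (C0 * s ^ Suc (Suc j)) + s\<^sup>2 * (C0 * s ^ j)"
    proof (intro add_mono mult_mono)
      show "cmod (hratio N (Suc j) z) \<le> C1 * s ^ Suc (Suc j)"
        using C1(2)[OF N z] mult_left_mono[OF pw(1) C1(1)] by (simp only: s_def)
      show "cmod (hratio N j z) \<le> C0 * s ^ Suc (Suc j)"
        using C0(2)[OF N z] mult_left_mono[OF pw(2) C0(1)] by (simp only: s_def)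
      show "cmod (hratio N j z) \<le> C0 * s ^ j" using C0(2)[OF N z] by (simp only: s_def)
    qed (use z R C0 s in \<open>auto simp: strip_def\<close>)
    also have "\<dots> = (2 * R * C1 + 2 * real j * C0 + C0) * s ^ Suc (Suc j)"
      by (simp add: algebra_simps power2_eq_square)
    finally show "cmod (hratio N (Suc (Suc j)) z) \<le> (2 * R * C1 + 2 * real j * C0 + C0) * hscale N ^ Suc (Suc j)"
      by (simp only: s_def)
  qed
qed

lemma hratio_step:
  "\<exists>C\<ge>0. \<forall>N\<ge>1. \<forall>z\<in>strip \<delta> R.
     cmod (hratio N (Suc (Suc j)) z + of_real ((hscale N)\<^sup>2) * hratio N j z) \<le> C * hscale N ^ Suc j"
proof -
  obtain C1 where C1: "C1 \<ge> 0" "\<And>N z. N \<ge> 1 \<Longrightarrow> z \<in> strip \<delta> R \<Longrightarrow> cmod (hratio N (Suc j) z) \<le> C1 * hscale N ^ Suc j"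
    using hratio_bound[of "Suc j"] by blast
  obtain C0 where C0: "C0 \<ge> 0" "\<And>N z. N \<ge> 1 \<Longrightarrow> z \<in> strip \<delta> R \<Longrightarrow> cmod (hratio N j z) \<le> C0 * hscale N ^ j"
    using hratio_bound[of j] by blast
  show ?thesis
  proof (intro exI[of _ "2 * R * C1 + 2 * real j * C0"] conjI allI impI ballI)
    show "2 * R * C1 + 2 * real j * C0 \<ge> 0" using R C1 C0 by simp
    fix N :: nat and z assume N: "N \<ge> 1" and z: "z \<in> strip \<delta> R"
    define s where "s = hscale N"
    have s: "s \<ge> 1" using hscale_ge_1[OF N] by (simp add: s_def)
    have pw: "s ^ j \<le> s ^ Suc j" by (rule power_increasing) (use s in auto)
    have "hratio N (Suc (Suc j)) z + of_real ((hscale N)\<^sup>2) * hratio N j z = 2 * z * hratio N (Suc j) z + 2 * of_nat j * hratio N j z"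
      unfolding hratio_Suc_Suc by simp
    also have "cmod \<dots> \<le> 2 * cmod z * cmod (hratio N (Suc j) z) + 2 * real j * cmod (hratio N j z)"
      by (rule order.trans[OF norm_triangle_ineq]) (simp add: norm_mult)
    also have "\<dots> \<le> 2 * R * (C1 * s ^ Suc j) + 2 * real j * (C0 * s ^ Suc j)"
    proof (intro add_mono mult_mono)
      show "cmod (hratio N (Suc j) z) \<le> C1 * s ^ Suc j"
        using C1(2)[OF N z] by (simp only: s_def)
      show "cmod (hratio N j z) \<le> C0 * s ^ Suc j"
        using C0(2)[OF N z] mult_left_mono[OF pw C0(1)] by (simp only: s_def)
    qed (use z R C0 s in \<open>auto simp: strip_def\<close>)
    also have "\<dots> = (2 * R * C1 + 2 * real j * C0) * s ^ Suc j"
      by (simp add: algebra_simps)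
    finally show "cmod (hratio N (Suc (Suc j)) z + of_real ((hscale N)\<^sup>2) * hratio N j z) \<le>
       (2 * R * C1 + 2 * real j * C0) * hscale N ^ Suc j"
      by (simp only: s_def)
  qed
qed

text \<open>Two derivatives at a time give the factor \<open>- 2 N\<close> with relative error
  \<open>O(1 / s)\<close>. So even derivatives are explicit (\<open>j = 0\<close>) and odd ones
  reduce to \<open>h'\<close> (\<open>j = 1\<close>). The factor \<open>hscale N\<close> on the left
  avoids a negative power when \<open>2 * i + j = 0\<close>.\<close>

lemma hratio_asymp:
  "\<exists>C\<ge>0. \<forall>N\<ge>1. \<forall>z\<in>strip \<delta> R.
     cmod (hratio N (2 * i + j) z - (-1) ^ i * of_real (hscale N ^ (2 * i)) * hratio N j z) * hscale N \<le> C * hscale N ^ (2 * i + j)"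
proof (induction i)
  case 0
  show ?case by (intro exI[of _ 0]) auto
next
  case (Suc i)
  obtain C where C: "C \<ge> 0" "\<And>N z. N \<ge> 1 \<Longrightarrow> z \<in> strip \<delta> R \<Longrightarrow>
     cmod (hratio N (2 * i + j) z - (-1) ^ i * of_real (hscale N ^ (2 * i)) * hratio N j z) * hscale N \<le> C * hscale N ^ (2 * i + j)"
    using Suc by blast
  obtain D where D: "D \<ge> 0" "\<And>N z. N \<ge> 1 \<Longrightarrow> z \<in> strip \<delta> R \<Longrightarrow>
     cmod (hratio N (Suc (Suc (2 * i + j))) z + of_real ((hscale N)\<^sup>2) * hratio N (2 * i + j) z) \<le> D * hscale N ^ Suc (2 * i + j)"
    using hratio_step[of "2 * i + j"] by blast
  show ?case
  proof (intro exI[of _ "C + D"] conjI allI impI ballI)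
    show "C + D \<ge> 0" using C D by simp
    fix N :: nat and z assume N: "N \<ge> 1" and z: "z \<in> strip \<delta> R"
    define s where "s = hscale N"
    have s: "s \<ge> 1" using hscale_ge_1[OF N] by (simp add: s_def)
    define A where "A = hratio N (Suc (Suc (2 * i + j))) z + of_real (s\<^sup>2) * hratio N (2 * i + j) z"
    define B where "B = hratio N (2 * i + j) z - (-1) ^ i * of_real (s ^ (2 * i)) * hratio N j z"
    have "hratio N (2 * Suc i + j) z - (-1) ^ Suc i * of_real (s ^ (2 * Suc i)) * hratio N j z = A - of_real (s\<^sup>2) * B"
      by (simp add: A_def B_def algebra_simps power2_eq_square)
    also have "cmod \<dots> \<le> cmod A + s\<^sup>2 * cmod B"
      by (rule order.trans[OF norm_triangle_ineq4]) (simp add: norm_mult norm_power)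
    finally have "cmod (hratio N (2 * Suc i + j) z - (-1) ^ Suc i * of_real (s ^ (2 * Suc i)) * hratio N j z) * s
       \<le> (cmod A + s\<^sup>2 * cmod B) * s" using s by (intro mult_right_mono) auto
    also have "\<dots> = cmod A * s + s\<^sup>2 * (cmod B * s)" by (simp add: algebra_simps)
    also have "\<dots> \<le> D * s ^ Suc (2 * i + j) * s + s\<^sup>2 * (C * s ^ (2 * i + j))"
      using C(2)[OF N z] D(2)[OF N z] s unfolding A_def B_def s_def
      by (intro add_mono mult_right_mono mult_left_mono) auto
    also have "\<dots> = (C + D) * s ^ (2 * Suc i + j)" by (simp add: algebra_simps power2_eq_square)
    finally show "cmod (hratio N (2 * Suc i + j) z - (-1) ^ Suc i * of_real (hscale N ^ (2 * Suc i)) * hratio N j z) * hscale N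
       \<le> (C + D) * hscale N ^ (2 * Suc i + j)" by (simp only: s_def)
  qed
qed

lemma poly_strip_bound: "\<exists>B\<ge>0. \<forall>z\<in>strip \<delta> R. cmod (poly p z) \<le> B"
  using poly_bound_exists[of R p] by (auto simp: strip_def intro: less_imp_le)

text \<open>The top order is \<open>k + l - 1\<close>, one less than the exponent on the right; the
  factor \<open>hscale N\<close> on the left makes up for this and covers the empty sum as
  well.\<close>

lemma sum_hratio_bound:
  "\<exists>C\<ge>0. \<forall>N\<ge>1. \<forall>z\<in>strip \<delta> R. cmod (\<Sum>i<k. poly (p i) z * hratio N (i + l) z) * hscale N \<le> C * hscale N ^ (k + l)"
proof (induction k)
  case 0
  show ?case by (intro exI[of _ 0]) auto
next
  case (Suc k)
  obtain C where C: "C \<ge> 0" "\<And>N z. N \<ge> 1 \<Longrightarrow> z \<in> strip \<delta> R \<Longrightarrow>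
     cmod (\<Sum>i<k. poly (p i) z * hratio N (i + l) z) * hscale N \<le> C * hscale N ^ (k + l)"
    using Suc by blast
  obtain D where D: "D \<ge> 0" "\<And>N z. N \<ge> 1 \<Longrightarrow> z \<in> strip \<delta> R \<Longrightarrow> cmod (hratio N (k + l) z) \<le> D * hscale N ^ (k + l)"
    using hratio_bound[of "k + l"] by blast
  obtain B where B: "B \<ge> 0" "\<And>z. z \<in> strip \<delta> R \<Longrightarrow> cmod (poly (p k) z) \<le> B"
    using poly_strip_bound[of "p k"] by blast
  show ?case
  proof (intro exI[of _ "C + B * D"] conjI allI impI ballI)
    show "C + B * D \<ge> 0" using C D B by simp
    fix N :: nat and z assume N: "N \<ge> 1" and z: "z \<in> strip \<delta> R"
    define s where "s = hscale N"
    have s: "s \<ge> 1" using hscale_ge_1[OF N] by (simp add: s_def)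
    define S where "S = (\<Sum>i<k. poly (p i) z * hratio N (i + l) z)"
    have "cmod (\<Sum>i<Suc k. poly (p i) z * hratio N (i + l) z) * s \<le> (cmod S + cmod (poly (p k) z) * cmod (hratio N (k + l) z)) * s"
      using s by (intro mult_right_mono) (auto simp: S_def simp flip: norm_mult intro: norm_triangle_ineq)
    also have "\<dots> = cmod S * s + cmod (poly (p k) z) * cmod (hratio N (k + l) z) * s" by (simp add: algebra_simps)
    also have "\<dots> \<le> C * s ^ Suc (k + l) + B * (D * s ^ (k + l)) * s"
    proof (rule add_mono)
      have "cmod S * s \<le> C * s ^ (k + l)" using C(2)[OF N z] by (simp add: S_def s_def)
      also have "\<dots> \<le> C * s ^ Suc (k + l)"
        using s C(1) by (intro mult_left_mono power_increasing) auto
      finally show "cmod S * s \<le> C * s ^ Suc (k + l)" .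
      show "cmod (poly (p k) z) * cmod (hratio N (k + l) z) * s \<le> B * (D * s ^ (k + l)) * s"
        by (intro mult_right_mono mult_mono) (use B D N z s in \<open>auto simp: s_def\<close>)
    qed
    also have "\<dots> = (C + B * D) * s ^ (Suc k + l)" by (simp add: algebra_simps)
    finally show "cmod (\<Sum>i<Suc k. poly (p i) z * hratio N (i + l) z) * hscale N \<le> (C + B * D) * hscale N ^ (Suc k + l)"
      by (simp only: s_def)
  qed
qed

end

lemma hscale_eventually_gt: "\<forall>\<^sub>F N in sequentially. hscale N > A"
proof -
  obtain n :: nat where n: "A\<^sup>2 < real n" using reals_Archimedean2 by blast
  have "hscale N > A" if "N \<ge> n" for N
  proof -
    have "A\<^sup>2 < 2 * real N" using n that by simp
    hence "\<bar>A\<bar> < hscale N" unfolding hscale_def by (metis real_sqrt_abs real_sqrt_less_mono)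
    thus ?thesis by simp
  qed
  thus ?thesis by (auto simp: eventually_sequentially)
qed

lemma hscale_ge_0: "hscale N \<ge> 0"
  by (simp add: hscale_def)

section \<open>The exceptional polynomial relative to \<open>hermite N\<close>\<close>

context
  fixes fs :: "complex poly list" and r :: nat
  assumes r: "r = length fs" and even_r: "even r"
begin

definition exc_quot :: "nat \<Rightarrow> complex \<Rightarrow> complex" where
  "exc_quot N z = poly (wronskian (fs @ [hermite N])) z / poly (hermite N) z"

lemma exc_quot_eq:
  "exc_quot N z = (\<Sum>i<r. poly (wcof fs i) z * hratio N i z) + poly (wronskian fs) z * hratio N r z"
proof -
  have "exc_quot N z = (\<Sum>i\<le>r. poly (wcof fs i) z * hratio N i z)"
    by (simp add: exc_quot_def wronskian_snoc hratio_def poly_sum sum_divide_distrib r)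
  also have "\<dots> = (\<Sum>i<r. poly (wcof fs i) z * hratio N i z) + poly (wcof fs r) z * hratio N r z"
    unfolding lessThan_Suc_atMost[symmetric] by simp
  finally show ?thesis unfolding r wcof_length .
qed

context
  fixes \<delta> R :: real
  assumes \<delta>: "\<delta> > 0" and R: "R \<ge> 0"
begin

text \<open>The derivative of order \<open>r\<close> comes with the Wronskian of \<open>fs\<close>,
  and all other terms are smaller by a factor \<open>1 / s\<close>. Because \<open>r\<close> is
  even, that derivative is to leading order an explicit multiple of \<open>h\<close>, without a
  factor \<open>h' / h\<close>.\<close>

lemma exc_quot_approx:
  "\<exists>C\<ge>0. \<forall>N\<ge>1. \<forall>z\<in>strip \<delta> R.
     cmod (exc_quot N z - (-1) ^ (r div 2) * of_real (hscale N ^ r) * poly (wronskian fs) z) * hscale N \<le> C * hscale N ^ r"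
proof -
  obtain C1 where C1: "C1 \<ge> 0" "\<And>N z. N \<ge> 1 \<Longrightarrow> z \<in> strip \<delta> R \<Longrightarrow>
     cmod (\<Sum>i<r. poly (wcof fs i) z * hratio N (i + 0) z) * hscale N \<le> C1 * hscale N ^ (r + 0)"
    using sum_hratio_bound[OF \<delta> R, where p = "wcof fs" and k = r and l = 0] by blast
  obtain C2 where C2: "C2 \<ge> 0" "\<And>N z. N \<ge> 1 \<Longrightarrow> z \<in> strip \<delta> R \<Longrightarrow>
     cmod (hratio N (2 * (r div 2) + 0) z - (-1) ^ (r div 2) * of_real (hscale N ^ (2 * (r div 2))) * hratio N 0 z) * hscale N
       \<le> C2 * hscale N ^ (2 * (r div 2) + 0)"
    using hratio_asymp[OF \<delta> R, of "r div 2" 0] by blast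
  obtain B where B: "B \<ge> 0" "\<And>z. z \<in> strip \<delta> R \<Longrightarrow> cmod (poly (wronskian fs) z) \<le> B"
    using poly_strip_bound[OF \<delta> R, of "wronskian fs"] by blast
  have r2: "2 * (r div 2) = r" using even_r by simp
  show ?thesis
  proof (intro exI[of _ "C1 + B * C2"] conjI allI impI ballI)
    show "C1 + B * C2 \<ge> 0" using C1 B C2 by simp
    fix N :: nat and z assume N: "N \<ge> 1" and z: "z \<in> strip \<delta> R"
    define W where "W = poly (wronskian fs) z"
    define S where "S = (\<Sum>i<r. poly (wcof fs i) z * hratio N i z)"
    define D where "D = hratio N r z - (-1) ^ (r div 2) * of_real (hscale N ^ r)"
    have "exc_quot N z - (-1) ^ (r div 2) * of_real (hscale N ^ r) * W = S + W * D"
      by (simp add: exc_quot_eq S_def D_def W_def algebra_simps)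
    also have "cmod \<dots> * hscale N \<le> (cmod S + cmod W * cmod D) * hscale N"
      using hscale_ge_0 by (intro mult_right_mono) (auto simp flip: norm_mult intro: norm_triangle_ineq)
    also have "\<dots> = cmod S * hscale N + cmod W * (cmod D * hscale N)" by (simp add: algebra_simps)
    also have "\<dots> \<le> C1 * hscale N ^ r + B * (C2 * hscale N ^ r)"
    proof (rule add_mono)
      show "cmod S * hscale N \<le> C1 * hscale N ^ r" using C1(2)[OF N z] by (simp add: S_def)
      have "cmod D * hscale N \<le> C2 * hscale N ^ r" using C2(2)[OF N z] hratio_0[OF z \<delta>] by (simp add: D_def r2)
      thus "cmod W * (cmod D * hscale N) \<le> B * (C2 * hscale N ^ r)"
        by (rule mult_mono[rotated]) (use B z hscale_ge_0 in \<open>auto simp: W_def\<close>)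
    qed
    finally show "cmod (exc_quot N z - (-1) ^ (r div 2) * of_real (hscale N ^ r) * poly (wronskian fs) z) * hscale N
       \<le> (C1 + B * C2) * hscale N ^ r" by (simp add: W_def algebra_simps)
  qed
qed

lemma exc_quot_approx_norm:
  obtains C where "C \<ge> 0" and "\<And>N z. N \<ge> 1 \<Longrightarrow> z \<in> strip \<delta> R \<Longrightarrow>
    cmod (exc_quot N z) \<le> hscale N ^ r * (cmod (poly (wronskian fs) z) + C / hscale N) \<and>
    hscale N ^ r * (cmod (poly (wronskian fs) z) - C / hscale N) \<le> cmod (exc_quot N z)"
proof -
  obtain C where C: "C \<ge> 0" "\<And>N z. N \<ge> 1 \<Longrightarrow> z \<in> strip \<delta> R \<Longrightarrow>
    cmod (exc_quot N z - (-1) ^ (r div 2) * of_real (hscale N ^ r) * poly (wronskian fs) z) * hscale N \<le> C * hscale N ^ r"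
    using exc_quot_approx by blast
  show ?thesis
  proof (rule that[OF C(1)])
    fix N :: nat and z assume N: "N \<ge> 1" and z: "z \<in> strip \<delta> R"
    define s where "s = hscale N"
    have s: "s \<ge> 1" using hscale_ge_1[OF N] by (simp add: s_def)
    define A where "A = (-1) ^ (r div 2) * of_real (s ^ r) * poly (wronskian fs) z"
    have "cmod (exc_quot N z - A) \<le> C * s ^ r / s"
      using C(2)[OF N z] s by (simp add: A_def s_def[symmetric] field_simps)
    moreover have "cmod A = s ^ r * cmod (poly (wronskian fs) z)"
      using s by (simp add: A_def norm_mult norm_power)
    moreover have "cmod (exc_quot N z) \<le> cmod A + cmod (exc_quot N z - A)"
      using norm_triangle_ineq[of A "exc_quot N z - A"] by simp
    moreover have "cmod A - cmod (exc_quot N z - A) \<le> cmod (exc_quot N z)"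
      using norm_triangle_ineq2[of A "A - exc_quot N z"] by (simp add: norm_minus_commute)
    ultimately show "cmod (exc_quot N z) \<le> hscale N ^ r * (cmod (poly (wronskian fs) z) + C / hscale N) \<and>
        hscale N ^ r * (cmod (poly (wronskian fs) z) - C / hscale N) \<le> cmod (exc_quot N z)"
      unfolding s_def[symmetric] by (simp add: algebra_simps)
  qed
qed

lemma exc_deriv_bound:
  "\<exists>C\<ge>0. \<forall>N\<ge>1. \<forall>z\<in>strip \<delta> R.
     cmod (poly (pderiv (wronskian (fs @ [hermite N]))) z / poly (hermite N) z) \<le> C * hscale N ^ Suc r"
proof -
  obtain C1 where C1: "C1 \<ge> 0" "\<And>N z. N \<ge> 1 \<Longrightarrow> z \<in> strip \<delta> R \<Longrightarrow>
     cmod (\<Sum>i<Suc r. poly (pderiv (wcof fs i)) z * hratio N (i + 0) z) * hscale N \<le> C1 * hscale N ^ (Suc r + 0)"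
    using sum_hratio_bound[OF \<delta> R, where p = "\<lambda>i. pderiv (wcof fs i)" and k = "Suc r" and l = 0] by blast
  obtain C2 where C2: "C2 \<ge> 0" "\<And>N z. N \<ge> 1 \<Longrightarrow> z \<in> strip \<delta> R \<Longrightarrow>
     cmod (\<Sum>i<Suc r. poly (wcof fs i) z * hratio N (i + 1) z) * hscale N \<le> C2 * hscale N ^ (Suc r + 1)"
    using sum_hratio_bound[OF \<delta> R, where p = "wcof fs" and k = "Suc r" and l = 1] by blast
  show ?thesis
  proof (intro exI[of _ "C1 + C2"] conjI allI impI ballI)
    show "C1 + C2 \<ge> 0" using C1 C2 by simp
    fix N :: nat and z assume N: "N \<ge> 1" and z: "z \<in> strip \<delta> R"
    define s where "s = hscale N"
    have s: "s \<ge> 1" using hscale_ge_1[OF N] by (simp add: s_def)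
    define S1 where "S1 = (\<Sum>i<Suc r. poly (pderiv (wcof fs i)) z * hratio N (i + 0) z)"
    define S2 where "S2 = (\<Sum>i<Suc r. poly (wcof fs i) z * hratio N (i + 1) z)"
    have "poly (pderiv (wronskian (fs @ [hermite N]))) z / poly (hermite N) z = S1 + S2"
      unfolding wronskian_snoc pderiv_sum pderiv_mult r[symmetric] S1_def S2_def lessThan_Suc_atMost
      by (simp add: hratio_def poly_sum sum_divide_distrib add_divide_distrib sum.distrib mult.commute)
    also have "cmod \<dots> * s \<le> (cmod S1 + cmod S2) * s"
      using s by (intro mult_right_mono norm_triangle_ineq) auto
    also have "\<dots> \<le> C1 * s ^ Suc r + C2 * s ^ Suc (Suc r)"
      using C1(2)[OF N z] C2(2)[OF N z] by (simp add: S1_def S2_def s_def distrib_right)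
    also have "\<dots> \<le> C1 * s ^ Suc (Suc r) + C2 * s ^ Suc (Suc r)"
      using s C1(1) by (intro add_right_mono mult_left_mono power_increasing) auto
    also have "\<dots> = ((C1 + C2) * s ^ Suc r) * s" by (simp add: algebra_simps)
    finally show "cmod (poly (pderiv (wronskian (fs @ [hermite N]))) z / poly (hermite N) z) \<le> (C1 + C2) * hscale N ^ Suc r"
      using s unfolding s_def[symmetric] by (simp only: mult_le_cancel_right_pos)
  qed
qed

text \<open>At a zero of the Wronskian the top term drops out. The next coefficient is minus its
  derivative, and the order \<open>r - 1\<close> is odd, so that term has size
  \<open>s ^ (r - 2) * |h' / h|\<close>, which is of order \<open>s ^ (r - 1)\<close>, while the
  rest is \<open>O(s ^ (r - 2))\<close>. This keeps exceptional zeros apart from the zeros of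
  \<open>H\<close>.\<close>

lemma exc_nonzero_at_root:
  assumes z: "z \<in> strip \<delta> R" and W0: "poly (wronskian fs) z = 0" and W1: "poly (pderiv (wronskian fs)) z \<noteq> 0"
  shows "\<forall>\<^sub>F N in sequentially. poly (wronskian (fs @ [hermite N])) z \<noteq> 0"
proof -
  have "r \<noteq> 0"
  proof
    assume "r = 0"
    hence "wronskian fs = 1" using r by (simp add: wronskian_def)
    with W0 show False by simp
  qed
  moreover obtain t where "r = 2 * t" using even_r by (elim evenE)
  ultimately obtain q where q: "r = Suc (Suc (2 * q))" by (cases t) auto
  define s where "s = hscale"
  define d where "d = cmod (poly (pderiv (wronskian fs)) z)"
  have d: "d > 0" using W1 by (simp add: d_def)
  have wc: "poly (wcof fs (Suc (2 * q))) z = - poly (pderiv (wronskian fs)) z"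
    using pderiv_wronskian[of fs "Suc (2 * q)"] r q by simp
  obtain C1 where C1: "C1 \<ge> 0" "\<And>N. N \<ge> 1 \<Longrightarrow>
     cmod (\<Sum>i<Suc (2 * q). poly (wcof fs i) z * hratio N (i + 0) z) * s N \<le> C1 * s N ^ (Suc (2 * q) + 0)"
    using sum_hratio_bound[OF \<delta> R, where p = "wcof fs" and k = "Suc (2 * q)" and l = 0] z unfolding s_def by blast
  obtain C2 where C2: "C2 \<ge> 0" "\<And>N. N \<ge> 1 \<Longrightarrow>
     cmod (hratio N (2 * q + 1) z - (-1) ^ q * of_real (s N ^ (2 * q)) * hratio N 1 z) * s N
       \<le> C2 * s N ^ (2 * q + 1)"
    using hratio_asymp[OF \<delta> R, of q 1] z unfolding s_def by blast
  obtain K where K: "K \<ge> 0" "\<And>N. N \<ge> 1 \<Longrightarrow> s N \<le> (K + 1) * cmod (hratio N 1 z)"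
  proof -
    obtain K where K: "K \<ge> 0" "\<And>N z. N \<ge> 1 \<Longrightarrow> z \<in> strip \<delta> R \<Longrightarrow>
      cmod (poly (pderiv (hermite N)) z / poly (hermite N) z) \<le> (K + 1) * hscale N \<and>
      hscale N \<le> (K + 1) * cmod (poly (pderiv (hermite N)) z / poly (hermite N) z)"
      using hermite_log_derivative_bounds[OF \<delta> R] by blast
    have "hratio N 1 z = poly (pderiv (hermite N)) z / poly (hermite N) z" for N
      by (simp add: hratio_def)
    thus ?thesis using that[of K] K z by (simp add: s_def)
  qed
  show ?thesis
    \<comment> \<open>In this threshold \<open>C1 / d\<close> accounts for the lower terms,
      \<open>C2\<close> for the error in the odd derivative, and \<open>K + 1\<close> for the lower
      bound on \<open>h' / h\<close>.\<close>
    using hscale_eventually_gt[of "(K + 1) * (C2 + C1 / d)"] eventually_ge_at_top[of 1]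
  proof eventually_elim
    case (elim N)
    have sN: "s N \<ge> 1" using hscale_ge_1 elim by (simp add: s_def)
    define D where "D = hratio N (2 * q + 1) z - (-1) ^ q * of_real (s N ^ (2 * q)) * hratio N 1 z"
    define S where "S = (\<Sum>i<Suc (2 * q). poly (wcof fs i) z * hratio N i z)"
    have D: "cmod D \<le> C2 * s N ^ (2 * q)"
      using C2(2)[of N] elim sN by (simp add: D_def)
    have S: "cmod S \<le> C1 * s N ^ (2 * q)"
      using C1(2)[of N] elim sN by (simp add: S_def)
    have "exc_quot N z = S - poly (pderiv (wronskian fs)) z * hratio N (2 * q + 1) z"
      unfolding exc_quot_eq W0 q by (simp add: S_def wc)
    moreover have "cmod (poly (pderiv (wronskian fs)) z * hratio N (2 * q + 1) z) > cmod S"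
    proof -
      have "C2 + C1 / d < s N / (K + 1)"
        using elim K(1) by (simp add: s_def pos_less_divide_eq mult.commute)
      also have "\<dots> \<le> cmod (hratio N 1 z)" using K elim by (simp add: pos_divide_le_eq mult.commute)
      finally have "C1 < d * (cmod (hratio N 1 z) - C2)" using d by (simp add: field_simps)
      hence "C1 * s N ^ (2 * q) < d * (cmod (hratio N 1 z) - C2) * s N ^ (2 * q)"
        using sN by (intro mult_strict_right_mono) auto
      also have "\<dots> = d * (s N ^ (2 * q) * cmod (hratio N 1 z) - C2 * s N ^ (2 * q))" by (simp add: algebra_simps)
      also have "s N ^ (2 * q) * cmod (hratio N 1 z) = cmod ((-1) ^ q * of_real (s N ^ (2 * q)) * hratio N 1 z)"
        using sN by (simp add: norm_mult norm_power)
      also have "d * (\<dots> - C2 * s N ^ (2 * q)) \<le> d * cmod (hratio N (2 * q + 1) z)"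
      proof (rule mult_left_mono)
        have "(-1) ^ q * of_real (s N ^ (2 * q)) * hratio N 1 z = hratio N (2 * q + 1) z - D" by (simp add: D_def)
        thus "cmod ((-1) ^ q * of_real (s N ^ (2 * q)) * hratio N 1 z) - C2 * s N ^ (2 * q) \<le> cmod (hratio N (2 * q + 1) z)"
          using norm_triangle_ineq4[of "hratio N (2 * q + 1) z" D] D by simp
      qed (use d in simp)
      finally show ?thesis using S by (simp add: norm_mult d_def)
    qed
    ultimately have "exc_quot N z \<noteq> 0" by auto
    thus ?case by (auto simp: exc_quot_def)
  qed
qed

text \<open>One derivative costs at most one factor \<open>s\<close>, while the quotient by
  \<open>hermite N\<close> stays above a multiple of \<open>s ^ r\<close>. The bound serves at a
  single reference point, to control the sum over the regular zeros.\<close>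

lemma exc_log_derivative_bound:
  assumes z: "z \<in> strip \<delta> R" and W0: "poly (wronskian fs) z \<noteq> 0"
  shows "\<exists>C\<ge>0. \<forall>\<^sub>F N in sequentially. poly (wronskian (fs @ [hermite N])) z \<noteq> 0 \<and>
    cmod (poly (pderiv (wronskian (fs @ [hermite N]))) z / poly (wronskian (fs @ [hermite N])) z) \<le> C * hscale N"
proof -
  define d where "d = cmod (poly (wronskian fs) z)"
  have d: "d > 0" using W0 by (simp add: d_def)
  obtain C where C: "C \<ge> 0" "\<And>N z. N \<ge> 1 \<Longrightarrow> z \<in> strip \<delta> R \<Longrightarrow>
    cmod (exc_quot N z) \<le> hscale N ^ r * (cmod (poly (wronskian fs) z) + C / hscale N) \<and>
    hscale N ^ r * (cmod (poly (wronskian fs) z) - C / hscale N) \<le> cmod (exc_quot N z)"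
    using exc_quot_approx_norm by blast
  obtain C' where C': "C' \<ge> 0" "\<And>N z. N \<ge> 1 \<Longrightarrow> z \<in> strip \<delta> R \<Longrightarrow>
     cmod (poly (pderiv (wronskian (fs @ [hermite N]))) z / poly (hermite N) z) \<le> C' * hscale N ^ Suc r"
    using exc_deriv_bound by blast
  show ?thesis
  proof (intro exI[of _ "2 * C' / d"] conjI)
    show "2 * C' / d \<ge> 0" using C' d by simp
    show "\<forall>\<^sub>F N in sequentially. poly (wronskian (fs @ [hermite N])) z \<noteq> 0 \<and>
      cmod (poly (pderiv (wronskian (fs @ [hermite N]))) z / poly (wronskian (fs @ [hermite N])) z) \<le> 2 * C' / d * hscale N"
      using hscale_eventually_gt[of "2 * C / d"] eventually_ge_at_top[of 1]
    proof eventually_elim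
      case (elim N)
      define s where "s = hscale N"
      have s: "s \<ge> 1" using hscale_ge_1 elim by (simp add: s_def)
      have "C / s \<le> d / 2" using elim(1) d s by (simp add: s_def[symmetric] field_simps)
      hence "s ^ r * (d / 2) \<le> s ^ r * (d - C / s)" using s by (intro mult_left_mono) auto
      also have "\<dots> \<le> cmod (exc_quot N z)" using C(2)[of N z] elim z by (simp add: s_def d_def)
      finally have q: "s ^ r * (d / 2) \<le> cmod (exc_quot N z)" .
      moreover have sd: "s ^ r * (d / 2) > 0" using s d by simp
      ultimately have "exc_quot N z \<noteq> 0" by auto
      hence nz: "poly (wronskian (fs @ [hermite N])) z \<noteq> 0" "poly (hermite N) z \<noteq> 0"
        by (auto simp: exc_quot_def)
      define D where "D = poly (pderiv (wronskian (fs @ [hermite N]))) z / poly (hermite N) z"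
      have "poly (pderiv (wronskian (fs @ [hermite N]))) z / poly (wronskian (fs @ [hermite N])) z = D / exc_quot N z"
        using nz by (simp add: D_def exc_quot_def)
      moreover have "cmod (D / exc_quot N z) \<le> (C' * s ^ Suc r) / (s ^ r * (d / 2))"
        unfolding norm_divide using C'(2)[of N z] elim z q sd
        by (intro frac_le) (auto simp: D_def s_def C'(1) hscale_ge_0)
      moreover have "(C' * s ^ Suc r) / (s ^ r * (d / 2)) = 2 * C' / d * s"
        using s d by (simp add: field_simps)
      ultimately show ?case using nz by (simp add: s_def)
    qed
  qed
qed

end

text \<open>Existence comes from the maximum principle for \<open>h / P\<close>, with
  \<open>P\<close> the exceptional polynomial: without a zero of \<open>P\<close> in the disc this
  function would be holomorphic there, yet larger in modulus at the centre, where the Wronskian of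
  \<open>fs\<close> vanishes, than on the circle. The distance bound holds because that Wronskian is
  at least \<open>c * |z - \<zeta>|\<close> in modulus on the disc.\<close>

lemma exc_zero_near_root:
  assumes Wr: "wronskian fs \<noteq> 0" and W0: "poly (wronskian fs) \<zeta> = 0" and W1: "poly (pderiv (wronskian fs)) \<zeta> \<noteq> 0"
    and \<rho>: "0 < \<rho>" "\<rho> < \<bar>Im \<zeta>\<bar>"
    and iso: "\<And>z. z \<in> cball \<zeta> \<rho> \<Longrightarrow> poly (wronskian fs) z = 0 \<Longrightarrow> z = \<zeta>"
  shows "\<exists>C\<ge>0. \<forall>\<^sub>F N in sequentially. poly (wronskian (fs @ [hermite N])) \<zeta> \<noteq> 0 \<and>
    (\<exists>z\<in>cball \<zeta> \<rho>. poly (wronskian (fs @ [hermite N])) z = 0) \<and>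
    (\<forall>z\<in>cball \<zeta> \<rho>. poly (wronskian (fs @ [hermite N])) z = 0 \<longrightarrow> cmod (z - \<zeta>) * hscale N \<le> C)"
proof -
  define \<delta> where "\<delta> = \<bar>Im \<zeta>\<bar> - \<rho>"
  define R where "R = cmod \<zeta> + \<rho>"
  have \<delta>: "\<delta> > 0" and R: "R \<ge> 0" using \<rho> by (auto simp: \<delta>_def R_def)
  have sub: "cball \<zeta> \<rho> \<subseteq> strip \<delta> R"
  proof
    fix z assume "z \<in> cball \<zeta> \<rho>"
    hence "cmod (\<zeta> - z) \<le> \<rho>" by (simp add: dist_norm)
    moreover have "\<bar>Im (\<zeta> - z)\<bar> \<le> cmod (\<zeta> - z)" by (rule abs_Im_le_cmod)
    moreover have "cmod z \<le> cmod \<zeta> + cmod (\<zeta> - z)" using norm_triangle_ineq4[of \<zeta> "\<zeta> - z"] by simp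
    ultimately show "z \<in> strip \<delta> R" by (auto simp: strip_def \<delta>_def R_def)
  qed
  have \<zeta>: "\<zeta> \<in> strip \<delta> R" using sub \<rho> by auto
  obtain C where C: "C \<ge> 0" "\<And>N z. N \<ge> 1 \<Longrightarrow> z \<in> strip \<delta> R \<Longrightarrow>
    cmod (exc_quot N z) \<le> hscale N ^ r * (cmod (poly (wronskian fs) z) + C / hscale N) \<and>
    hscale N ^ r * (cmod (poly (wronskian fs) z) - C / hscale N) \<le> cmod (exc_quot N z)"
    using exc_quot_approx_norm[OF \<delta> R] by blast
  obtain G where G: "wronskian fs = [:- \<zeta>, 1:] * G" using W0 by (auto simp: poly_eq_0_iff_dvd elim: dvdE)
  have G\<zeta>: "poly G \<zeta> \<noteq> 0"
    using W1 unfolding G by (subst (asm) pderiv_mult) (simp add: pderiv_pCons)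
  have Gnz: "poly G z \<noteq> 0" if "z \<in> cball \<zeta> \<rho>" for z
    using iso[OF that] G\<zeta> by (auto simp: G)
  have "continuous_on (cball \<zeta> \<rho>) (\<lambda>z. cmod (poly G z))" by (intro continuous_intros)
  moreover have "compact (cball \<zeta> \<rho>)" "cball \<zeta> \<rho> \<noteq> {}" using \<rho> by auto
  ultimately obtain z0 where z0: "z0 \<in> cball \<zeta> \<rho>" "\<And>z. z \<in> cball \<zeta> \<rho> \<Longrightarrow> cmod (poly G z0) \<le> cmod (poly G z)"
    using continuous_attains_inf[of "cball \<zeta> \<rho>" "\<lambda>z. cmod (poly G z)"] by blast
  define c where "c = cmod (poly G z0)"
  have c: "c > 0" using Gnz z0 by (simp add: c_def)
  have W_ge: "c * cmod (z - \<zeta>) \<le> cmod (poly (wronskian fs) z)" if "z \<in> cball \<zeta> \<rho>" for z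
  proof -
    have "poly (wronskian fs) z = (z - \<zeta>) * poly G z" by (simp add: G algebra_simps)
    hence "cmod (poly (wronskian fs) z) = cmod (z - \<zeta>) * cmod (poly G z)" by (simp only: norm_mult)
    thus ?thesis using z0(2)[OF that] unfolding c_def by (simp add: mult.commute mult_left_mono)
  qed
  have herm_nz: "poly (hermite N) z \<noteq> 0" if "z \<in> cball \<zeta> \<rho>" for N z
    using hermite_nonreal[of z N] sub that \<delta> by (fastforce simp: strip_def)
  show ?thesis
  proof (intro exI[of _ "C / c"] conjI)
    show "C / c \<ge> 0" using C c by simp
    show "\<forall>\<^sub>F N in sequentially. poly (wronskian (fs @ [hermite N])) \<zeta> \<noteq> 0 \<and>
      (\<exists>z\<in>cball \<zeta> \<rho>. poly (wronskian (fs @ [hermite N])) z = 0) \<and>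
      (\<forall>z\<in>cball \<zeta> \<rho>. poly (wronskian (fs @ [hermite N])) z = 0 \<longrightarrow> cmod (z - \<zeta>) * hscale N \<le> C / c)"
      using hscale_eventually_gt[of "2 * C / (c * \<rho>)"] eventually_ge_at_top[of 1]
        exc_nonzero_at_root[OF \<delta> R \<zeta> W0 W1]
    proof eventually_elim
      case (elim N)
      define s where "s = hscale N"
      have s: "s \<ge> 1" using hscale_ge_1 elim by (simp add: s_def)
      have sr: "s ^ r > 0" using s by simp
      \<comment> \<open>On the circle the Wronskian of \<open>fs\<close> has modulus at least
        \<open>c * \<rho>\<close>; the approximation error \<open>C / s\<close> reduces this and is
        all that remains at the centre.\<close>
      have gap: "C / s < c * \<rho> - C / s" using elim(1) c \<rho> s by (simp add: s_def[symmetric] field_simps)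
      define P where "P = wronskian (fs @ [hermite N])"
      have "\<exists>z\<in>cball \<zeta> \<rho>. poly P z = 0"
      proof (rule ccontr)
        assume no: "\<not> (\<exists>z\<in>cball \<zeta> \<rho>. poly P z = 0)"
        define g where "g = (\<lambda>z. poly (hermite N) z / poly P z)"
        have diff: "g field_differentiable (at z)" if "z \<in> cball \<zeta> \<rho>" for z
          using no that unfolding g_def
          by (intro field_differentiable_divide) (auto simp: field_differentiable_def intro: poly_DERIV)
        have g: "cmod (g z) = 1 / cmod (exc_quot N z)" for z
          by (simp add: g_def exc_quot_def P_def norm_divide)
        define b where "b = s ^ r * (c * \<rho> - C / s)"
        have "C / s \<ge> 0" using C(1) s by simp
        with gap have "c * \<rho> - C / s > 0" by linarith
        hence b: "b > 0" unfolding b_def by (rule mult_pos_pos[OF sr])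
        have "cmod (g \<zeta>) \<le> 1 / b"
        proof (rule maximum_modulus_frontier[where f = g and S = "cball \<zeta> \<rho>" and \<xi> = \<zeta> and B = "1 / b"])
          show "g holomorphic_on interior (cball \<zeta> \<rho>)"
            unfolding holomorphic_on_def using diff by (auto intro: field_differentiable_at_within)
          show "continuous_on (closure (cball \<zeta> \<rho>)) g"
            using diff by (auto intro!: continuous_at_imp_continuous_on field_differentiable_imp_continuous_at)
          fix z assume "z \<in> frontier (cball \<zeta> \<rho>)"
          hence z: "z \<in> cball \<zeta> \<rho>" "cmod (z - \<zeta>) = \<rho>" using \<rho> by (auto simp: dist_norm norm_minus_commute)
          have "b \<le> s ^ r * (cmod (poly (wronskian fs) z) - C / s)"
            unfolding b_def using W_ge[OF z(1)] z(2) sr by (intro mult_left_mono) (simp_all add: mult.commute)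
          also have "\<dots> \<le> cmod (exc_quot N z)" using C(2)[of N z] elim z(1) sub by (auto simp: s_def)
          finally show "cmod (g z) \<le> 1 / b" unfolding g using b by (intro frac_le) auto
        qed (use \<rho> in auto)
        moreover have "cmod (exc_quot N \<zeta>) > 0" using elim(3) herm_nz[of \<zeta>] \<rho> by (simp add: exc_quot_def)
        ultimately have "b \<le> cmod (exc_quot N \<zeta>)" unfolding g using b by (simp add: field_simps)
        also have "\<dots> \<le> s ^ r * (C / s)" using C(2)[of N \<zeta>] elim \<zeta> by (simp add: W0 s_def)
        also have "\<dots> < b" unfolding b_def using gap sr by (rule mult_strict_left_mono)
        finally show False by simp
      qed
      moreover have "cmod (z - \<zeta>) * s \<le> C / c" if z: "z \<in> cball \<zeta> \<rho>" and P: "poly P z = 0" for z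
      proof -
        have "exc_quot N z = 0" using P by (simp add: exc_quot_def P_def)
        moreover have "s ^ r * (cmod (poly (wronskian fs) z) - C / s) \<le> cmod (exc_quot N z)"
          using C(2)[of N z] elim z sub by (auto simp: s_def)
        ultimately have "s ^ r * (cmod (poly (wronskian fs) z) - C / s) \<le> 0" by simp
        hence "cmod (poly (wronskian fs) z) \<le> C / s" using sr by (simp add: mult_le_0_iff)
        with W_ge[OF z] have "c * cmod (z - \<zeta>) \<le> C / s" by simp
        thus ?thesis using c s by (simp add: field_simps)
      qed
      ultimately show ?case using elim(3) by (simp add: P_def s_def)
    qed
  qed
qed

end

section \<open>Zeros of exceptional Hermite polynomials\<close>

definition degree_seq :: "nat list \<Rightarrow> nat \<Rightarrow> nat" where
  "degree_seq lam i = rev lam ! i + i"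

lemma hermite_seq_eq: "hermite_seq lam = map (\<lambda>i. hermite (degree_seq lam i)) [0..<length lam]"
  by (simp add: hermite_seq_def degree_seq_def)

lemma hermite_seq_eq': "hermite_seq lam = map hermite (map (degree_seq lam) [0..<length lam])"
  by (simp add: hermite_seq_eq)

lemma degree_seq_strict_mono:
  assumes "partition lam" "i < j" "j < length lam"
  shows "degree_seq lam i < degree_seq lam j"
proof -
  have "sorted (rev lam)" using assms(1) by (simp add: partition_def sorted_wrt_rev)
  hence "rev lam ! i \<le> rev lam ! j" using assms by (intro sorted_nth_mono) auto
  thus ?thesis using assms by (simp add: degree_seq_def)
qed

lemma degree_seq_inj:
  assumes "partition lam"
  shows "inj_on (degree_seq lam) {..<length lam}"
  by (intro linorder_inj_onI) (use degree_seq_strict_mono[OF assms] in force)+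

text \<open>The length is even, so reversing the list keeps equal parts in aligned pairs; adding the
  position makes the two degrees consecutive.\<close>

lemma degree_seq_pairs:
  assumes "even_partition lam" "2 * k + 1 < length lam"
  shows "degree_seq lam (2 * k + 1) = degree_seq lam (2 * k) + 1"
proof -
  obtain q where q: "length lam = 2 * q" using assms(1) by (auto simp: even_partition_def)
  define j where "j = q - 1 - k"
  have j: "j < q" "length lam - Suc (2 * k) = 2 * j + 1" "length lam - Suc (2 * k + 1) = 2 * j"
    using assms(2) q by (auto simp: j_def)
  have "lam ! (2 * j) = lam ! (2 * j + 1)" using assms(1) j(1) q by (auto simp: even_partition_def)
  thus ?thesis using assms(2) j by (simp add: degree_seq_def rev_nth)
qed

text \<open>A factor \<open>(k - d) * (k - d - 1)\<close> is negative only strictly between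
  \<open>d\<close> and \<open>d + 1\<close>, where no integer lies. This is the use of the pairing
  of equal parts.\<close>

lemma degree_seq_prod_nonneg:
  assumes "even_partition lam"
  shows "(\<Prod>i<length lam. real k - real (degree_seq lam i)) \<ge> 0"
proof -
  obtain q where q: "length lam = 2 * q" using assms by (auto simp: even_partition_def)
  have "(\<Prod>i<2 * p. real k - real (degree_seq lam i)) \<ge> 0" if "p \<le> q" for p
    using that
  proof (induction p)
    case (Suc p)
    define d where "d = degree_seq lam (2 * p)"
    have d: "degree_seq lam (2 * p + 1) = d + 1" unfolding d_def
      by (rule degree_seq_pairs[OF assms]) (use Suc.prems q in simp)
    have eq: "(\<Prod>i<2 * Suc p. real k - real (degree_seq lam i)) =
       (\<Prod>i<2 * p. real k - real (degree_seq lam i)) * ((real k - real d) * (real k - real (d + 1)))"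
      using d by (simp add: d_def mult.assoc)
    have "(real k - real d) * (real k - real (d + 1)) \<ge> 0"
      by (cases "k \<le> d") (auto intro: mult_nonneg_nonneg mult_nonpos_nonpos)
    moreover have "(\<Prod>i<2 * p. real k - real (degree_seq lam i)) \<ge> 0" using Suc by simp
    ultimately show ?case unfolding eq by (rule mult_nonneg_nonneg[rotated])
  qed simp
  thus ?thesis using q by simp
qed

lemma pderiv_nonzero_simple_root:
  fixes p :: "complex poly"
  assumes "p \<noteq> 0" "poly p a = 0" "order a p = 1"
  shows "poly (pderiv p) a \<noteq> 0"
proof
  assume d: "poly (pderiv p) a = 0"
  obtain G where G: "p = [:- a, 1:] * G" using assms(2) by (auto simp: poly_eq_0_iff_dvd elim: dvdE)
  have "poly G a = 0" using d unfolding G by (subst (asm) pderiv_mult) (simp add: pderiv_pCons)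
  hence "[:- a, 1:] * [:- a, 1:] dvd p" unfolding G by (intro mult_dvd_mono) (auto simp: poly_eq_0_iff_dvd)
  hence "[:- a, 1:] ^ 2 dvd p" by (simp only: power2_eq_square)
  thus False using assms(1,3) by (simp add: order_divides)
qed

lemma order_eq_1I:
  fixes p :: "complex poly"
  assumes "poly p a = 0" "poly (pderiv p) a \<noteq> 0"
  shows "order a p = 1"
proof -
  have "p \<noteq> 0" using assms(2) by auto
  moreover have "\<not> [:- a, 1:] ^ 2 dvd p"
  proof
    assume "[:- a, 1:] ^ 2 dvd p"
    then obtain q where "p = [:- a, 1:] ^ 2 * q" by (elim dvdE)
    hence "p = [:- a, 1:] * ([:- a, 1:] * q)" by (simp only: power2_eq_square mult.assoc)
    hence "poly (pderiv p) a = 0" by (simp only: pderiv_mult) (simp add: pderiv_pCons)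
    thus False using assms(2) by simp
  qed
  ultimately have "order a p < 2" by (simp add: order_divides)
  moreover have "order a p \<noteq> 0" using \<open>p \<noteq> 0\<close> assms(1) by (simp add: order_root)
  ultimately show ?thesis by simp
qed

text \<open>
  Below \<open>s = sqrt (2 * N)\<close>, which is \<open>\<pi>\<close> times the density of the regular zeros near the origin, and
  \<open>\<zeta> k\<close> is the zero of \<open>H\<close> next to \<open>z k\<close>.
\<close>

definition near_configuration ::
  "real \<Rightarrow> real \<Rightarrow> real \<Rightarrow> complex poly \<Rightarrow> nat \<Rightarrow> nat \<Rightarrow> (nat \<Rightarrow> complex) \<Rightarrow> (nat \<Rightarrow> real) \<Rightarrow> (nat \<Rightarrow> complex) \<Rightarrow> bool" where
  "near_configuration \<rho> C s H m n z x \<zeta> \<longleftrightarrow>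
     H \<noteq> 0 \<and> H = smult (lead_coeff H) (\<Prod>k<m. [:- \<zeta> k, 1:]) \<and>
     (\<forall>k<m. 2 * \<rho> \<le> \<bar>Im (\<zeta> k)\<bar> \<and> cmod (z k - \<zeta> k) \<le> \<rho> \<and> z k \<noteq> \<zeta> k \<and> cmod (z k - \<zeta> k) * s \<le> C \<and>
        (\<Sum>i<n. 1 / (cmod (of_real (x i) - z k))\<^sup>2) \<le> C * s) \<and>
     (\<forall>k<m. \<forall>l<m. k \<noteq> l \<longrightarrow> 4 * \<rho> \<le> cmod (\<zeta> k - \<zeta> l)) \<and> inj_on x {..<n}"

lemma finite_positive_lower_bound:
  fixes S :: "real set"
  assumes "finite S" "\<And>s. s \<in> S \<Longrightarrow> s > 0"
  obtains \<rho> where "\<rho> > 0" "\<And>s. s \<in> S \<Longrightarrow> \<rho> \<le> s" "\<rho> \<le> 1"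
  by (rule that[of "Min (insert 1 S)"]) (use assms in auto)

lemma count_mset_map_upt: "count (mset (map f [0..<n])) t = card {l. l < n \<and> f l = t}"
proof (induction n)
  case (Suc n)
  have "{l. l < Suc n \<and> f l = t} = {l. l < n \<and> f l = t} \<union> (if f n = t then {n} else {})"
    by (auto simp: less_Suc_eq)
  thus ?case using Suc by (simp add: card_insert_if)
qed simp

section \<open>Matching the exceptional zeros with the zeros of \<open>H\<close>\<close>

context
  fixes lam :: "nat list" and H :: "complex poly"
  assumes lam: "even_partition lam" and H: "H = gen_hermite lam"
    and simple: "\<forall>a. poly H a = 0 \<longrightarrow> order a H = 1"
begin

lemma gen_hermite_nonzero: "H \<noteq> 0"
proof -
  have "partition lam" using lam by (simp add: even_partition_def)
  hence "distinct (map (degree_seq lam) [0..<length lam])"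
    using degree_seq_inj by (simp add: distinct_map atLeast0LessThan)
  thus ?thesis using wronskian_hermite_nonzero unfolding H gen_hermite_def hermite_seq_eq' by blast
qed

lemma gen_hermite_no_real_root: "poly H (of_real t) \<noteq> 0"
proof
  assume "poly H (of_real t) = 0"
  hence ord: "order (of_real t) H = 1" using simple by blast
  have "H = wronskian (map (\<lambda>i. hermite (degree_seq lam i)) [0..<length lam])"
    unfolding H gen_hermite_def hermite_seq_eq ..
  moreover have "even (length lam)" "partition lam" using lam by (auto simp: even_partition_def)
  ultimately have "poly H (of_real X) * poly H (of_real Y) \<in> \<real>\<^sub>\<ge>\<^sub>0" for X Y :: real
    using wronskian_hermite_same_sign[OF _ degree_seq_inj degree_seq_prod_nonneg[OF lam]] by simp
  hence "H = 0" using ord by (rule simple_root_same_sign_not_real)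
  with gen_hermite_nonzero show False by simp
qed

text \<open>The enumeration provides \<open>m\<close> nonreal zeros, and each of the
  \<open>m\<close> disjoint discs around the zeros of \<open>H\<close> holds at least one. So each
  disc holds exactly one, and no nonreal zero lies elsewhere.\<close>

lemma exceptional_zeros_near:
  "\<exists>\<rho>>0. \<exists>C\<ge>0. \<forall>\<^sub>F n in sequentially. (\<forall>p\<in>set lam. p \<le> n) \<longrightarrow>
     (\<forall>z x. enumerates_zeros (exc_hermite lam n) (degree H) n z x \<longrightarrow>
        (\<exists>\<zeta>. near_configuration \<rho> C (hscale (n + length lam)) H (degree H) n z x \<zeta>))"
proof -
  define fs where "fs = hermite_seq lam"
  define r where "r = length fs"
  define m where "m = degree H"
  have r_lam: "r = length lam" by (simp add: r_def fs_def hermite_seq_def)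
  have even_r: "even r" using lam by (simp add: r_lam even_partition_def)
  have part: "partition lam" using lam by (simp add: even_partition_def)
  have Hw: "H = wronskian fs" by (simp add: H gen_hermite_def fs_def)
  define Z where "Z = {a. poly H a = 0}"
  have finZ: "finite Z" unfolding Z_def by (rule poly_roots_finite[OF gen_hermite_nonzero])
  have HZ: "H = smult (lead_coeff H) (\<Prod>a\<in>Z. [:- a, 1:])"
  proof -
    have "H = smult (lead_coeff H) (\<Prod>a\<in>Z. [:- a, 1:] ^ order a H)"
      unfolding Z_def by (rule complex_poly_decompose[symmetric])
    also have "(\<Prod>a\<in>Z. [:- a, 1:] ^ order a H) = (\<Prod>a\<in>Z. [:- a, 1:])"
      by (rule prod.cong) (use simple in \<open>auto simp: Z_def\<close>)
    finally show ?thesis .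
  qed
  have cardZ: "card Z = m"
  proof -
    have "m = degree (smult (lead_coeff H) (\<Prod>a\<in>Z. [:- a, 1:]))" unfolding m_def using HZ by simp
    also have "\<dots> = card Z" using gen_hermite_nonzero by (simp add: degree_prod_eq_sum_degree)
    finally show ?thesis by simp
  qed
  have ImZ: "Im a \<noteq> 0" if "a \<in> Z" for a
    using that gen_hermite_no_real_root[of "Re a"] by (auto simp: Z_def complex_is_Real_iff of_real_Re)
  \<comment> \<open>With \<open>\<rho>\<close> below all these numbers, the discs of radius
    \<open>\<rho>\<close> around the zeros of \<open>H\<close> stay off the real axis and at
    distance at least \<open>2 * \<rho>\<close> from each other.\<close>
  define S where "S = (\<lambda>a. \<bar>Im a\<bar> / 2) ` Z \<union> (\<lambda>(a, b). cmod (a - b) / 4) ` {p \<in> Z \<times> Z. fst p \<noteq> snd p}"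
  have "finite S" using finZ by (auto simp: S_def)
  moreover have "s > 0" if "s \<in> S" for s using that ImZ by (auto simp: S_def)
  ultimately obtain \<rho> where \<rho>: "\<rho> > 0" "\<And>s. s \<in> S \<Longrightarrow> \<rho> \<le> s" "\<rho> \<le> 1"
    using finite_positive_lower_bound by blast
  have \<rho>Im: "2 * \<rho> \<le> \<bar>Im a\<bar>" if "a \<in> Z" for a
    using \<rho>(2)[of "\<bar>Im a\<bar> / 2"] that by (auto simp: S_def)
  have \<rho>dist: "4 * \<rho> \<le> cmod (a - b)" if "a \<in> Z" "b \<in> Z" "a \<noteq> b" for a b
    using \<rho>(2)[of "cmod (a - b) / 4"] that by (force simp: S_def)
  define near where "near = (\<lambda>a C N. poly (wronskian (fs @ [hermite N])) a \<noteq> 0 \<and>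
    (\<exists>z\<in>cball a \<rho>. poly (wronskian (fs @ [hermite N])) z = 0) \<and>
    (\<forall>z\<in>cball a \<rho>. poly (wronskian (fs @ [hermite N])) z = 0 \<longrightarrow> cmod (z - a) * hscale N \<le> C))"
  have near: "\<exists>C\<ge>0. \<forall>\<^sub>F N in sequentially. near a C N" if a: "a \<in> Z" for a
    unfolding near_def
  proof (rule exc_zero_near_root[OF r_def even_r])
    show "wronskian fs \<noteq> 0" "poly (wronskian fs) a = 0" "poly (pderiv (wronskian fs)) a \<noteq> 0"
      using gen_hermite_nonzero a simple pderiv_nonzero_simple_root[of H a] by (auto simp: Hw[symmetric] Z_def)
    show "0 < \<rho>" "\<rho> < \<bar>Im a\<bar>" using \<rho>(1) \<rho>Im[OF a] by auto
    show "y = a" if "y \<in> cball a \<rho>" "poly (wronskian fs) y = 0" for y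
    proof (rule ccontr)
      assume "y \<noteq> a"
      moreover have "y \<in> Z" using that by (simp add: Hw Z_def)
      ultimately have "4 * \<rho> \<le> cmod (a - y)" using \<rho>dist[OF a, of y] by simp
      thus False using that(1) \<rho>(1) by (simp add: dist_norm)
    qed
  qed
  define Ca where "Ca = (\<lambda>a. SOME C. C \<ge> 0 \<and> (\<forall>\<^sub>F N in sequentially. near a C N))"
  have Ca: "Ca a \<ge> 0 \<and> (\<forall>\<^sub>F N in sequentially. near a (Ca a) N)" if "a \<in> Z" for a
    unfolding Ca_def by (rule someI_ex[OF near[OF that, unfolded Bex_def]])
  have ev1: "\<forall>\<^sub>F N in sequentially. \<forall>a\<in>Z. near a (Ca a) N"
    using Ca by (intro eventually_ball_finite finZ) auto
  \<comment> \<open>\<open>w\<close> is a reference point on the imaginary axis, at distance at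
    least \<open>1\<close> from every \<open>z k\<close>. Once the \<open>m\<close> exceptional
    terms are removed, the logarithmic derivative at \<open>w\<close> has an imaginary part whose
    terms all have the same sign.\<close>
  define T where "T = 2 + (\<Sum>a\<in>Z. cmod a)"
  define w where "w = \<i> * of_real T"
  have T2: "T \<ge> 2" by (auto simp: T_def intro: sum_nonneg)
  have TZ: "cmod a + 2 \<le> T" if "a \<in> Z" for a
    unfolding T_def using member_le_sum[of a Z cmod] that finZ by simp
  have w: "Im w = T" "cmod w = T" using T2 by (simp_all add: w_def norm_mult)
  have "w \<notin> Z" using TZ[of w] w by auto
  hence "\<exists>C\<ge>0. \<forall>\<^sub>F N in sequentially. poly (wronskian (fs @ [hermite N])) w \<noteq> 0 \<and>
    cmod (poly (pderiv (wronskian (fs @ [hermite N]))) w / poly (wronskian (fs @ [hermite N])) w) \<le> C * hscale N"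
    using T2 w by (intro exc_log_derivative_bound[OF r_def even_r, of T T]) (auto simp: strip_def Z_def Hw)
  then obtain C0 where C0: "C0 \<ge> 0" and ev2: "\<forall>\<^sub>F N in sequentially. poly (wronskian (fs @ [hermite N])) w \<noteq> 0 \<and>
    cmod (poly (pderiv (wronskian (fs @ [hermite N]))) w / poly (wronskian (fs @ [hermite N])) w) \<le> C0 * hscale N"
    by blast
  \<comment> \<open>Chosen so that \<open>|w - t| \<le> A * |t - z k|\<close> for real
    \<open>t\<close>: the points \<open>w\<close> and \<open>z k\<close> are at most
    \<open>2 * T\<close> apart, and \<open>|t - z k|\<close> is at least
    \<open>\<rho>\<close>.\<close>
  define A where "A = 2 * T / \<rho> + 1"
  define C where "C = (\<Sum>a\<in>Z. Ca a) + A\<^sup>2 * (C0 + real m)"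
  have A1: "A \<ge> 1" using \<rho> T2 by (simp add: A_def)
  have C_ge: "C \<ge> 0" unfolding C_def using Ca C0 by (intro add_nonneg_nonneg sum_nonneg mult_nonneg_nonneg) auto
  have Ca_le: "Ca a \<le> C" if "a \<in> Z" for a
  proof -
    have "Ca a \<le> (\<Sum>a\<in>Z. Ca a)" using that finZ Ca by (intro member_le_sum) auto
    moreover have "A\<^sup>2 * (C0 + real m) \<ge> 0" using C0 by simp
    ultimately show ?thesis by (simp add: C_def)
  qed
  have "\<forall>\<^sub>F n in sequentially. (\<forall>p\<in>set lam. p \<le> n) \<longrightarrow>
     (\<forall>z x. enumerates_zeros (exc_hermite lam n) m n z x \<longrightarrow>
        (\<exists>\<zeta>. near_configuration \<rho> C (hscale (n + r)) H m n z x \<zeta>))"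
    using ev1[THEN eventually_sequentially_seg[THEN iffD2, of _ r]] ev2[THEN eventually_sequentially_seg[THEN iffD2, of _ r]]
      eventually_ge_at_top[of 1]
  proof eventually_elim
    case (elim n)
    define N where "N = n + r"
    define s where "s = hscale N"
    define P where "P = wronskian (fs @ [hermite N])"
    have s: "s \<ge> 1" using elim(3) hscale_ge_1[of N] by (simp add: s_def N_def)
    have P0: "P \<noteq> 0" using elim(2) by (auto simp: P_def N_def)
    show ?case
    proof (intro impI allI)
      fix z x assume n_ge: "\<forall>p\<in>set lam. p \<le> n" and "enumerates_zeros (exc_hermite lam n) m n z x"
      hence z_nonreal: "\<And>k. k < m \<Longrightarrow> z k \<notin> \<real>"
        and pr: "proots P = mset (map z [0..<m]) + mset (map (\<lambda>i. complex_of_real (x i)) [0..<n])"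
        by (auto simp: enumerates_zeros_def exc_hermite_def P_def N_def fs_def r_lam)
      have roots: "{a. poly P a = 0} = z ` {..<m} \<union> (\<lambda>i. complex_of_real (x i)) ` {..<n}"
        using arg_cong[OF pr, of set_mset] P0 by (simp add: atLeast0LessThan)
      have "\<exists>k<m. z k \<in> cball a \<rho>" if a: "a \<in> Z" for a
      proof -
        obtain y where y: "y \<in> cball a \<rho>" "poly P y = 0" using elim(1) a by (auto simp: P_def N_def near_def)
        have "\<bar>Im (a - y)\<bar> \<le> \<rho>" using y(1) abs_Im_le_cmod[of "a - y"] by (simp add: dist_norm)
        hence "Im y \<noteq> 0" using \<rho>Im[OF a] \<rho>(1) by auto
        thus ?thesis using roots y by (auto simp: set_eq_iff)
      qed
      then obtain \<kappa> where \<kappa>: "\<And>a. a \<in> Z \<Longrightarrow> \<kappa> a < m" "\<And>a. a \<in> Z \<Longrightarrow> z (\<kappa> a) \<in> cball a \<rho>" by metis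
      have inj\<kappa>: "inj_on \<kappa> Z"
      proof
        fix a b assume ab: "a \<in> Z" "b \<in> Z" "\<kappa> a = \<kappa> b"
        have "dist a b \<le> dist a (z (\<kappa> a)) + dist b (z (\<kappa> a))" by (rule dist_triangle2)
        also have "\<dots> \<le> 2 * \<rho>" using \<kappa>(2)[OF ab(1)] \<kappa>(2)[OF ab(2)] ab(3) by simp
        finally show "a = b" using \<rho>dist[OF ab(1,2)] \<rho>(1) by (fastforce simp: dist_norm)
      qed
      \<comment> \<open>The zeros of \<open>H\<close> are simple, so \<open>Z\<close> has
        \<open>m\<close> elements and the injection is onto: every exceptional zero is
        matched.\<close>
      have "\<kappa> ` Z = {..<m}"
        using \<kappa>(1) inj\<kappa> cardZ by (intro card_subset_eq) (auto simp: card_image)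
      hence bij: "bij_betw \<kappa> Z {..<m}" using inj\<kappa> by (simp add: bij_betw_def)
      define \<zeta> where "\<zeta> = inv_into Z \<kappa>"
      have bij\<zeta>: "bij_betw \<zeta> {..<m} Z" unfolding \<zeta>_def by (rule bij_betw_inv_into[OF bij])
      have \<zeta>Z: "\<zeta> k \<in> Z" if "k < m" for k using bij\<zeta> that by (auto simp: bij_betw_def)
      have \<zeta>ball: "z k \<in> cball (\<zeta> k) \<rho>" if "k < m" for k
        using \<kappa>(2)[OF \<zeta>Z[OF that]] bij_betw_inv_into_right[OF bij, of k] that by (simp add: \<zeta>_def)
      have Pz: "poly P (z k) = 0" if "k < m" for k using roots that by auto
      have norm_z: "cmod (z k - \<zeta> k) \<le> \<rho>" if "k < m" for k
        using \<zeta>ball[OF that] by (simp add: dist_norm norm_minus_commute)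
      have Im_z: "\<rho> \<le> \<bar>Im (z k)\<bar>" if "k < m" for k
        using \<rho>Im[OF \<zeta>Z[OF that]] norm_z[OF that] abs_Im_le_cmod[of "z k - \<zeta> k"] by simp
      have w_z: "1 \<le> cmod (w - z k)" "cmod (w - z k) \<le> 2 * T" if "k < m" for k
      proof -
        have "cmod (z k) \<le> cmod (\<zeta> k) + cmod (z k - \<zeta> k)" using norm_triangle_ineq[of "\<zeta> k" "z k - \<zeta> k"] by simp
        hence "cmod (z k) \<le> T - 1" using TZ[OF \<zeta>Z[OF that]] norm_z[OF that] \<rho>(3) by simp
        thus "1 \<le> cmod (w - z k)" "cmod (w - z k) \<le> 2 * T"
          using norm_triangle_ineq2[of w "z k"] norm_triangle_ineq4[of w "z k"] w(2) by auto
      qed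
      define G where "G = (\<Sum>i<n. 1 / (cmod (w - of_real (x i)))\<^sup>2)"
      have "G \<le> C0 * s + real m"
      proof -
        have nz: "poly P w \<noteq> 0" using elim(2) by (simp add: P_def N_def)
        have "poly (pderiv P) w / poly P w = (\<Sum>a\<in>#proots P. 1 / (w - a))"
          unfolding log_derivative_poly(1)[OF nz] by (rule nonzero_mult_div_cancel_left[OF nz])
        also have "\<dots> = (\<Sum>k<m. 1 / (w - z k)) + (\<Sum>i<n. 1 / (w - of_real (x i)))"
          unfolding pr by (simp add: sum_unfold_sum_mset mset_set_upto_eq_mset_upto atLeast0LessThan[symmetric] image_mset.compositionality o_def)
        finally have eq: "(\<Sum>i<n. 1 / (w - of_real (x i))) = poly (pderiv P) w / poly P w - (\<Sum>k<m. 1 / (w - z k))" by simp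
        have "Im (\<Sum>i<n. 1 / (w - of_real (x i))) = (\<Sum>i<n. - Im w * (1 / (cmod (w - of_real (x i)))\<^sup>2))"
          unfolding Im_sum by (intro sum.cong refl Im_inverse_diff_real) auto
        also have "\<dots> = - T * G" unfolding w G_def sum_distrib_left ..
        finally have "T * G = \<bar>Im (\<Sum>i<n. 1 / (w - of_real (x i)))\<bar>"
          using T2 by (simp add: abs_mult G_def sum_nonneg)
        also have "\<dots> \<le> cmod (\<Sum>i<n. 1 / (w - of_real (x i)))" by (rule abs_Im_le_cmod)
        also have "\<dots> \<le> cmod (poly (pderiv P) w / poly P w) + cmod (\<Sum>k<m. 1 / (w - z k))"
          unfolding eq by (rule norm_triangle_ineq4)
        also have "\<dots> \<le> C0 * s + real m"
        proof (rule add_mono)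
          show "cmod (poly (pderiv P) w / poly P w) \<le> C0 * s" using elim(2) by (simp add: P_def N_def s_def)
          have "cmod (\<Sum>k<m. 1 / (w - z k)) \<le> (\<Sum>k<m. 1)"
            by (rule sum_norm_le) (use w_z in \<open>auto simp: norm_divide divide_le_eq_1\<close>)
          thus "cmod (\<Sum>k<m. 1 / (w - z k)) \<le> real m" by simp
        qed
        finally have "T * G \<le> C0 * s + real m" .
        moreover have "1 * G \<le> T * G" using T2 by (intro mult_right_mono) (auto simp: G_def sum_nonneg)
        ultimately show ?thesis by simp
      qed
      have sum_le: "(\<Sum>i<n. 1 / (cmod (of_real (x i) - z k))\<^sup>2) \<le> C * s" if k: "k < m" for k
      proof -
        have "1 / (cmod (of_real (x i) - z k))\<^sup>2 \<le> A\<^sup>2 * (1 / (cmod (w - of_real (x i)))\<^sup>2)" for i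
        proof -
          define d where "d = cmod (of_real (x i) - z k)"
          have "\<bar>Im (of_real (x i) - z k)\<bar> \<le> d" unfolding d_def by (rule abs_Im_le_cmod)
          hence d: "\<rho> \<le> d" using Im_z[OF k] by simp
          have wx: "cmod (w - of_real (x i)) > 0"
            using w(1) T2 by (auto simp: complex_eq_iff)
          have "cmod (w - of_real (x i)) \<le> cmod (w - z k) + d"
            unfolding d_def using norm_triangle_ineq4[of "w - z k" "of_real (x i) - z k"] by simp
          also have "\<dots> \<le> 2 * T + d" using w_z[OF k] by simp
          also have "2 * T = 2 * T / \<rho> * \<rho>" using \<rho>(1) by simp
          also have "2 * T / \<rho> * \<rho> + d \<le> 2 * T / \<rho> * d + d"
            using d \<rho>(1) T2 by (intro add_right_mono mult_left_mono) auto
          finally have "cmod (w - of_real (x i)) \<le> A * d" by (simp add: A_def algebra_simps)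
          hence "(cmod (w - of_real (x i)))\<^sup>2 \<le> (A * d)\<^sup>2" by (intro power_mono) auto
          thus ?thesis using wx d \<rho>(1) unfolding d_def[symmetric] by (simp add: field_simps power_mult_distrib)
        qed
        hence "(\<Sum>i<n. 1 / (cmod (of_real (x i) - z k))\<^sup>2) \<le> A\<^sup>2 * G"
          unfolding G_def sum_distrib_left by (intro sum_mono)
        also have "\<dots> \<le> A\<^sup>2 * (C0 * s + real m)" by (rule mult_left_mono[OF \<open>G \<le> C0 * s + real m\<close>]) simp
        also have "\<dots> \<le> A\<^sup>2 * (C0 * s + real m * s)" using mult_left_mono[of 1 s "real m"] s by (intro mult_left_mono add_left_mono) auto
        also have "\<dots> = A\<^sup>2 * (C0 + real m) * s" by (simp add: algebra_simps)
        also have "\<dots> \<le> C * s" unfolding C_def using s Ca by (intro mult_right_mono) (auto intro: sum_nonneg)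
        finally show ?thesis .
      qed
      have injx: "inj_on x {..<n}"
      proof
        fix i j assume ij: "i \<in> {..<n}" "j \<in> {..<n}" "x i = x j"
        show "i = j"
        proof (rule ccontr)
          assume "i \<noteq> j"
          define t where "t = complex_of_real (x i)"
          have "count (mset (map (\<lambda>i. complex_of_real (x i)) [0..<n])) t \<ge> 2"
          proof -
            have "{i, j} \<subseteq> {l. l < n \<and> complex_of_real (x l) = t}" using ij by (auto simp: t_def)
            hence "card {i, j} \<le> card {l. l < n \<and> complex_of_real (x l) = t}" by (intro card_mono) auto
            also have "\<dots> = count (mset (map (\<lambda>i. complex_of_real (x i)) [0..<n])) t"
              by (rule count_mset_map_upt[symmetric])
            finally show ?thesis using \<open>i \<noteq> j\<close> by simp
          qed
          hence "order t P \<ge> 2" using arg_cong[OF pr, of "\<lambda>M. count M t"] P0 by simp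
          moreover have Pt: "poly P t = 0" using roots ij(1) by (auto simp: t_def)
          moreover have "poly (pderiv P) t \<noteq> 0"
          proof -
            \<comment> \<open>Parts at most \<open>n\<close> and \<open>l < r\<close> give
              \<open>degree_seq lam l < n + r\<close>. A new degree together with the absence of
              real zeros of \<open>H\<close> makes the regular zeros simple.\<close>
            have "N \<notin> set (map (degree_seq lam) [0..<length lam])"
            proof
              assume "N \<in> set (map (degree_seq lam) [0..<length lam])"
              then obtain l where l: "l < length lam" "N = degree_seq lam l" by auto
              have "rev lam ! l \<in> set lam" using l(1) by (metis length_rev nth_mem set_rev)
              hence "rev lam ! l \<le> n" using n_ge by blast
              thus False using l by (simp add: N_def r_lam degree_seq_def)
            qed
            moreover have "poly (wronskian (map hermite (map (degree_seq lam) [0..<length lam]))) t \<noteq> 0"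
              using gen_hermite_no_real_root[of "x i"] by (simp add: Hw fs_def hermite_seq_eq' t_def)
            ultimately show ?thesis
              using wronskian_hermite_snoc_simple_root[of N _ t] Pt
              unfolding P_def fs_def hermite_seq_eq' by blast
          qed
          ultimately show False using order_eq_1I[of P t] by simp
        qed
      qed
      have "near_configuration \<rho> C s H m n z x \<zeta>"
        unfolding near_configuration_def
      proof (intro conjI allI impI)
        show "H \<noteq> 0" by (rule gen_hermite_nonzero)
        have "(\<Prod>a\<in>Z. [:- a, 1:]) = (\<Prod>k<m. [:- \<zeta> k, 1:])"
          using prod.reindex_bij_betw[OF bij\<zeta>, of "\<lambda>a. [:- a, 1:]"] by simp
        with HZ show "H = smult (lead_coeff H) (\<Prod>k<m. [:- \<zeta> k, 1:])" by simp
        show "inj_on x {..<n}" by (rule injx)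
      next
        fix k assume k: "k < m"
        show "2 * \<rho> \<le> \<bar>Im (\<zeta> k)\<bar>" by (rule \<rho>Im[OF \<zeta>Z[OF k]])
        show "cmod (z k - \<zeta> k) \<le> \<rho>" by (rule norm_z[OF k])
        show "z k \<noteq> \<zeta> k" using Pz[OF k] elim(1) \<zeta>Z[OF k] by (auto simp: P_def N_def near_def)
        have "cmod (z k - \<zeta> k) * s \<le> Ca (\<zeta> k)"
          using elim(1) \<zeta>Z[OF k] \<zeta>ball[OF k] Pz[OF k] by (auto simp: P_def N_def s_def near_def)
        also have "\<dots> \<le> C" by (rule Ca_le[OF \<zeta>Z[OF k]])
        finally show "cmod (z k - \<zeta> k) * s \<le> C" .
        show "(\<Sum>i<n. 1 / (cmod (of_real (x i) - z k))\<^sup>2) \<le> C * s" by (rule sum_le[OF k])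
      next
        fix k l assume "k < m" "l < m" "k \<noteq> l"
        thus "4 * \<rho> \<le> cmod (\<zeta> k - \<zeta> l)"
          using bij\<zeta> \<zeta>Z by (intro \<rho>dist) (auto simp: bij_betw_def inj_on_def)
      qed
      thus "\<exists>\<zeta>. near_configuration \<rho> C (hscale (n + r)) H m n z x \<zeta>"
        unfolding s_def N_def by blast
    qed
  qed
  thus ?thesis using \<rho>(1) C_ge unfolding m_def r_lam by blast
qed

end

section \<open>The Hessian of the energy\<close>

text \<open>All positions as complex numbers, the exceptional ones below \<open>m\<close> and the
  regular ones from \<open>m\<close> on: for \<open>p = m + i\<close> the index \<open>m + p\<close>
  is \<open>2 * m + i\<close>. With \<open>coord_index\<close> and \<open>coord_dir\<close>, the
  coordinate \<open>j\<close> moves one position in the direction \<open>1\<close> or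
  \<open>\<i>\<close>.\<close>

definition position :: "nat \<Rightarrow> (nat \<Rightarrow> real) \<Rightarrow> nat \<Rightarrow> complex" where
  "position m v p = (if p < m then Complex (v (2 * p)) (v (2 * p + 1)) else of_real (v (m + p)))"

definition coord_index :: "nat \<Rightarrow> nat \<Rightarrow> nat" where
  "coord_index m j = (if j < 2 * m then j div 2 else j - m)"

definition coord_dir :: "nat \<Rightarrow> nat \<Rightarrow> complex" where
  "coord_dir m j = (if j < 2 * m \<and> odd j then \<i> else 1)"

lemma position_upd:
  "position m (v(j := t)) = (position m v)(coord_index m j :=
     position m v (coord_index m j) + of_real (t - v j) * coord_dir m j)"
proof
  fix p
  show "position m (v(j := t)) p = ((position m v)(coord_index m j :=
     position m v (coord_index m j) + of_real (t - v j) * coord_dir m j)) p"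
  proof (cases "j < 2 * m")
    case True
    show ?thesis
    proof (cases "even j")
      case even: True
      then obtain k where k: "j = 2 * k" by (elim evenE)
      have "k < m" using True k by simp
      moreover have "2 * p + 1 \<noteq> 2 * k" by presburger
      ultimately show ?thesis unfolding k
        by (auto simp: position_def coord_index_def coord_dir_def complex_eq_iff)
    next
      case False
      then obtain k where k: "j = 2 * k + 1" by (elim oddE)
      have "k < m" using True k by simp
      moreover have "2 * p \<noteq> 2 * k + 1" by presburger
      ultimately show ?thesis unfolding k
        by (auto simp: position_def coord_index_def coord_dir_def complex_eq_iff)
    qed
  next
    case False
    hence "j = m + (j - m)" "j - m \<ge> m" by auto
    thus ?thesis using False
      by (auto simp: position_def coord_index_def coord_dir_def complex_eq_iff)
  qed
qed

lemma sum_lessThan_add: "(\<Sum>q<a + b. g q) = (\<Sum>q<a. g q) + (\<Sum>i<b. g (a + i) :: 'a::comm_monoid_add)" for a b :: nat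
  by (induction b) (simp_all add: add.assoc)

lemma sum_lessThan_double: "(\<Sum>j<2 * a. g j) = (\<Sum>k<a. g (2 * k) + g (2 * k + 1) :: 'a::comm_monoid_add)" for a :: nat
  by (induction a) (simp_all add: add.assoc)

text \<open>Turns the action of the real Hessian on a real vector \<open>c\<close> into that of a
  complex matrix on the complex vector \<open>position m c\<close>.\<close>

lemma sum_coord:
  "(\<Sum>j<2 * m + n. of_real (c j) * coord_dir m j * g (coord_index m j)) = (\<Sum>q<m + n. position m c q * g q)"
proof -
  have "(\<Sum>j<2 * m + n. of_real (c j) * coord_dir m j * g (coord_index m j)) =
    (\<Sum>k<m. of_real (c (2 * k)) * g k + of_real (c (2 * k + 1)) * \<i> * g k) + (\<Sum>i<n. of_real (c (2 * m + i)) * g (m + i))"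
    unfolding sum_lessThan_add sum_lessThan_double
    by (intro arg_cong2[of _ _ _ _ "(+)"] sum.cong refl) (auto simp: coord_index_def coord_dir_def)
  also have "(\<Sum>k<m. of_real (c (2 * k)) * g k + of_real (c (2 * k + 1)) * \<i> * g k) = (\<Sum>k<m. position m c k * g k)"
  proof (intro sum.cong refl)
    fix k assume "k \<in> {..<m}"
    hence "position m c k = of_real (c (2 * k)) + of_real (c (2 * k + 1)) * \<i>"
      by (simp add: position_def complex_eq_iff)
    thus "of_real (c (2 * k)) * g k + of_real (c (2 * k + 1)) * \<i> * g k = position m c k * g k"
      by (simp only: distrib_right)
  qed
  also have "(\<Sum>i<n. of_real (c (2 * m + i)) * g (m + i)) = (\<Sum>i<n. position m c (m + i) * g (m + i))"
    by (intro sum.cong refl) (simp add: position_def mult_2 add.assoc)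
  finally show ?thesis by (simp add: sum_lessThan_add)
qed

lemma DERIV_ln_cmod_line:
  fixes z d :: complex and t0 :: real
  assumes "z \<noteq> 0"
  shows "((\<lambda>t. ln ((cmod (z + of_real (t - t0) * d))\<^sup>2)) has_real_derivative 2 * Re (d / z)) (at t0)"
proof -
  have pos: "(Re z)\<^sup>2 + (Im z)\<^sup>2 > 0" using assms by (simp add: complex_neq_0)
  have "((\<lambda>t. (Re z + (t - t0) * Re d)\<^sup>2 + (Im z + (t - t0) * Im d)\<^sup>2) has_real_derivative
     2 * (Re z * Re d + Im z * Im d)) (at t0)"
    by (auto intro!: derivative_eq_intros simp: algebra_simps)
  hence "((\<lambda>t. ln ((Re z + (t - t0) * Re d)\<^sup>2 + (Im z + (t - t0) * Im d)\<^sup>2)) has_real_derivative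
     1 / ((Re z + (t0 - t0) * Re d)\<^sup>2 + (Im z + (t0 - t0) * Im d)\<^sup>2) * (2 * (Re z * Re d + Im z * Im d))) (at t0)"
    by (intro DERIV_chain2[of ln]) (use pos in \<open>auto intro!: DERIV_ln_divide\<close>)
  moreover have "1 / ((Re z + (t0 - t0) * Re d)\<^sup>2 + (Im z + (t0 - t0) * Im d)\<^sup>2) * (2 * (Re z * Re d + Im z * Im d)) = 2 * Re (d / z)"
    using pos by (simp add: Re_divide field_simps)
  moreover have "(cmod (z + of_real (t - t0) * d))\<^sup>2 = (Re z + (t - t0) * Re d)\<^sup>2 + (Im z + (t - t0) * Im d)\<^sup>2" for t
    by (simp add: cmod_power2)
  ultimately show ?thesis by simp
qed

lemma Re_mult_sum_inverse: "Re (d * (\<Sum>k\<in>A. 1 / g k)) = (\<Sum>k\<in>A. Re (d / g k))"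
  unfolding sum_distrib_left Re_sum by (simp only: times_divide_eq_right mult_1_right)

lemma eventually_line_neq:
  fixes z d a :: complex and t0 :: real
  assumes "z \<noteq> a"
  shows "\<forall>\<^sub>F t in nhds t0. z + of_real (t - t0) * d \<noteq> a"
proof -
  have "((\<lambda>t. z + of_real (t - t0) * d) \<longlongrightarrow> z + of_real (t0 - t0) * d) (nhds t0)"
    by (intro tendsto_intros) (simp add: filterlim_def)
  moreover have "z + of_real (t0 - t0) * d \<noteq> a" using assms by simp
  ultimately show ?thesis by (rule tendsto_imp_eventually_ne)
qed

lemma coord_index_less: "j < 2 * m + n \<Longrightarrow> coord_index m j < m + n"
  by (auto simp: coord_index_def)

section \<open>The energy as the real part of a holomorphic function\<close>

definition admissible :: "nat \<Rightarrow> nat \<Rightarrow> (nat \<Rightarrow> complex) \<Rightarrow> (nat \<Rightarrow> complex) \<Rightarrow> bool" where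
  "admissible m n \<zeta> u \<longleftrightarrow> (\<forall>p<m + n. \<forall>k<m. u p \<noteq> \<zeta> k) \<and> (\<forall>p<m + n. \<forall>q<m + n. p \<noteq> q \<longrightarrow> u p \<noteq> u q)"

text \<open>Exceptional and regular positions enter alike, so the five sums of \<open>energy\<close>
  collapse to two.\<close>

definition particle_energy :: "complex poly \<Rightarrow> nat \<Rightarrow> nat \<Rightarrow> (nat \<Rightarrow> complex) \<Rightarrow> real" where
  "particle_energy H m n u = (\<Sum>p<m + n. ln (weight H (u p))) + (\<Sum>q<m + n. \<Sum>p<q. ln ((cmod (u p - u q))\<^sup>2))"

text \<open>
  The energy is locally the real part of a holomorphic function of all positions;
  \<open>energy_grad\<close> and \<open>energy_hess\<close> are its complex first and second derivatives. The summand with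
  \<open>q = p\<close> in \<open>energy_hess\<close> is \<open>1 / 0 = 0\<close>.
\<close>

definition energy_grad :: "nat \<Rightarrow> nat \<Rightarrow> (nat \<Rightarrow> complex) \<Rightarrow> (nat \<Rightarrow> complex) \<Rightarrow> nat \<Rightarrow> complex" where
  "energy_grad m n \<zeta> u p = - 2 * u p - 2 * (\<Sum>k<m. 1 / (u p - \<zeta> k)) + 2 * (\<Sum>q<m + n. if q = p then 0 else 1 / (u p - u q))"

definition energy_hess :: "nat \<Rightarrow> nat \<Rightarrow> (nat \<Rightarrow> complex) \<Rightarrow> (nat \<Rightarrow> complex) \<Rightarrow> nat \<Rightarrow> nat \<Rightarrow> complex" where
  "energy_hess m n \<zeta> u p q = (if p = q then - 2 + 2 * (\<Sum>k<m. 1 / (u p - \<zeta> k)\<^sup>2) - 2 * (\<Sum>q<m + n. 1 / (u p - u q)\<^sup>2)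
     else 2 / (u p - u q)\<^sup>2)"

context
  fixes H :: "complex poly" and m n :: nat and \<zeta> :: "nat \<Rightarrow> complex"
  assumes H0: "H \<noteq> 0" and H: "H = smult (lead_coeff H) (\<Prod>k<m. [:- \<zeta> k, 1:])"
begin

lemma energy_eq: "energy H m n v = particle_energy H m n (position m v)"
proof -
  define u where "u = position m v"
  have uz: "Complex (v (2 * k)) (v (2 * k + 1)) = u k" if "k < m" for k using that by (simp add: u_def position_def)
  have ux: "complex_of_real (v (2 * m + i)) = u (m + i)" for i by (simp add: u_def position_def mult_2 add.assoc)
  have ux': "\<bar>v (2 * m + i) - v (2 * m + j)\<bar> = cmod (u (m + i) - u (m + j))" for i j
    by (metis norm_of_real of_real_diff real_norm_def ux)
  have "energy H m n v = (\<Sum>k<m. ln (weight H (u k))) + (\<Sum>i<n. ln (weight H (u (m + i)))) +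
        (\<Sum>l<m. \<Sum>k<l. ln ((cmod (u k - u l))\<^sup>2)) +
        (\<Sum>j<n. \<Sum>i<j. ln ((cmod (u (m + i) - u (m + j)))\<^sup>2)) +
        (\<Sum>k<m. \<Sum>i<n. ln ((cmod (u (m + i) - u k))\<^sup>2))"
    unfolding energy_def Let_def ux ux'
    by (intro arg_cong2[of _ _ _ _ "(+)"] sum.cong refl) (simp_all add: uz[unfolded Suc_eq_plus1[symmetric]])
  also have "(\<Sum>k<m. \<Sum>i<n. ln ((cmod (u (m + i) - u k))\<^sup>2)) = (\<Sum>i<n. \<Sum>k<m. ln ((cmod (u k - u (m + i)))\<^sup>2))"
    by (subst sum.swap) (simp add: norm_minus_commute)
  finally show ?thesis
    by (simp add: particle_energy_def u_def[symmetric] sum_lessThan_add sum.distrib)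
qed

text \<open>In this form the zeros of \<open>H\<close> act as fixed particles of the opposite sign.
  A particle close to one of them thus acquires the large second derivative
  \<open>2 / (z - \<zeta> k)\<^sup>2\<close>.\<close>

lemma ln_weight:
  assumes "\<And>k. k < m \<Longrightarrow> z \<noteq> \<zeta> k"
  shows "ln (weight H z) = - Re (z\<^sup>2) - ln ((cmod (lead_coeff H))\<^sup>2) - (\<Sum>k<m. ln ((cmod (z - \<zeta> k))\<^sup>2))"
proof -
  define l where "l = lead_coeff H"
  have l: "l \<noteq> 0" using H0 by (simp add: l_def)
  have "poly H z = l * (\<Prod>k<m. z - \<zeta> k)" by (subst H) (simp add: poly_prod l_def)
  hence "(cmod (poly H z))\<^sup>2 = (cmod l)\<^sup>2 * (\<Prod>k<m. (cmod (z - \<zeta> k))\<^sup>2)"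
    by (simp add: norm_mult prod_norm[symmetric] power_mult_distrib prod_power_distrib)
  hence "ln (weight H z) = ln (exp (- Re (z\<^sup>2)) / ((cmod l)\<^sup>2 * (\<Prod>k<m. (cmod (z - \<zeta> k))\<^sup>2)))"
    by (simp add: weight_def)
  also have "\<dots> = - Re (z\<^sup>2) - (ln ((cmod l)\<^sup>2) + ln (\<Prod>k<m. (cmod (z - \<zeta> k))\<^sup>2))"
  proof -
    have "ln (exp a / (b * c)) = a - (ln b + ln c)" if "b > 0" "c > 0" for a b c :: real
      using that by (simp add: ln_div ln_mult)
    moreover have "(\<Prod>k<m. (cmod (z - \<zeta> k))\<^sup>2) > 0" using assms by (intro prod_pos) auto
    moreover have "(cmod l)\<^sup>2 > 0" using l by simp
    ultimately show ?thesis by blast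
  qed
  also have "ln (\<Prod>k<m. (cmod (z - \<zeta> k))\<^sup>2) = (\<Sum>k<m. ln ((cmod (z - \<zeta> k))\<^sup>2))"
    using assms by (intro ln_prod) auto
  finally show ?thesis by (simp add: l_def)
qed

lemma DERIV_ln_weight_line:
  assumes "\<And>k. k < m \<Longrightarrow> z \<noteq> \<zeta> k"
  shows "((\<lambda>t. ln (weight H (z + of_real (t - t0) * d))) has_real_derivative
    Re (d * (- 2 * z - 2 * (\<Sum>k<m. 1 / (z - \<zeta> k))))) (at t0)"
proof -
  define g where "g = (\<lambda>t. - Re ((z + of_real (t - t0) * d)\<^sup>2) - ln ((cmod (lead_coeff H))\<^sup>2)
     - (\<Sum>k<m. ln ((cmod ((z - \<zeta> k) + of_real (t - t0) * d))\<^sup>2)))"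
  have "\<forall>\<^sub>F t in nhds t0. \<forall>k\<in>{..<m}. z + of_real (t - t0) * d \<noteq> \<zeta> k"
    using assms by (intro eventually_ball_finite ballI eventually_line_neq) auto
  hence ev: "\<forall>\<^sub>F t in nhds t0. ln (weight H (z + of_real (t - t0) * d)) = g t"
  proof eventually_elim
    case (elim t)
    show ?case using elim by (subst ln_weight) (auto simp: g_def algebra_simps)
  qed
  have sq: "Re ((z + of_real (t - t0) * d)\<^sup>2) = (Re z + (t - t0) * Re d)\<^sup>2 - (Im z + (t - t0) * Im d)\<^sup>2" for t
    by (simp add: power2_eq_square)
  have "((\<lambda>t. Re ((z + of_real (t - t0) * d)\<^sup>2)) has_real_derivative 2 * Re (d * z)) (at t0)"
    unfolding sq by (auto intro!: derivative_eq_intros simp: algebra_simps)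
  moreover have "((\<lambda>t. \<Sum>k<m. ln ((cmod ((z - \<zeta> k) + of_real (t - t0) * d))\<^sup>2)) has_real_derivative (\<Sum>k<m. 2 * Re (d / (z - \<zeta> k)))) (at t0)"
    using assms by (intro DERIV_sum DERIV_ln_cmod_line) auto
  ultimately have "(g has_real_derivative - (2 * Re (d * z)) - 0 - (\<Sum>k<m. 2 * Re (d / (z - \<zeta> k)))) (at t0)"
    unfolding g_def by (intro DERIV_diff DERIV_minus DERIV_const)
  moreover have "- (2 * Re (d * z)) - 0 - (\<Sum>k<m. 2 * Re (d / (z - \<zeta> k))) = Re (d * (- 2 * z - 2 * (\<Sum>k<m. 1 / (z - \<zeta> k))))"
  proof -
    define S where "S = (\<Sum>k<m. 1 / (z - \<zeta> k))"
    have "Re (d * (- 2 * z - 2 * S)) = - (2 * Re (d * z)) - 2 * Re (d * S)"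
      by (simp add: algebra_simps)
    moreover have "(\<Sum>k<m. 2 * Re (d / (z - \<zeta> k))) = 2 * Re (d * S)"
      unfolding S_def Re_mult_sum_inverse by (simp only: sum_distrib_left)
    ultimately show ?thesis unfolding S_def by linarith
  qed
  ultimately show ?thesis using DERIV_cong_ev[OF refl ev refl] by simp
qed

lemma sum_pairs_delta:
  fixes a :: "nat \<Rightarrow> real"
  assumes "p0 < M"
  shows "(\<Sum>q<M. \<Sum>p<q. if p = p0 then a q else if q = p0 then a p else 0) = (\<Sum>q<M. if q = p0 then 0 else a q)"
  using assms
proof (induction M)
  case (Suc M)
  show ?case
  proof (cases "p0 = M")
    case True
    have "(\<Sum>q<M. \<Sum>p<q. if p = p0 then a q else if q = p0 then a p else 0) = 0"
      using True by (intro sum.neutral ballI) auto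
    moreover have "(\<Sum>p<M. if p = p0 then a M else if M = p0 then a p else 0) = (\<Sum>p<M. if p = p0 then 0 else a p)"
      using True by (intro sum.cong) auto
    ultimately show ?thesis using True by simp
  next
    case False
    hence p0: "p0 < M" using Suc.prems by simp
    have "(\<Sum>p<M. if p = p0 then a M else if M = p0 then a p else 0) = (\<Sum>p<M. if p = p0 then a M else 0)"
      using False by (intro sum.cong) auto
    also have "\<dots> = a M" using p0 by simp
    finally show ?thesis using Suc.IH[OF p0] False by simp
  qed
qed simp

lemma DERIV_particle_energy:
  assumes adm: "admissible m n \<zeta> u" and p0: "p0 < m + n"
  shows "((\<lambda>t. particle_energy H m n (u(p0 := u p0 + of_real (t - t0) * d))) has_real_derivative Re (d * energy_grad m n \<zeta> u p0)) (at t0)"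
proof -
  define U where "U = (\<lambda>t. u(p0 := u p0 + of_real (t - t0) * d))"
  have w: "((\<lambda>t. ln (weight H (U t p))) has_real_derivative
     (if p = p0 then Re (d * (- 2 * u p0 - 2 * (\<Sum>k<m. 1 / (u p0 - \<zeta> k)))) else 0)) (at t0)" if "p < m + n" for p
  proof (cases "p = p0")
    case True
    thus ?thesis using DERIV_ln_weight_line[of "u p0" t0 d] adm p0 by (simp add: U_def admissible_def)
  qed (simp add: U_def)
  define a where "a = (\<lambda>q. 2 * Re (d / (u p0 - u q)))"
  have i: "((\<lambda>t. ln ((cmod (U t p - U t q))\<^sup>2)) has_real_derivative (if p = p0 then a q else if q = p0 then a p else 0)) (at t0)"
    if pq: "p < q" "q < m + n" for p q
  proof -
    have ne: "u p \<noteq> u q" using adm pq by (auto simp: admissible_def)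
    consider "p = p0" "q \<noteq> p0" | "p \<noteq> p0" "q = p0" | "p \<noteq> p0" "q \<noteq> p0" using pq by blast
    thus ?thesis
    proof cases
      case 1
      thus ?thesis using DERIV_ln_cmod_line[of "u p0 - u q" t0 d] ne by (simp add: U_def a_def algebra_simps)
    next
      case 2
      have "((\<lambda>t. ln ((cmod (u p0 - u p + of_real (t - t0) * d))\<^sup>2)) has_real_derivative a p) (at t0)"
        using DERIV_ln_cmod_line[of "u p0 - u p" t0 d] ne 2 by (simp add: a_def)
      moreover have "cmod (U t p - U t q) = cmod (u p0 - u p + of_real (t - t0) * d)" for t
      proof -
        have "u p0 - u p + of_real (t - t0) * d = - (U t p - U t q)" using 2 by (simp add: U_def)
        thus ?thesis by (simp only: norm_minus_cancel)
      qed
      ultimately show ?thesis using 2 by simp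
    next
      case 3
      thus ?thesis by (simp add: U_def)
    qed
  qed
  have "((\<lambda>t. particle_energy H m n (U t)) has_real_derivative
     (\<Sum>p<m + n. if p = p0 then Re (d * (- 2 * u p0 - 2 * (\<Sum>k<m. 1 / (u p0 - \<zeta> k)))) else 0) +
     (\<Sum>q<m + n. \<Sum>p<q. if p = p0 then a q else if q = p0 then a p else 0)) (at t0)"
    unfolding particle_energy_def using w i by (intro DERIV_add DERIV_sum) auto
  also have "(\<Sum>q<m + n. \<Sum>p<q. if p = p0 then a q else if q = p0 then a p else 0) = (\<Sum>q<m + n. if q = p0 then 0 else a q)"
    by (rule sum_pairs_delta[OF p0])
  also have "\<dots> = Re (d * (2 * (\<Sum>q<m + n. if q = p0 then 0 else 1 / (u p0 - u q))))"
  proof -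
    have "Re (d * (2 * (1 / w))) = 2 * Re (d / w)" for w
    proof -
      have "d * (2 * (1 / w)) = of_real 2 * (d / w)" by simp
      thus ?thesis by (simp only: times_complex.sel Re_complex_of_real Im_complex_of_real mult_zero_left diff_0_right)
    qed
    hence "(if q = p0 then 0 else a q) = Re (d * (2 * (if q = p0 then 0 else 1 / (u p0 - u q))))" for q
      unfolding a_def by (cases "q = p0") (simp_all only: if_True if_False simp_thms mult_zero_right zero_complex.sel)
    thus ?thesis unfolding sum_distrib_left Re_sum by (intro sum.cong refl)
  qed
  also have "(\<Sum>p<m + n. if p = p0 then Re (d * (- 2 * u p0 - 2 * (\<Sum>k<m. 1 / (u p0 - \<zeta> k)))) else 0) =
     Re (d * (- 2 * u p0 - 2 * (\<Sum>k<m. 1 / (u p0 - \<zeta> k))))" using p0 by simp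
  finally show ?thesis unfolding U_def energy_grad_def
    by (simp only: distrib_left plus_complex.sel)
qed

lemma energy_grad_line:
  assumes adm: "admissible m n \<zeta> u" and p0: "p0 < m + n" and q0: "q0 < m + n"
  shows "((\<lambda>\<tau>. energy_grad m n \<zeta> (u(p0 := u p0 + \<tau> * d)) q0) has_field_derivative d * energy_hess m n \<zeta> u q0 p0) (at 0)"
proof (cases "q0 = p0")
  case True
  have ne: "u p0 - \<zeta> k \<noteq> 0" if "k < m" for k using adm p0 that by (auto simp: admissible_def)
  have ne': "u p0 - u q \<noteq> 0" if "q < m + n" "q \<noteq> p0" for q using adm p0 that by (auto simp: admissible_def)
  have inv: "((\<lambda>\<tau>. 1 / (u p0 + \<tau> * d - a)) has_field_derivative - d * (1 / (u p0 - a)\<^sup>2)) (at 0)" if "u p0 - a \<noteq> 0" for a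
    using that by (auto intro!: derivative_eq_intros simp: power2_eq_square)
  have "((\<lambda>\<tau>. - 2 * (u p0 + \<tau> * d) - 2 * (\<Sum>k<m. 1 / (u p0 + \<tau> * d - \<zeta> k)) +
      2 * (\<Sum>q<m + n. if q = p0 then 0 else 1 / (u p0 + \<tau> * d - u q))) has_field_derivative
     - 2 * d - 2 * (\<Sum>k<m. - d * (1 / (u p0 - \<zeta> k)\<^sup>2)) + 2 * (\<Sum>q<m + n. - d * (1 / (u p0 - u q)\<^sup>2))) (at 0)"
  proof (intro DERIV_add DERIV_diff DERIV_cmult DERIV_sum inv ne)
    show "((\<lambda>\<tau>. u p0 + \<tau> * d) has_field_derivative d) (at 0)" by (auto intro!: derivative_eq_intros)
    fix q assume "q \<in> {..<m + n}"
    thus "((\<lambda>\<tau>. if q = p0 then 0 else 1 / (u p0 + \<tau> * d - u q)) has_field_derivative - d * (1 / (u p0 - u q)\<^sup>2)) (at 0)"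
      using inv[of "u q"] ne'[of q] by (cases "q = p0") auto
  qed auto
  moreover have "energy_grad m n \<zeta> (u(p0 := u p0 + \<tau> * d)) q0 = - 2 * (u p0 + \<tau> * d) - 2 * (\<Sum>k<m. 1 / (u p0 + \<tau> * d - \<zeta> k)) +
      2 * (\<Sum>q<m + n. if q = p0 then 0 else 1 / (u p0 + \<tau> * d - u q))" for \<tau>
    unfolding energy_grad_def True fun_upd_same
    by (intro arg_cong2[of _ _ _ _ "(+)"] arg_cong2[of _ _ _ _ "(*)"] sum.cong refl) simp
  moreover have "- 2 * d - 2 * (\<Sum>k<m. - d * (1 / (u p0 - \<zeta> k)\<^sup>2)) + 2 * (\<Sum>q<m + n. - d * (1 / (u p0 - u q)\<^sup>2)) =
     d * energy_hess m n \<zeta> u q0 p0"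
    unfolding energy_hess_def True sum_distrib_left[symmetric] if_P[OF refl] by (simp only: distrib_left right_diff_distrib) simp
  ultimately show ?thesis by simp
next
  case False
  have ne: "u q0 - u p0 \<noteq> 0" using adm p0 q0 False by (auto simp: admissible_def)
  define c where "c = - 2 * u q0 - 2 * (\<Sum>k<m. 1 / (u q0 - \<zeta> k)) + 2 * (\<Sum>q\<in>{..<m + n} - {p0}. if q = q0 then 0 else 1 / (u q0 - u q))"
  have "energy_grad m n \<zeta> (u(p0 := u p0 + \<tau> * d)) q0 = c + 2 * (1 / (u q0 - (u p0 + \<tau> * d)))" for \<tau>
  proof -
    have "(\<Sum>q<m + n. if q = q0 then 0 else 1 / (u q0 - (u(p0 := u p0 + \<tau> * d)) q)) =
       1 / (u q0 - (u p0 + \<tau> * d)) + (\<Sum>q\<in>{..<m + n} - {p0}. if q = q0 then 0 else 1 / (u q0 - u q))"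
    proof -
      define h where "h = (\<lambda>q. if q = q0 then 0 else 1 / (u q0 - (u(p0 := u p0 + \<tau> * d)) q))"
      have "(\<Sum>q<m + n. h q) = h p0 + (\<Sum>q\<in>{..<m + n} - {p0}. h q)"
        by (rule sum.remove) (use p0 in auto)
      also have "(\<Sum>q\<in>{..<m + n} - {p0}. h q) = (\<Sum>q\<in>{..<m + n} - {p0}. if q = q0 then 0 else 1 / (u q0 - u q))"
        by (rule sum.cong) (auto simp: h_def)
      also have "h p0 = 1 / (u q0 - (u p0 + \<tau> * d))" using False by (simp add: h_def)
      finally show ?thesis by (simp only: h_def)
    qed
    moreover have "(u(p0 := u p0 + \<tau> * d)) q0 = u q0" using False by simp
    ultimately show ?thesis unfolding energy_grad_def c_def by (simp only: distrib_left ac_simps)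
  qed
  moreover have "((\<lambda>\<tau>. c + 2 * (1 / (u q0 - (u p0 + \<tau> * d)))) has_field_derivative d * (2 / (u q0 - u p0)\<^sup>2)) (at 0)"
    using ne by (auto intro!: derivative_eq_intros simp: power2_eq_square)
  ultimately show ?thesis using False by (simp add: energy_hess_def)
qed

lemma DERIV_energy_grad:
  assumes adm: "admissible m n \<zeta> u" and p0: "p0 < m + n" and q0: "q0 < m + n"
  shows "((\<lambda>t. Re (e * energy_grad m n \<zeta> (u(p0 := u p0 + of_real (t - t0) * d)) q0)) has_real_derivative
     Re (e * (d * energy_hess m n \<zeta> u q0 p0))) (at t0)"
proof -
  have "((\<lambda>\<tau>. e * energy_grad m n \<zeta> (u(p0 := u p0 + (\<tau> - of_real t0) * d)) q0) has_field_derivative e * (d * energy_hess m n \<zeta> u q0 p0 * 1)) (at (of_real t0))"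
    by (intro DERIV_cmult DERIV_chain2[where g = "\<lambda>\<tau>. \<tau> - of_real t0" and f = "\<lambda>\<tau>. energy_grad m n \<zeta> (u(p0 := u p0 + \<tau> * d)) q0"])
       (auto intro!: derivative_eq_intros energy_grad_line[OF adm p0 q0])
  hence "((\<lambda>t. e * energy_grad m n \<zeta> (u(p0 := u p0 + (of_real t - of_real t0) * d)) q0) has_vector_derivative e * (d * energy_hess m n \<zeta> u q0 p0 * 1)) (at t0)"
    by (rule has_vector_derivative_real_field)
  hence "((\<lambda>t. Re (e * energy_grad m n \<zeta> (u(p0 := u p0 + (of_real t - of_real t0) * d)) q0)) has_field_derivative Re (e * (d * energy_hess m n \<zeta> u q0 p0 * 1))) (at t0)"
    by (rule has_field_derivative_Re)
  thus ?thesis by simp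
qed

lemma partial_energy:
  assumes "admissible m n \<zeta> (position m v)" "j < 2 * m + n"
  shows "partial j (energy H m n) v = Re (coord_dir m j * energy_grad m n \<zeta> (position m v) (coord_index m j))"
  unfolding partial_def energy_eq position_upd
  by (intro DERIV_imp_deriv DERIV_particle_energy assms coord_index_less)

text \<open>The formula for the first partial derivatives holds at admissible points, and a second
  derivative needs it in a whole neighbourhood.\<close>

lemma admissible_eventually:
  assumes adm: "admissible m n \<zeta> u"
  shows "\<forall>\<^sub>F t in nhds t0. admissible m n \<zeta> (u(p0 := u p0 + of_real (t - t0) * d))"
proof -
  have 1: "\<forall>\<^sub>F t in nhds t0. \<forall>p\<in>{..<m + n}. \<forall>k\<in>{..<m}. (u(p0 := u p0 + of_real (t - t0) * d)) p \<noteq> \<zeta> k"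
  proof (intro eventually_ball_finite ballI)
    fix p k assume "p \<in> {..<m + n}" "k \<in> {..<m}"
    hence "u p \<noteq> \<zeta> k" using adm by (auto simp: admissible_def)
    thus "\<forall>\<^sub>F t in nhds t0. (u(p0 := u p0 + of_real (t - t0) * d)) p \<noteq> \<zeta> k"
      using eventually_line_neq[of "u p0" "\<zeta> k" t0 d] by (cases "p = p0") simp_all
  qed auto
  have 2: "\<forall>\<^sub>F t in nhds t0. \<forall>q\<in>{..<m + n} - {p0}. u p0 + of_real (t - t0) * d \<noteq> u q" if "p0 < m + n"
  proof (intro eventually_ball_finite ballI eventually_line_neq)
    fix q assume "q \<in> {..<m + n} - {p0}"
    thus "u p0 \<noteq> u q" using adm that by (auto simp: admissible_def)
  qed auto
  show ?thesis
  proof (cases "p0 < m + n")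
    case True
    show ?thesis using 1 2[OF True]
    proof eventually_elim
      case (elim t)
      have "(u(p0 := u p0 + of_real (t - t0) * d)) p \<noteq> (u(p0 := u p0 + of_real (t - t0) * d)) q"
        if "p < m + n" "q < m + n" "p \<noteq> q" for p q
        using elim(2) that adm by (cases "p = p0"; cases "q = p0") (force simp: admissible_def)+
      thus ?case using elim(1) unfolding admissible_def by blast
    qed
  next
    case False
    hence "admissible m n \<zeta> (u(p0 := u p0 + of_real (t - t0) * d))" for t
      using adm by (auto simp: admissible_def)
    thus ?thesis by simp
  qed
qed

text \<open>For a holomorphic \<open>F\<close>, differentiating \<open>Re F\<close> in the complex
  directions \<open>d\<close> and \<open>e\<close> gives \<open>Re (d * e * F'')\<close>;
  \<open>coord_dir\<close> supplies the directions.\<close>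

lemma hessian_energy:
  assumes adm: "admissible m n \<zeta> (position m v)"
  shows "hessian (2 * m + n) (energy H m n) v = Matrix.mat (2 * m + n) (2 * m + n) (\<lambda>(i, j).
     Re (coord_dir m j * (coord_dir m i * energy_hess m n \<zeta> (position m v) (coord_index m j) (coord_index m i))))"
proof -
  have "partial i (partial j (energy H m n)) v =
     Re (coord_dir m j * (coord_dir m i * energy_hess m n \<zeta> (position m v) (coord_index m j) (coord_index m i)))"
    if i: "i < 2 * m + n" and j: "j < 2 * m + n" for i j
    unfolding partial_def[of i]
  proof (rule DERIV_imp_deriv)
    define u where "u = position m v"
    define U where "U = (\<lambda>t. u(coord_index m i := u (coord_index m i) + of_real (t - v i) * coord_dir m i))"
    have "\<forall>\<^sub>F t in nhds (v i). partial j (energy H m n) (v(i := t)) = Re (coord_dir m j * energy_grad m n \<zeta> (U t) (coord_index m j))"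
      using admissible_eventually[OF adm, of "coord_index m i" "v i" "coord_dir m i"]
    proof eventually_elim
      case (elim t)
      have "position m (v(i := t)) = U t" unfolding U_def u_def position_upd ..
      moreover have "admissible m n \<zeta> (U t)" using elim by (simp add: U_def u_def)
      ultimately show ?case using partial_energy[of "v(i := t)" j] j by simp
    qed
    moreover have "((\<lambda>t. Re (coord_dir m j * energy_grad m n \<zeta> (U t) (coord_index m j))) has_real_derivative
       Re (coord_dir m j * (coord_dir m i * energy_hess m n \<zeta> u (coord_index m j) (coord_index m i)))) (at (v i))"
      unfolding U_def u_def by (intro DERIV_energy_grad adm coord_index_less i j)
    ultimately show "((\<lambda>t. partial j (energy H m n) (v(i := t))) has_real_derivative
       Re (coord_dir m j * (coord_dir m i * energy_hess m n \<zeta> (position m v) (coord_index m j) (coord_index m i)))) (at (v i))"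
      unfolding u_def by (subst DERIV_cong_ev[OF refl _ refl])
  qed
  thus ?thesis unfolding hessian_def by (intro eq_matI) auto
qed

end

lemma position_point_of:
  "position m (point_of m z x) p = (if p < m then z p else of_real (x (p - m)))"
  by (auto simp: position_def point_of_def)

section \<open>The kernel of the Hessian\<close>

text \<open>Symmetrising in \<open>i\<close> and \<open>j\<close> turns twice the sum into minus the
  sum of all \<open>g i j * (y i - y j)\<^sup>2\<close>.\<close>

lemma sum_laplacian_nonpos:
  fixes y :: "nat \<Rightarrow> real" and g :: "nat \<Rightarrow> nat \<Rightarrow> real"
  assumes "\<And>i j. g i j = g j i" "\<And>i j. g i j \<ge> 0"
  shows "(\<Sum>i<n. \<Sum>j<n. g i j * (y i * y j - y i * y i)) \<le> 0"
proof -
  define S where "S = (\<Sum>i<n. \<Sum>j<n. g i j * (y i * y j - y i * y i))"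
  have "S = (\<Sum>i<n. \<Sum>j<n. g j i * (y j * y i - y j * y j))" unfolding S_def by (rule sum.swap)
  hence "2 * S = (\<Sum>i<n. \<Sum>j<n. g i j * (y i * y j - y i * y i) + g j i * (y j * y i - y j * y j))"
    unfolding sum.distrib by (simp add: S_def)
  also have "\<dots> = (\<Sum>i<n. \<Sum>j<n. - (g i j * (y i - y j)\<^sup>2))"
    by (intro sum.cong refl) (simp add: assms(1)[of _ "_ :: nat"] power2_eq_square algebra_simps)
  also have "\<dots> \<le> 0" using assms(2) by (intro sum_nonpos) auto
  finally show ?thesis by (simp add: S_def)
qed

lemma inverse_square_diff_bound:
  fixes a b :: complex
  assumes \<rho>: "\<rho> > 0" and ab: "\<rho> \<le> cmod a" "\<rho> \<le> cmod b"
  shows "cmod (1 / a\<^sup>2 - 1 / b\<^sup>2) \<le> 2 / \<rho> ^ 3 * cmod (a - b)"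
proof -
  have nz: "a \<noteq> 0" "b \<noteq> 0" using assms by auto
  define A where "A = 1 / a"
  define B where "B = 1 / b"
  have AB: "cmod A \<le> 1 / \<rho>" "cmod B \<le> 1 / \<rho>"
    unfolding A_def B_def norm_divide norm_one using assms by (intro frac_le; simp)+
  have "1 / a\<^sup>2 - 1 / b\<^sup>2 = - (A * B) * (A + B) * (a - b)"
    using nz by (simp add: A_def B_def field_simps power2_eq_square)
  hence "cmod (1 / a\<^sup>2 - 1 / b\<^sup>2) = cmod A * cmod B * cmod (A + B) * cmod (a - b)"
    by (simp only: norm_mult norm_minus_cancel)
  also have "\<dots> \<le> (1 / \<rho>) * (1 / \<rho>) * (1 / \<rho> + 1 / \<rho>) * cmod (a - b)"
    using AB \<rho> by (intro mult_right_mono mult_mono order.trans[OF norm_triangle_ineq] add_mono) auto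
  also have "\<dots> = 2 / \<rho> ^ 3 * cmod (a - b)" by (simp add: power3_eq_cube)
  finally show ?thesis .
qed

lemma energy_hess_sym: "energy_hess m n \<zeta> u p q = energy_hess m n \<zeta> u q p"
  by (simp add: energy_hess_def power2_commute[of "u p"])

text \<open>
  The diagonal entries of order \<open>s\<^sup>2\<close> at the exceptional zeros dominate all entries coupling them
  to other zeros, whose squares add up to \<open>O(s)\<close> only. The remaining block of the regular zeros is
  negative definite up to an error \<open>O(1 / s)\<close>.
\<close>

lemma energy_hess_kernel_trivial:
  fixes z \<zeta> :: "nat \<Rightarrow> complex" and x yr :: "nat \<Rightarrow> real" and yc :: "nat \<Rightarrow> complex"
  assumes \<rho>: "\<rho> > 0" and C: "C \<ge> 0" and s: "s \<ge> 1"
    and s1: "4 * real m * C / \<rho> ^ 3 \<le> s"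
    and s2: "(C + 1)\<^sup>2 * (2 + 4 * real m / \<rho>\<^sup>2 + 2 * C + real m * (2 + 4 * C) / \<rho>\<^sup>2) < 2 * s"
    and conf: "near_configuration \<rho> C s H m n z x \<zeta>"
    and u: "\<And>p. u p = (if p < m then z p else of_real (x (p - m)))"
    and Y: "\<And>p. Y p = (if p < m then yc p else of_real (yr (p - m)))"
    and eqz: "\<And>k. k < m \<Longrightarrow> (\<Sum>q<m + n. energy_hess m n \<zeta> u k q * Y q) = 0"
    and eqx: "\<And>i. i < n \<Longrightarrow> Re (\<Sum>q<m + n. energy_hess m n \<zeta> u (m + i) q * Y q) = 0"
    and p: "p < m + n"
  shows "Y p = 0"
proof -
  have \<zeta>_Im: "2 * \<rho> \<le> \<bar>Im (\<zeta> k)\<bar>" and z\<zeta>: "cmod (z k - \<zeta> k) \<le> \<rho>" "z k \<noteq> \<zeta> k" "cmod (z k - \<zeta> k) * s \<le> C"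
    and sum_le: "(\<Sum>i<n. 1 / (cmod (of_real (x i) - z k))\<^sup>2) \<le> C * s" if "k < m" for k
    using conf that by (auto simp: near_configuration_def)
  have \<zeta>_dist: "4 * \<rho> \<le> cmod (\<zeta> k - \<zeta> l)" if "k < m" "l < m" "k \<noteq> l" for k l
    using conf that by (auto simp: near_configuration_def)
  have x\<zeta>: "\<rho> \<le> cmod (of_real (x i) - \<zeta> k)" if "k < m" for i k
    using \<zeta>_Im[OF that] abs_Im_le_cmod[of "of_real (x i) - \<zeta> k"] \<rho> by simp
  have xz: "\<rho> \<le> cmod (of_real (x i) - z k)" if "k < m" for i k
    using \<zeta>_Im[OF that] z\<zeta>(1)[OF that] abs_Im_le_cmod[of "of_real (x i) - z k"] abs_Im_le_cmod[of "z k - \<zeta> k"] \<rho> by simp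
  have z\<zeta>_dist: "\<rho> \<le> cmod (z k - \<zeta> l)" if "k < m" "l < m" "k \<noteq> l" for k l
    using \<zeta>_dist[OF that] z\<zeta>(1)[OF that(1)] norm_triangle_ineq4[of "z k - \<zeta> l" "z k - \<zeta> k"] \<rho> by simp
  have zz_dist: "\<rho> \<le> cmod (z k - z l)" if "k < m" "l < m" "k \<noteq> l" for k l
  proof -
    have "cmod (\<zeta> k - \<zeta> l) \<le> cmod (z k - \<zeta> l) + cmod (z k - \<zeta> k)"
      using norm_triangle_ineq4[of "z k - \<zeta> l" "z k - \<zeta> k"] by simp
    moreover have "cmod (z k - \<zeta> l) \<le> cmod (z k - z l) + cmod (z l - \<zeta> l)"
      using norm_triangle_ineq[of "z k - z l" "z l - \<zeta> l"] by simp
    ultimately show ?thesis using \<zeta>_dist[OF that] z\<zeta>(1)[OF that(1)] z\<zeta>(1)[OF that(2)] \<rho> by linarith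
  qed
  \<comment> \<open>\<open>A\<close> is a Euclidean norm, matched to the quadratic form of the
    regular block; \<open>B\<close> sums over the fixed number \<open>m\<close> of exceptional
    entries. \<open>\<theta>\<^sup>2\<close> bounds the sum of all \<open>|x i - z k|^(-4)\<close>,
    by \<open>sum_le\<close> and the distance \<open>\<rho>\<close>.\<close>
  define A where "A = sqrt (\<Sum>i<n. (yr i)\<^sup>2)"
  define B where "B = (\<Sum>k<m. cmod (yc k))"
  define \<theta> where "\<theta> = sqrt (C * s / \<rho>\<^sup>2)"
  have A0: "A \<ge> 0" and B0: "B \<ge> 0" and \<theta>0: "\<theta> \<ge> 0"
    using C s by (auto simp: A_def B_def \<theta>_def intro!: sum_nonneg)
  have A2: "A\<^sup>2 = (\<Sum>i<n. (yr i)\<^sup>2)" by (simp add: A_def sum_nonneg)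
  have \<theta>2: "\<theta>\<^sup>2 = C * s / \<rho>\<^sup>2" using C s by (simp add: \<theta>_def)
  have cs: "(\<Sum>i<n. \<bar>yr i\<bar> * (1 / (cmod (of_real (x i) - z k))\<^sup>2)) \<le> A * \<theta>" if k: "k < m" for k
  proof -
    define g where "g = (\<lambda>i. 1 / (cmod (of_real (x i) - z k))\<^sup>2)"
    have g_le: "(g i)\<^sup>2 \<le> 1 / \<rho>\<^sup>2 * g i" for i
    proof -
      have "\<rho>\<^sup>2 \<le> (cmod (of_real (x i) - z k))\<^sup>2" using xz[OF k, of i] \<rho> by (intro power_mono) auto
      hence "g i \<le> 1 / \<rho>\<^sup>2" unfolding g_def using \<rho> by (intro frac_le) auto
      thus ?thesis unfolding power2_eq_square[of "g i"] by (intro mult_right_mono) (auto simp: g_def)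
    qed
    have "(\<Sum>i<n. \<bar>yr i\<bar> * g i)\<^sup>2 \<le> (\<Sum>i<n. \<bar>yr i\<bar>\<^sup>2) * (\<Sum>i<n. (g i)\<^sup>2)"
      by (rule Cauchy_Schwarz_ineq_sum)
    also have "\<dots> \<le> A\<^sup>2 * \<theta>\<^sup>2"
    proof (rule mult_mono)
      have "(\<Sum>i<n. (g i)\<^sup>2) \<le> 1 / \<rho>\<^sup>2 * (\<Sum>i<n. g i)" unfolding sum_distrib_left by (intro sum_mono g_le)
      also have "\<dots> \<le> 1 / \<rho>\<^sup>2 * (C * s)" using sum_le[OF k] by (intro mult_left_mono) (auto simp: g_def)
      finally show "(\<Sum>i<n. (g i)\<^sup>2) \<le> \<theta>\<^sup>2" by (simp add: \<theta>2)
    qed (auto simp: A2 sum_nonneg)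
    finally have "(\<Sum>i<n. \<bar>yr i\<bar> * g i)\<^sup>2 \<le> (A * \<theta>)\<^sup>2" by (simp add: power_mult_distrib)
    hence "(\<Sum>i<n. \<bar>yr i\<bar> * g i) \<le> A * \<theta>"
      by (rule power2_le_imp_le) (rule mult_nonneg_nonneg[OF A0 \<theta>0])
    thus ?thesis by (simp only: g_def)
  qed
  have AB: "A \<le> 2 * \<theta> * B"
  proof -
    \<comment> \<open>On the diagonal of the regular block the zeros of \<open>H\<close> and the
      exceptional zeros enter with opposite signs and nearly cancel: each pair leaves
      \<open>O(1 / s)\<close>. The hypothesis \<open>s1\<close> makes the total at most one
      half.\<close>
    define D where "D = (\<lambda>i. (\<Sum>k<m. 1 / (of_real (x i) - \<zeta> k)\<^sup>2) - (\<Sum>k<m. 1 / (of_real (x i) - z k)\<^sup>2))"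
    define g where "g = (\<lambda>i j. 1 / (x i - x j)\<^sup>2)"
    define V where "V = (\<lambda>i. \<Sum>k<m. 2 / (of_real (x i) - z k)\<^sup>2 * yc k)"
    have D_le: "2 * cmod (D i) \<le> 1" for i
    proof -
      have "cmod (D i) \<le> (\<Sum>k<m. 2 / \<rho> ^ 3 * (C / s))"
        unfolding D_def sum_subtractf[symmetric]
      proof (rule sum_norm_le)
        fix k assume "k \<in> {..<m}"
        hence k: "k < m" by simp
        have "cmod (1 / (of_real (x i) - \<zeta> k)\<^sup>2 - 1 / (of_real (x i) - z k)\<^sup>2) \<le> 2 / \<rho> ^ 3 * cmod (z k - \<zeta> k)"
          using inverse_square_diff_bound[OF \<rho> x\<zeta>[OF k] xz[OF k], of i i] by simp
        also have "\<dots> \<le> 2 / \<rho> ^ 3 * (C / s)" using z\<zeta>(3)[OF k] s \<rho> by (intro mult_left_mono) (auto simp: field_simps)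
        finally show "cmod (1 / (of_real (x i) - \<zeta> k)\<^sup>2 - 1 / (of_real (x i) - z k)\<^sup>2) \<le> 2 / \<rho> ^ 3 * (C / s)" .
      qed
      hence "2 * cmod (D i) \<le> (4 * real m * C / \<rho> ^ 3) / s" by simp
      also have "\<dots> \<le> 1" using s1 s by (subst pos_divide_le_eq) auto
      finally show ?thesis .
    qed
    have row: "- 2 * yr i + 2 * Re (D i) * yr i + 2 * (\<Sum>j<n. g i j * (yr j - yr i)) + Re (V i) = 0" if i: "i < n" for i
    proof -
      have diag: "energy_hess m n \<zeta> u (m + i) (m + i) = - 2 + 2 * D i - 2 * (\<Sum>j<n. of_real (g i j))"
        by (simp add: energy_hess_def u D_def sum_lessThan_add g_def algebra_simps)
      have "(\<Sum>q<m + n. energy_hess m n \<zeta> u (m + i) q * Y q) =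
         V i + (\<Sum>j<n. energy_hess m n \<zeta> u (m + i) (m + j) * of_real (yr j))"
        unfolding sum_lessThan_add by (intro arg_cong2[of _ _ _ _ "(+)"]) (auto simp: V_def Y energy_hess_def u intro!: sum.cong)
      also have "(\<Sum>j<n. energy_hess m n \<zeta> u (m + i) (m + j) * of_real (yr j)) =
         (\<Sum>j<n. 2 * of_real (g i j * yr j) + (if j = i then (- 2 + 2 * D i - 2 * (\<Sum>j<n. of_real (g i j))) * of_real (yr i) else 0))"
      proof (rule sum.cong[OF refl])
        fix j
        show "energy_hess m n \<zeta> u (m + i) (m + j) * of_real (yr j) =
          2 * of_real (g i j * yr j) + (if j = i then (- 2 + 2 * D i - 2 * (\<Sum>j<n. of_real (g i j))) * of_real (yr i) else 0)"
          using diag by (cases "j = i") (auto simp: energy_hess_def u g_def)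
      qed
      also have "\<dots> = 2 * of_real (\<Sum>j<n. g i j * yr j) + (- 2 + 2 * D i - 2 * of_real (\<Sum>j<n. g i j)) * of_real (yr i)"
        using i by (simp add: sum.distrib sum_distrib_left)
      finally have "Re (V i + (2 * of_real (\<Sum>j<n. g i j * yr j) + (- 2 + 2 * D i - 2 * of_real (\<Sum>j<n. g i j)) * of_real (yr i))) = 0"
        using eqx[OF i] by simp
      moreover have "(\<Sum>j<n. g i j * (yr j - yr i)) = (\<Sum>j<n. g i j * yr j) - (\<Sum>j<n. g i j) * yr i"
        by (simp add: right_diff_distrib sum_subtractf sum_distrib_right)
      ultimately show ?thesis by (simp add: algebra_simps)
    qed
    \<comment> \<open>Testing the rows against \<open>yr\<close>: the Laplacian has the favourable
      sign and \<open>D\<close> costs at most \<open>A\<^sup>2\<close>, which leaves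
      \<open>A\<^sup>2 \<le> 2 * A * \<theta> * B\<close>.\<close>
    have "(\<Sum>i<n. yr i * (- 2 * yr i + 2 * Re (D i) * yr i + 2 * (\<Sum>j<n. g i j * (yr j - yr i)) + Re (V i))) = 0"
      using row by simp
    hence "2 * A\<^sup>2 = (\<Sum>i<n. 2 * Re (D i) * (yr i)\<^sup>2) + 2 * (\<Sum>i<n. \<Sum>j<n. g i j * (yr i * yr j - yr i * yr i)) + (\<Sum>i<n. yr i * Re (V i))"
      unfolding A2 by (simp add: algebra_simps sum.distrib sum_subtractf sum_negf sum_distrib_left power2_eq_square)
    also have "(\<Sum>i<n. \<Sum>j<n. g i j * (yr i * yr j - yr i * yr i)) \<le> 0"
      by (rule sum_laplacian_nonpos) (auto simp: g_def power2_commute)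
    also have "(\<Sum>i<n. 2 * Re (D i) * (yr i)\<^sup>2) \<le> (\<Sum>i<n. 1 * (yr i)\<^sup>2)"
    proof (intro sum_mono mult_right_mono)
      fix i show "2 * Re (D i) \<le> 1" using D_le[of i] complex_Re_le_cmod[of "D i"] by linarith
    qed auto
    also have "(\<Sum>i<n. 1 * (yr i)\<^sup>2) = A\<^sup>2" by (simp add: A2)
    also have "(\<Sum>i<n. yr i * Re (V i)) \<le> (\<Sum>i<n. \<Sum>k<m. 2 * cmod (yc k) * (\<bar>yr i\<bar> * (1 / (cmod (of_real (x i) - z k))\<^sup>2)))"
    proof (rule sum_mono)
      fix i
      have "yr i * Re (V i) \<le> \<bar>yr i\<bar> * cmod (V i)"
        using abs_Re_le_cmod[of "V i"] by (metis abs_ge_self abs_ge_zero abs_mult mult_left_mono order_trans)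
      also have "\<dots> \<le> \<bar>yr i\<bar> * (\<Sum>k<m. 2 / (cmod (of_real (x i) - z k))\<^sup>2 * cmod (yc k))"
        unfolding V_def by (intro mult_left_mono sum_norm_le) (auto simp: norm_mult norm_divide norm_power)
      also have "\<dots> = (\<Sum>k<m. 2 * cmod (yc k) * (\<bar>yr i\<bar> * (1 / (cmod (of_real (x i) - z k))\<^sup>2)))"
        unfolding sum_distrib_left by (intro sum.cong refl) simp
      finally show "yr i * Re (V i) \<le> (\<Sum>k<m. 2 * cmod (yc k) * (\<bar>yr i\<bar> * (1 / (cmod (of_real (x i) - z k))\<^sup>2)))" .
    qed
    also have "\<dots> = (\<Sum>k<m. 2 * cmod (yc k) * (\<Sum>i<n. \<bar>yr i\<bar> * (1 / (cmod (of_real (x i) - z k))\<^sup>2)))"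
      unfolding sum_distrib_left by (rule sum.swap)
    also have "\<dots> \<le> (\<Sum>k<m. 2 * cmod (yc k) * (A * \<theta>))"
      using cs by (intro sum_mono mult_left_mono) auto
    also have "\<dots> = A * (2 * \<theta> * B)" by (simp add: B_def sum_distrib_left sum_distrib_right mult_ac)
    finally have "A * A \<le> A * (2 * \<theta> * B)" by (simp add: power2_eq_square)
    thus ?thesis using A0 B0 \<theta>0 by (cases "A = 0") (auto simp: mult_le_cancel_left_pos)
  qed
  \<comment> \<open>The first term comes from \<open>2 / (z k - \<zeta> k)\<^sup>2\<close>, the
    others bound the rest of the diagonal entry. \<open>C + 1\<close> instead of \<open>C\<close> in
    the denominator allows \<open>C = 0\<close>.\<close>
  define \<Lambda> where "\<Lambda> = 2 * s\<^sup>2 / (C + 1)\<^sup>2 - 2 - 4 * real m / \<rho>\<^sup>2 - 2 * C * s"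
  have inv_le: "cmod (1 / a\<^sup>2) \<le> 1 / \<rho>\<^sup>2" if "\<rho> \<le> cmod a" for a
    using that \<rho> unfolding norm_divide norm_power norm_one by (intro frac_le power_mono) auto
  have diag_ge: "\<Lambda> \<le> cmod (energy_hess m n \<zeta> u k k)" if k: "k < m" for k
  proof -
    define E where "E = - 2 + 2 * (\<Sum>l\<in>{..<m} - {k}. 1 / (z k - \<zeta> l)\<^sup>2) - 2 * (\<Sum>l<m. 1 / (z k - z l)\<^sup>2) - 2 * (\<Sum>i<n. 1 / (z k - of_real (x i))\<^sup>2)"
    have "(\<Sum>l<m. 1 / (z k - \<zeta> l)\<^sup>2) = 1 / (z k - \<zeta> k)\<^sup>2 + (\<Sum>l\<in>{..<m} - {k}. 1 / (z k - \<zeta> l)\<^sup>2)"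
      by (rule sum.remove) (use k in auto)
    hence eq: "energy_hess m n \<zeta> u k k = 2 * (1 / (z k - \<zeta> k)\<^sup>2) + E"
      using k by (simp add: energy_hess_def u sum_lessThan_add E_def algebra_simps)
    have "s / (C + 1) \<le> 1 / cmod (z k - \<zeta> k)"
      using z\<zeta>(2,3)[OF k] C s by (simp add: field_simps)
    hence "(s / (C + 1))\<^sup>2 \<le> (1 / cmod (z k - \<zeta> k))\<^sup>2" using C s by (intro power_mono) auto
    hence big: "2 * s\<^sup>2 / (C + 1)\<^sup>2 \<le> cmod (2 * (1 / (z k - \<zeta> k)\<^sup>2))"
      by (simp add: norm_divide norm_power power_divide)
    have "cmod (\<Sum>l\<in>{..<m} - {k}. 1 / (z k - \<zeta> l)\<^sup>2) \<le> (\<Sum>l\<in>{..<m} - {k}. 1 / \<rho>\<^sup>2)"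
      by (intro sum_norm_le inv_le z\<zeta>_dist) (use k in auto)
    also have "\<dots> \<le> real m / \<rho>\<^sup>2"
    proof -
      have "card ({..<m} - {k}) \<le> m" using card_mono[of "{..<m}" "{..<m} - {k}"] by simp
      hence "real (card ({..<m} - {k})) * (1 / \<rho>\<^sup>2) \<le> real m * (1 / \<rho>\<^sup>2)" by (intro mult_right_mono) auto
      thus ?thesis by simp
    qed
    finally have e1: "cmod (\<Sum>l\<in>{..<m} - {k}. 1 / (z k - \<zeta> l)\<^sup>2) \<le> real m / \<rho>\<^sup>2" .
    have "cmod (\<Sum>l<m. 1 / (z k - z l)\<^sup>2) \<le> (\<Sum>l<m. 1 / \<rho>\<^sup>2)"
    proof (rule sum_norm_le)
      fix l assume "l \<in> {..<m}"
      thus "cmod (1 / (z k - z l)\<^sup>2) \<le> 1 / \<rho>\<^sup>2"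
        using inv_le[OF zz_dist[of k l]] k by (cases "k = l") auto
    qed
    hence e2: "cmod (\<Sum>l<m. 1 / (z k - z l)\<^sup>2) \<le> real m / \<rho>\<^sup>2" by simp
    have "cmod (\<Sum>i<n. 1 / (z k - of_real (x i))\<^sup>2) \<le> (\<Sum>i<n. 1 / (cmod (of_real (x i) - z k))\<^sup>2)"
      by (rule sum_norm_le) (simp add: norm_divide norm_power norm_minus_commute)
    also have "\<dots> \<le> C * s" by (rule sum_le[OF k])
    finally have e3: "cmod (\<Sum>i<n. 1 / (z k - of_real (x i))\<^sup>2) \<le> C * s" .
    have tri: "cmod (- 2 + 2 * a - 2 * b - 2 * c) \<le> 2 + 2 * cmod a + 2 * cmod b + 2 * cmod c" for a b c
    proof -
      have "cmod (- 2 + 2 * a - 2 * b - 2 * c) \<le> cmod (- 2 + 2 * a) + cmod (2 * b) + cmod (2 * c)"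
        by (rule order.trans[OF norm_triangle_ineq4 add_right_mono[OF norm_triangle_ineq4]])
      also have "cmod (- 2 + 2 * a) \<le> cmod (- 2) + cmod (2 * a)" by (rule norm_triangle_ineq)
      finally show ?thesis by (simp add: norm_mult)
    qed
    have "cmod E \<le> 2 + 2 * (real m / \<rho>\<^sup>2) + 2 * (real m / \<rho>\<^sup>2) + 2 * (C * s)"
      unfolding E_def using tri e1 e2 e3 by (smt (verit))
    moreover have "cmod (2 * (1 / (z k - \<zeta> k)\<^sup>2)) \<le> cmod (energy_hess m n \<zeta> u k k) + cmod E"
      unfolding eq using norm_triangle_ineq4[of "2 * (1 / (z k - \<zeta> k)\<^sup>2) + E" E] by simp
    ultimately show ?thesis using big by (simp add: \<Lambda>_def)
  qed
  \<comment> \<open>\<open>2 / \<rho>\<^sup>2\<close> comes from the other exceptional zeros. The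
    regular ones contribute at most \<open>2 * A * \<theta>\<close>, and
    \<open>A \<le> 2 * \<theta> * B\<close> turns this into
    \<open>4 * \<theta>\<^sup>2 * B\<close>.\<close>
  have row_le: "\<Lambda> * cmod (yc k) \<le> (2 / \<rho>\<^sup>2 + 4 * \<theta>\<^sup>2) * B" if k: "k < m" for k
  proof -
    define V where "V = (\<Sum>l\<in>{..<m} - {k}. 2 / (z k - z l)\<^sup>2 * yc l)"
    define W where "W = (\<Sum>i<n. 2 / (z k - of_real (x i))\<^sup>2 * of_real (yr i))"
    have "0 = (\<Sum>q<m + n. energy_hess m n \<zeta> u k q * Y q)" using eqz[OF k] by simp
    also have "\<dots> = (\<Sum>l<m. energy_hess m n \<zeta> u k l * yc l) + W"
      unfolding sum_lessThan_add
      by (intro arg_cong2[of _ _ _ _ "(+)"]) (use k in \<open>auto simp: W_def Y energy_hess_def u intro!: sum.cong\<close>)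
    also have "(\<Sum>l<m. energy_hess m n \<zeta> u k l * yc l) = energy_hess m n \<zeta> u k k * yc k + (\<Sum>l\<in>{..<m} - {k}. energy_hess m n \<zeta> u k l * yc l)"
      by (rule sum.remove) (use k in auto)
    also have "(\<Sum>l\<in>{..<m} - {k}. energy_hess m n \<zeta> u k l * yc l) = V"
      unfolding V_def using k by (intro sum.cong refl) (auto simp: energy_hess_def u)
    finally have "energy_hess m n \<zeta> u k k * yc k + (V + W) = 0" by (simp only: add.assoc)
    hence "energy_hess m n \<zeta> u k k * yc k = - (V + W)" by (simp only: eq_neg_iff_add_eq_0)
    hence "cmod (energy_hess m n \<zeta> u k k) * cmod (yc k) = cmod (V + W)" by (metis norm_minus_cancel norm_mult)
    moreover have "\<Lambda> * cmod (yc k) \<le> cmod (energy_hess m n \<zeta> u k k) * cmod (yc k)"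
      using diag_ge[OF k] by (intro mult_right_mono) auto
    moreover have "cmod (V + W) \<le> cmod V + cmod W" by (rule norm_triangle_ineq)
    moreover have "cmod V \<le> 2 / \<rho>\<^sup>2 * B"
    proof -
      have "cmod V \<le> (\<Sum>l\<in>{..<m} - {k}. 2 / \<rho>\<^sup>2 * cmod (yc l))"
        unfolding V_def
      proof (rule sum_norm_le)
        fix l assume "l \<in> {..<m} - {k}"
        hence "cmod (1 / (z k - z l)\<^sup>2) \<le> 1 / \<rho>\<^sup>2" using k by (intro inv_le zz_dist) auto
        hence "2 * cmod (1 / (z k - z l)\<^sup>2) * cmod (yc l) \<le> 2 * (1 / \<rho>\<^sup>2) * cmod (yc l)"
          by (intro mult_right_mono mult_left_mono) auto
        thus "cmod (2 / (z k - z l)\<^sup>2 * yc l) \<le> 2 / \<rho>\<^sup>2 * cmod (yc l)"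
          by (simp add: norm_mult norm_divide norm_power)
      qed
      also have "\<dots> \<le> (\<Sum>l<m. 2 / \<rho>\<^sup>2 * cmod (yc l))" using \<rho> by (intro sum_mono2) auto
      finally show ?thesis by (simp add: B_def sum_distrib_left)
    qed
    moreover have "cmod W \<le> 4 * \<theta>\<^sup>2 * B"
    proof -
      have "cmod W \<le> (\<Sum>i<n. 2 * (\<bar>yr i\<bar> * (1 / (cmod (of_real (x i) - z k))\<^sup>2)))"
        unfolding W_def
        by (rule sum_norm_le) (simp add: norm_mult norm_divide norm_power norm_minus_commute)
      also have "\<dots> = 2 * (\<Sum>i<n. \<bar>yr i\<bar> * (1 / (cmod (of_real (x i) - z k))\<^sup>2))" by (simp only: sum_distrib_left)
      also have "\<dots> \<le> 2 * (A * \<theta>)" using cs[OF k] by simp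
      also have "\<dots> \<le> 2 * (2 * \<theta> * B * \<theta>)" using AB \<theta>0 by (intro mult_left_mono mult_right_mono) auto
      finally show ?thesis by (simp add: power2_eq_square mult_ac)
    qed
    ultimately show ?thesis by (simp add: distrib_right)
  qed
  have "B = 0"
  proof (rule ccontr)
    assume "B \<noteq> 0"
    with B0 have B: "B > 0" by simp
    have "\<Lambda> * B = (\<Sum>k<m. \<Lambda> * cmod (yc k))" by (simp add: B_def sum_distrib_left)
    also have "\<dots> \<le> (\<Sum>k<m. (2 / \<rho>\<^sup>2 + 4 * \<theta>\<^sup>2) * B)" using row_le by (intro sum_mono) auto
    also have "\<dots> = real m * (2 / \<rho>\<^sup>2 + 4 * \<theta>\<^sup>2) * B" by simp
    finally have le: "\<Lambda> \<le> real m * (2 / \<rho>\<^sup>2 + 4 * \<theta>\<^sup>2)" using B by simp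
    \<comment> \<open>For \<open>s \<ge> 1\<close> all terms below the order
      \<open>s\<^sup>2\<close> add up to at most \<open>c * s\<close>, so the row bounds summed over
      \<open>k\<close> contradict the hypothesis \<open>s2\<close>.\<close>
    define c where "c = 2 + 4 * real m / \<rho>\<^sup>2 + 2 * C + real m * (2 + 4 * C) / \<rho>\<^sup>2"
    have "2 * s\<^sup>2 / (C + 1)\<^sup>2 \<le> 2 + 4 * real m / \<rho>\<^sup>2 + 2 * C * s + real m * (2 / \<rho>\<^sup>2 + 4 * \<theta>\<^sup>2)"
      using le unfolding \<Lambda>_def diff_le_eq by (simp only: ac_simps)
    also have "\<dots> = (2 + 4 * real m / \<rho>\<^sup>2 + real m * 2 / \<rho>\<^sup>2) * 1 + (2 * C + real m * (4 * C) / \<rho>\<^sup>2) * s"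
      by (simp add: \<theta>2 distrib_left algebra_simps)
    also have "\<dots> \<le> (2 + 4 * real m / \<rho>\<^sup>2 + real m * 2 / \<rho>\<^sup>2) * s + (2 * C + real m * (4 * C) / \<rho>\<^sup>2) * s"
      using s by (intro add_right_mono mult_left_mono) auto
    also have "\<dots> = c * s" by (simp add: c_def distrib_left distrib_right add_divide_distrib)
    finally have "2 * s\<^sup>2 \<le> c * s * (C + 1)\<^sup>2" using C by (simp add: field_simps)
    hence "s * (2 * s) \<le> s * ((C + 1)\<^sup>2 * c)" by (simp add: power2_eq_square mult_ac)
    hence "2 * s \<le> (C + 1)\<^sup>2 * c" using s by (simp add: mult_le_cancel_left_pos)
    thus False using s2 unfolding c_def[symmetric] by linarith
  qed
  hence "A = 0" using AB A0 by simp
  show "Y p = 0"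
  proof (cases "p < m")
    case True
    have "cmod (yc p) \<le> B" unfolding B_def by (rule member_le_sum) (use True in auto)
    thus ?thesis using \<open>B = 0\<close> True by (simp add: Y)
  next
    case False
    have "(\<Sum>i<n. (yr i)\<^sup>2) = 0" using \<open>A = 0\<close> A2 by simp
    hence "\<forall>i<n. (yr i)\<^sup>2 = 0" by (subst (asm) sum_nonneg_eq_0_iff) auto
    moreover have "p - m < n" using False p by simp
    ultimately show ?thesis using False by (simp add: Y)
  qed
qed

lemma near_configuration_admissible:
  assumes "\<rho> > 0" and conf: "near_configuration \<rho> C s H m n z x \<zeta>"
  shows "admissible m n \<zeta> (position m (point_of m z x))"
proof -
  have \<zeta>_Im: "2 * \<rho> \<le> \<bar>Im (\<zeta> k)\<bar>" and z\<zeta>: "cmod (z k - \<zeta> k) \<le> \<rho>" "z k \<noteq> \<zeta> k" if "k < m" for k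
    using conf that by (auto simp: near_configuration_def)
  have \<zeta>_dist: "4 * \<rho> \<le> cmod (\<zeta> k - \<zeta> l)" if "k < m" "l < m" "k \<noteq> l" for k l
    using conf that by (auto simp: near_configuration_def)
  have injx: "inj_on x {..<n}" using conf by (simp add: near_configuration_def)
  have Im_z: "Im (z k) \<noteq> 0" if "k < m" for k
    using \<zeta>_Im[OF that] z\<zeta>(1)[OF that] abs_Im_le_cmod[of "z k - \<zeta> k"] assms(1) by auto
  have Im_\<zeta>: "Im (\<zeta> k) \<noteq> 0" if "k < m" for k using \<zeta>_Im[OF that] assms(1) by auto
  have z_\<zeta>: "z k \<noteq> \<zeta> l" if "k < m" "l < m" for k l
    using z\<zeta>[OF that(1)] \<zeta>_dist[OF that] assms(1) by (cases "k = l") (auto simp: norm_minus_commute)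
  have z_z: "z k \<noteq> z l" if "k < m" "l < m" "k \<noteq> l" for k l
  proof
    assume "z k = z l"
    hence "cmod (\<zeta> k - \<zeta> l) \<le> cmod (z l - \<zeta> l) + cmod (z k - \<zeta> k)"
      using norm_triangle_ineq4[of "z l - \<zeta> l" "z k - \<zeta> k"] by simp
    thus False using \<zeta>_dist[OF that] z\<zeta>(1)[OF that(1)] z\<zeta>(1)[OF that(2)] assms(1) by linarith
  qed
  show ?thesis
    unfolding admissible_def
  proof (intro conjI allI impI)
    fix p k assume "p < m + n" "k < m"
    thus "position m (point_of m z x) p \<noteq> \<zeta> k"
      using z_\<zeta> Im_\<zeta>[of k] by (auto simp: position_point_of complex_eq_iff)
  next
    fix p q assume pq: "p < m + n" "q < m + n" "p \<noteq> q"
    have "x (p - m) \<noteq> x (q - m)" if "\<not> p < m" "\<not> q < m"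
    proof
      assume eq: "x (p - m) = x (q - m)"
      have "p - m < n" "q - m < n" using pq that by linarith+
      with eq have "p - m = q - m" by (intro inj_onD[OF injx]) auto
      thus False using pq(3) that by linarith
    qed
    thus "position m (point_of m z x) p \<noteq> position m (point_of m z x) q"
      using z_z[of p q] Im_z[of p] Im_z[of q] pq(3)
      by (auto simp: position_point_of complex_eq_iff)
  qed
qed

section \<open>From the trivial kernel to nonsingularity\<close>

lemma invertible_mat_det:
  fixes A :: "'a::field mat"
  assumes "A \<in> carrier_mat n n" "Determinant.det A \<noteq> 0"
  shows "invertible_mat A"
proof -
  obtain B where B: "B \<in> carrier_mat n n" "A * B = 1\<^sub>m n" "B * A = 1\<^sub>m n"
    using det_non_zero_imp_unit[OF assms] by (auto simp: Units_def ring_mat_def)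
  thus ?thesis using assms(1) unfolding invertible_mat_def inverts_mat_def by auto
qed

theorem theorem1:
  fixes lam :: "nat list" and H :: "complex poly" and m :: nat
  assumes "even_partition lam"
    and "H = gen_hermite lam"
    and "m = degree H"
    and "\<forall>a. poly H a = 0 \<longrightarrow> order a H = 1"
  shows "\<exists>n0. \<forall>n\<ge>n0. (\<forall>p\<in>set lam. p \<le> n) \<longrightarrow>
           (\<forall>z x. enumerates_zeros (exc_hermite lam n) m n z x \<longrightarrow>
              invertible_mat (hessian (2 * m + n) (energy H m n) (point_of m z x)))"
proof -
  obtain \<rho> C where \<rho>: "\<rho> > 0" and C: "C \<ge> 0" and near: "\<forall>\<^sub>F n in sequentially. (\<forall>p\<in>set lam. p \<le> n) \<longrightarrow>
     (\<forall>z x. enumerates_zeros (exc_hermite lam n) m n z x \<longrightarrow>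
        (\<exists>\<zeta>. near_configuration \<rho> C (hscale (n + length lam)) H m n z x \<zeta>))"
    using exceptional_zeros_near[OF assms(1,2,4)] unfolding assms(3) by blast
  define c1 where "c1 = 4 * real m * C / \<rho> ^ 3"
  define c2 where "c2 = (C + 1)\<^sup>2 * (2 + 4 * real m / \<rho>\<^sup>2 + 2 * C + real m * (2 + 4 * C) / \<rho>\<^sup>2)"
  have "\<forall>\<^sub>F n in sequentially. hscale (n + length lam) > max 1 (max c1 c2)"
    using hscale_eventually_gt by (rule eventually_sequentially_seg[THEN iffD2])
  with near have "\<forall>\<^sub>F n in sequentially. (\<forall>p\<in>set lam. p \<le> n) \<longrightarrow>
     (\<forall>z x. enumerates_zeros (exc_hermite lam n) m n z x \<longrightarrow>
        invertible_mat (hessian (2 * m + n) (energy H m n) (point_of m z x)))"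
  proof eventually_elim
    case (elim n)
    show ?case
    proof (intro impI allI)
      fix z x assume "\<forall>p\<in>set lam. p \<le> n" "enumerates_zeros (exc_hermite lam n) m n z x"
      with elim(1) obtain \<zeta> where conf: "near_configuration \<rho> C (hscale (n + length lam)) H m n z x \<zeta>" by blast
      define s where "s = hscale (n + length lam)"
      have s: "s \<ge> 1" "c1 \<le> s" "c2 < 2 * s" using elim(2) by (auto simp: s_def)
      define u where "u = position m (point_of m z x)"
      have adm: "admissible m n \<zeta> u" unfolding u_def by (rule near_configuration_admissible[OF \<rho> conf])
      have H: "H \<noteq> 0" "H = smult (lead_coeff H) (\<Prod>k<m. [:- \<zeta> k, 1:])"
        using conf by (auto simp: near_configuration_def)
      define a where "a = (\<lambda>i j. Re (coord_dir m j * (coord_dir m i * energy_hess m n \<zeta> u (coord_index m j) (coord_index m i))))"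
      have hess: "hessian (2 * m + n) (energy H m n) (point_of m z x) = Matrix.mat (2 * m + n) (2 * m + n) (\<lambda>(i, j). a i j)"
        unfolding a_def u_def by (rule hessian_energy[OF H adm[unfolded u_def]])
      have "Determinant.det (Matrix.mat (2 * m + n) (2 * m + n) (\<lambda>(i, j). a i j)) \<noteq> 0"
      proof
        assume "Determinant.det (Matrix.mat (2 * m + n) (2 * m + n) (\<lambda>(i, j). a i j)) = 0"
        then obtain c j0 where c: "j0 < 2 * m + n" "c j0 \<noteq> 0"
          "\<And>i. i < 2 * m + n \<Longrightarrow> (\<Sum>j<2 * m + n. a i j * c j) = 0"
          unfolding det_mat_eq_0_iff by auto
        define T where "T = (\<lambda>p. \<Sum>q<m + n. energy_hess m n \<zeta> u p q * position m c q)"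
        \<comment> \<open>At an exceptional position the directions \<open>1\<close> and
          \<open>\<i>\<close> together give a complex row equation; at a regular position only its
          real part is available.\<close>
        have row: "Re (coord_dir m i * T (coord_index m i)) = 0" if "i < 2 * m + n" for i
        proof -
          have "(\<Sum>j<2 * m + n. a i j * c j) = Re (\<Sum>j<2 * m + n. of_real (c j) * coord_dir m j *
             (coord_dir m i * energy_hess m n \<zeta> u (coord_index m j) (coord_index m i)))"
            unfolding Re_sum a_def by (intro sum.cong refl) (simp add: algebra_simps)
          also have "(\<Sum>j<2 * m + n. of_real (c j) * coord_dir m j *
             (coord_dir m i * energy_hess m n \<zeta> u (coord_index m j) (coord_index m i))) =
             (\<Sum>q<m + n. position m c q * (coord_dir m i * energy_hess m n \<zeta> u q (coord_index m i)))"
            by (rule sum_coord)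
          also have "\<dots> = coord_dir m i * T (coord_index m i)"
            unfolding T_def sum_distrib_left by (intro sum.cong refl) (simp add: energy_hess_sym[of m n \<zeta> u _ "coord_index m i"])
          finally show ?thesis using c(3)[OF that] by simp
        qed
        have "position m c p = 0" if "p < m + n" for p
        proof (rule energy_hess_kernel_trivial[OF \<rho> C s(1) s(2)[unfolded c1_def] s(3)[unfolded c2_def] conf[folded s_def] _ _ _ _ that])
          show "u p = (if p < m then z p else of_real (x (p - m)))" for p
            unfolding u_def by (rule position_point_of)
          show "position m c p = (if p < m then Complex (c (2 * p)) (c (2 * p + 1)) else of_real (c (2 * m + (p - m))))" for p
            by (auto simp: position_def mult_2)
          fix k assume k: "k < m"
          have "Re (T k) = 0" using row[of "2 * k"] k by (simp add: coord_dir_def coord_index_def)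
          moreover have "Im (T k) = 0" using row[of "2 * k + 1"] k by (simp add: coord_dir_def coord_index_def)
          ultimately have "T k = 0" by (simp add: complex_eq_iff)
          thus "(\<Sum>q<m + n. energy_hess m n \<zeta> u k q * position m c q) = 0" by (simp only: T_def)
        next
          fix i assume i: "i < n"
          have "Re (T (m + i)) = 0"
            using row[of "2 * m + i"] i by (simp add: coord_dir_def coord_index_def mult_2)
          thus "Re (\<Sum>q<m + n. energy_hess m n \<zeta> u (m + i) q * position m c q) = 0" by (simp only: T_def)
        qed
        hence pos0: "position m c (coord_index m j0) = 0" using coord_index_less[OF c(1)] by blast
        have "c j0 = 0"
        proof (cases "j0 < 2 * m")
          case True
          hence lt: "j0 div 2 < m" by simp
          hence "c (2 * (j0 div 2)) = 0" "c (2 * (j0 div 2) + 1) = 0"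
            using pos0 True by (simp_all add: coord_index_def position_def complex_eq_iff)
          moreover have "j0 = 2 * (j0 div 2) \<or> j0 = 2 * (j0 div 2) + 1" by presburger
          ultimately show ?thesis by metis
        next
          case False
          hence "m + (j0 - m) = j0" "\<not> j0 - m < m" by simp_all
          thus ?thesis using pos0 False by (simp add: coord_index_def position_def)
        qed
        with c(2) show False by simp
      qed
      thus "invertible_mat (hessian (2 * m + n) (energy H m n) (point_of m z x))"
        unfolding hess by (intro invertible_mat_det) auto
    qed
  qed
  thus ?thesis by (simp add: eventually_sequentially)
qed

end
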